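(* Let $K$ be a field of characteristic zero, let $Z=(z_{i,j})$ be a generic $r\times r$ skew-symmetric matrix, and let $R=K[Z]$, equipped with the lexicographic monomial order $<$ induced by $z_{1,r}>z_{1,r-1}>\dots>z_{1,2}>z_{2,r}>\dots>z_{2,3}>\dots>z_{r-1,r}$. For every integer $t$ with $1\le t\le\lfloor r/2\rfloor$ and every integer $n\ge0$, $$\mathrm{in}_<\big(P_{2t}(Z)^{(n)}\big)=\mathrm{in}_<\big(P_{2t}(Z)\big)^{(n)}.$$
   Context: Generic skew-symmetric means $z_{i,j}=-z_{j,i}$, $z_{i,i}=0$, and the $z_{i,j}$ with $i<j$ are distinct indeterminates; $K[Z]$ is the polynomial ring in them. For $i_1<\dots<i_{2t}$, the principal minor of $Z$ with rows and columns $i_1,\dots,i_{2t}$ is the square of a polynomial, called a $2t$-Pfaffian of $Z$; $P_{2t}(Z)$ is the ideal generated by all $2t$-Pfaffians. $\mathrm{in}_<(I)$ denotes the initial ideal of $I$ with respect to $<$. For an ideal $I$ of $R$ and $n\ge0$, $I^{(n)}=I^nR_S\cap R$, where $S$ is the complement of the union of the minimal primes of $I$. *)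

theory Defs
  imports
    "HOL-Library.Poly_Mapping"
    "HOL-Algebra.Ideal_Product"
    "Jordan_Normal_Form.Determinant"
    "Jordan_Normal_Form.DL_Submatrix"
begin

section \<open>Localization and symbolic powers in a commutative ring\<close>

text \<open>The ring of fractions of \<open>R\<close> with denominators in a multiplicatively closed set \<open>S\<close>: the
  fraction \<open>a/s\<close> is the class of \<open>(a, s)\<close>, where \<open>a/s = b/t\<close> iff \<open>u (t a - s b) = 0\<close> for some
  \<open>u\<close> in \<open>S\<close>.\<close>

definition fraction :: "('a, 'b) ring_scheme \<Rightarrow> 'a set \<Rightarrow> 'a \<Rightarrow> 'a \<Rightarrow> ('a \<times> 'a) set" where
  "fraction R S a s =
     {(b, t). b \<in> carrier R \<and> t \<in> S \<and>
        (\<exists>u\<in>S. u \<otimes>\<^bsub>R\<^esub> (t \<otimes>\<^bsub>R\<^esub> a \<ominus>\<^bsub>R\<^esub> s \<otimes>\<^bsub>R\<^esub> b) = \<zero>\<^bsub>R\<^esub>)}"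

text \<open>The operations are computed on representatives. All representatives give the same class, so
  the unions below are unions of copies of a single class.\<close>

definition localization :: "('a, 'b) ring_scheme \<Rightarrow> 'a set \<Rightarrow> ('a \<times> 'a) set ring" where
  "localization R S =
     \<lparr> carrier = {fraction R S a s | a s. a \<in> carrier R \<and> s \<in> S},
       monoid.mult = (\<lambda>X Y. \<Union>(a, s)\<in>X. \<Union>(b, t)\<in>Y. fraction R S (a \<otimes>\<^bsub>R\<^esub> b) (s \<otimes>\<^bsub>R\<^esub> t)),
       one = fraction R S \<one>\<^bsub>R\<^esub> \<one>\<^bsub>R\<^esub>,
       zero = fraction R S \<zero>\<^bsub>R\<^esub> \<one>\<^bsub>R\<^esub>,
       add = (\<lambda>X Y. \<Union>(a, s)\<in>X. \<Union>(b, t)\<in>Y.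
                fraction R S (t \<otimes>\<^bsub>R\<^esub> a \<oplus>\<^bsub>R\<^esub> s \<otimes>\<^bsub>R\<^esub> b) (s \<otimes>\<^bsub>R\<^esub> t)) \<rparr>"

definition minimal_primes :: "('a, 'b) ring_scheme \<Rightarrow> 'a set \<Rightarrow> 'a set set" where
  "minimal_primes R I =
     {P. primeideal P R \<and> I \<subseteq> P \<and> (\<forall>Q. primeideal Q R \<and> I \<subseteq> Q \<and> Q \<subseteq> P \<longrightarrow> Q = P)}"

text \<open>Powers of \<open>I\<close> are taken in the monoid of ideals of \<open>R\<close>, whose unit is \<open>carrier R\<close>. The set
  \<open>I\<^sup>n R\<^sub>S\<close> is the ideal of the localization generated by the image of \<open>I\<^sup>n\<close>, and the
  intersection with \<open>R\<close> is the preimage under the canonical map \<open>f \<mapsto> f/1\<close>.\<close>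

definition symbolic_power :: "('a, 'b) ring_scheme \<Rightarrow> 'a set \<Rightarrow> nat \<Rightarrow> 'a set" where
  "symbolic_power R I n =
     (let S = carrier R - \<Union>(minimal_primes R I);
          \<iota> = (\<lambda>f. fraction R S f \<one>\<^bsub>R\<^esub>)
      in {f \<in> carrier R. \<iota> f \<in> Idl\<^bsub>localization R S\<^esub> (\<iota> ` (I [^]\<^bsub>ideals_set R\<^esub> n))})"


section \<open>Polynomial rings and initial ideals\<close>

text \<open>Monomials are exponent vectors of type \<open>'x \<Rightarrow>\<^sub>0 nat\<close>; a polynomial maps each monomial to
  its coefficient.\<close>

type_synonym ('x, 'k) mpoly = "('x \<Rightarrow>\<^sub>0 nat) \<Rightarrow>\<^sub>0 'k"

definition mpoly_ring :: "'x set \<Rightarrow> ('x, 'k::comm_ring_1) mpoly ring" where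
  "mpoly_ring V =
     \<lparr> carrier = {f. \<forall>m\<in>Poly_Mapping.keys f. Poly_Mapping.keys m \<subseteq> V},
       monoid.mult = (*), one = 1, zero = 0, add = (+) \<rparr>"

text \<open>\<open>lt\<close> is the strict monomial order. The zero polynomial has no leading monomial.\<close>

definition is_leading_monomial ::
    "(('x \<Rightarrow>\<^sub>0 nat) \<Rightarrow> ('x \<Rightarrow>\<^sub>0 nat) \<Rightarrow> bool) \<Rightarrow> ('x, 'k::zero) mpoly \<Rightarrow> ('x \<Rightarrow>\<^sub>0 nat) \<Rightarrow> bool" where
  "is_leading_monomial lt f m \<longleftrightarrow>
     m \<in> Poly_Mapping.keys f \<and> (\<forall>m'\<in>Poly_Mapping.keys f. m' = m \<or> lt m' m)"

definition initial_ideal ::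
    "'x set \<Rightarrow> (('x \<Rightarrow>\<^sub>0 nat) \<Rightarrow> ('x \<Rightarrow>\<^sub>0 nat) \<Rightarrow> bool) \<Rightarrow>
      ('x, 'k::comm_ring_1) mpoly set \<Rightarrow> ('x, 'k) mpoly set" where
  "initial_ideal V lt I =
     Idl\<^bsub>mpoly_ring V\<^esub> {Poly_Mapping.single m 1 | m. \<exists>f\<in>I. is_leading_monomial lt f m}"

text \<open>\<open>gt v w\<close> says that the variable \<open>v\<close> is bigger than the variable \<open>w\<close>.\<close>

definition lex_less :: "('x \<Rightarrow> 'x \<Rightarrow> bool) \<Rightarrow> ('x \<Rightarrow>\<^sub>0 nat) \<Rightarrow> ('x \<Rightarrow>\<^sub>0 nat) \<Rightarrow> bool" where
  "lex_less gt m m' \<longleftrightarrow>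
     (\<exists>v. Poly_Mapping.lookup m v < Poly_Mapping.lookup m' v \<and>
        (\<forall>w. gt w v \<longrightarrow> Poly_Mapping.lookup m w = Poly_Mapping.lookup m' w))"


section \<open>The generic skew-symmetric matrix and its Pfaffians\<close>

text \<open>Rows and columns are numbered from \<open>0\<close> to \<open>r - 1\<close>, so the pair \<open>(i, j)\<close> with
  \<open>i < j < r\<close> stands for the indeterminate written \<open>z\<^sub>i\<^sub>+\<^sub>1\<^sub>,\<^sub>j\<^sub>+\<^sub>1\<close> with numbering from \<open>1\<close>.\<close>

definition skew_vars :: "nat \<Rightarrow> (nat \<times> nat) set" where
  "skew_vars r = {(i, j). i < j \<and> j < r}"

definition skew_var_greater :: "nat \<times> nat \<Rightarrow> nat \<times> nat \<Rightarrow> bool" where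
  "skew_var_greater v w \<longleftrightarrow> fst v < fst w \<or> fst v = fst w \<and> snd v > snd w"

definition indet :: "'x \<Rightarrow> ('x, 'k::comm_ring_1) mpoly" where
  "indet v = Poly_Mapping.single (Poly_Mapping.single v 1) 1"

definition generic_skew_mat :: "nat \<Rightarrow> (nat \<times> nat, 'k::comm_ring_1) mpoly mat" where
  "generic_skew_mat r =
     mat r r (\<lambda>(i, j). if i < j then indet (i, j) else if j < i then - indet (j, i) else 0)"

text \<open>Square roots of principal minors are determined up to sign, and both signs are included.\<close>

definition pfaffians :: "nat \<Rightarrow> nat \<Rightarrow> (nat \<times> nat, 'k::comm_ring_1) mpoly set" where
  "pfaffians r t =
     {f \<in> carrier (mpoly_ring (skew_vars r)).
        \<exists>A \<subseteq> {..<r}. card A = 2 * t \<and> f ^ 2 = det (submatrix (generic_skew_mat r) A A)}"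

definition pfaffian_ideal :: "nat \<Rightarrow> nat \<Rightarrow> (nat \<times> nat, 'k::comm_ring_1) mpoly set" where
  "pfaffian_ideal r t = Idl\<^bsub>mpoly_ring (skew_vars r)\<^esub> (pfaffians r t)"

end

theory Submission
  imports Defs "HOL-Library.Product_Lexorder" "HOL-Combinatorics.Permutations"
begin

text \<open>Let \<open>k = t - 1\<close>, and say that the variable \<open>(a, b)\<close> nests \<open>(c, d)\<close> if \<open>a < c < d < b\<close>. Substituting
  the generic sum of \<open>k\<close> skew-symmetric matrices of rank two for \<open>Z\<close> kills all \<open>2t\<close>-Pfaffians. On the
  other hand, if the support of the leading monomial of \<open>f\<close> contains no chain of \<open>t\<close> nested variables,
  then it is a union of \<open>k\<close> antichains, one for each summand, and the corresponding monomial of the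
  substituted polynomial cannot cancel. In particular, the leading monomial of a \<open>2t\<close>-Pfaffian is a
  \<open>t\<close>-chain. Hence the Pfaffian ideal \<open>P\<close> is the kernel of the substitution, so it is prime, and
  its initial ideal \<open>M\<close> is the squarefree ideal generated by the \<open>t\<close>-chains. The \<open>n\<close>-th symbolic power of
  \<open>M\<close> is spanned by the monomials that have degree at least \<open>n\<close> outside of every set \<open>F\<close> without
  \<open>t\<close>-chains.

  If the leading monomial of an element of the \<open>n\<close>-th symbolic power of \<open>P\<close> had smaller degree outside
  of \<open>F\<close>, then differentiating with respect to the variables outside of \<open>F\<close> would, in characteristic
  zero, produce an element of \<open>P\<close> whose leading monomial is supported on \<open>F\<close>. Conversely, by
  Greene--Kleitman duality a monomial in the \<open>n\<close>-th symbolic power of \<open>M\<close> is divisible by a product of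
  chains of lengths \<open>s\<^sub>j\<close> such that the numbers \<open>s\<^sub>j - k\<close> add up to at least \<open>n\<close>, and a Schur complement
  shows that a \<open>2s\<close>-Pfaffian lies in the symbolic power of \<open>P\<close> of exponent \<open>s - k\<close>.\<close>

section \<open>Substitution and derivations of polynomials\<close>

text \<open>The main obstacle is that a Pfaffian is given only as a square root of a minor: there is
  no expansion to read a leading term from, and even the existence of the root has to be shown. All
  information comes from three facts: its square is a determinant, it is homogeneous, and it dies in
  lower rank. A \<open>2s\<close>-Pfaffian has degree \<open>s\<close> and vanishes under the
  substitution with \<open>s - 1\<close> summands, so its leading monomial contains \<open>s\<close>
  nested variables, and \<open>2s\<close> indices admit only one such chain. Non-cancellation is a
  statement about tables. A product of entries of the vectors in the summands remembers, for each
  summand, only the row and column sums of a table of exponents. A table supported on an antichain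
  is a staircase, as in the north-west corner rule, and after merging the positions
  \<open>(a, b)\<close> and \<open>(b, a)\<close> it is lexicographically least among the tables
  with its margins. So no smaller monomial of \<open>f\<close> reaches the same image. The numbers
  \<open>s_j - k\<close> are natural in the duality because a chain of length \<open>s_j\<close> has
  at least \<open>s_j - k\<close> elements outside a union of \<open>k\<close> antichains.\<close>

abbreviation keys :: "('a \<Rightarrow>\<^sub>0 'b::zero) \<Rightarrow> 'a set" where
  "keys \<equiv> Poly_Mapping.keys"

abbreviation lookup :: "('a \<Rightarrow>\<^sub>0 'b::zero) \<Rightarrow> 'a \<Rightarrow> 'b" where
  "lookup \<equiv> Poly_Mapping.lookup"

abbreviation single :: "'a \<Rightarrow> 'b \<Rightarrow> ('a \<Rightarrow>\<^sub>0 'b::zero)" where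
  "single \<equiv> Poly_Mapping.single"

lemma in_keysD: "v \<in> keys m \<Longrightarrow> lookup m v \<noteq> 0"
  by (simp add: Poly_Mapping.in_keys_iff)

lemma keys_plus_nat: "keys (m + n :: 'x \<Rightarrow>\<^sub>0 nat) = keys m \<union> keys n"
  by (auto simp: Poly_Mapping.in_keys_iff lookup_add)

lemma lookup_single_if: "lookup (single k a) l = (if k = l then a else 0)"
  by (simp add: lookup_single when_def)

lemma sum_monomials: "(\<Sum>m\<in>keys f. single m (lookup f m)) = f"
proof (rule poly_mapping_eqI)
  fix k
  show "lookup (\<Sum>m\<in>keys f. single m (lookup f m)) k = lookup f k"
    by (cases "k \<in> keys f")
       (auto simp: lookup_sum lookup_single_if sum.delta Poly_Mapping.in_keys_iff if_distrib cong: if_cong)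
qed

lemma mpoly_induct [case_names zero single add]:
  assumes "P 0" and "\<And>m c. P (single m c)" and "\<And>f g. P f \<Longrightarrow> P g \<Longrightarrow> P (f + g)"
  shows "P (f :: 'a \<Rightarrow>\<^sub>0 'b::comm_monoid_add)"
proof -
  have "P (\<Sum>m\<in>A. single m (lookup f m))" if "finite A" for A
    using that by (induction A) (auto intro: assms)
  from this[of "keys f"] show ?thesis by (simp add: sum_monomials)
qed

lemma exponent_induct [case_names zero add]:
  assumes "P 0" and "\<And>m v. P m \<Longrightarrow> P (m + single v 1)"
  shows "P (m :: 'x \<Rightarrow>\<^sub>0 nat)"
proof -
  have pw: "P (m + single v k)" if "P m" for m v k
  proof (induction k)
    case (Suc k)
    have "m + single v (Suc k) = (m + single v k) + single v 1"
      by (simp add: add.assoc flip: single_add)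
    then show ?case using assms(2)[OF Suc] by simp
  qed (use that in simp)
  have "P (n + m)" if "P n" for n
    using that
  proof (induction m arbitrary: n rule: mpoly_induct)
    case (add g h)
    show ?case using add.IH(2)[OF add.IH(1)[OF add.prems]] by (simp add: add.assoc)
  qed (simp_all add: pw)
  from this[OF assms(1)] show ?thesis by simp
qed

text \<open>Substitution, partial derivatives and truncation to some of the monomials are all
  instances, so additivity is proved once. Coefficients enter as constants
  \<open>single 0 c\<close>, since source and target may have different variables.\<close>

definition lin_ext :: "(('x \<Rightarrow>\<^sub>0 nat) \<Rightarrow> ('y, 'k) mpoly) \<Rightarrow> ('x, 'k) mpoly \<Rightarrow> ('y, 'k::comm_ring_1) mpoly"
  where "lin_ext \<phi> f = (\<Sum>m\<in>keys f. single 0 (lookup f m) * \<phi> m)"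

lemma lin_ext_superset:
  assumes "finite A" "keys f \<subseteq> A"
  shows "lin_ext \<phi> f = (\<Sum>m\<in>A. single 0 (lookup f m) * \<phi> m)"
  unfolding lin_ext_def
  by (rule sum.mono_neutral_left) (use assms in \<open>auto simp: Poly_Mapping.in_keys_iff\<close>)

lemma lin_ext_add: "lin_ext \<phi> (f + g) = lin_ext \<phi> f + lin_ext \<phi> g"
proof -
  let ?A = "keys f \<union> keys g"
  have "lin_ext \<phi> h = (\<Sum>m\<in>?A. single 0 (lookup h m) * \<phi> m)" if "h \<in> {f, g, f + g}" for h
    by (rule lin_ext_superset) (use that Poly_Mapping.keys_add[of f g] in auto)
  then show ?thesis
    by (simp add: lookup_add single_add distrib_right sum.distrib)
qed

lemma lin_ext_zero [simp]: "lin_ext \<phi> 0 = 0"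
  by (simp add: lin_ext_def)

lemma lin_ext_single: "lin_ext \<phi> (single m c) = single 0 c * \<phi> m"
  by (simp add: lin_ext_def)

definition subst :: "('x \<Rightarrow> ('y, 'k) mpoly) \<Rightarrow> ('x, 'k) mpoly \<Rightarrow> ('y, 'k::comm_ring_1) mpoly"
  where "subst g = lin_ext (\<lambda>m. \<Prod>v\<in>keys m. g v ^ lookup m v)"

lemma prod_power_add:
  fixes g :: "'x \<Rightarrow> 'a::comm_monoid_mult"
  shows "(\<Prod>v\<in>keys (m + n). g v ^ lookup (m + n) v) =
    (\<Prod>v\<in>keys m. g v ^ lookup m v) * (\<Prod>v\<in>keys n. g v ^ lookup n v)"
proof -
  have *: "(\<Prod>v\<in>keys p. g v ^ lookup p v) = (\<Prod>v\<in>keys m \<union> keys n. g v ^ lookup p v)"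
    if "keys p \<subseteq> keys m \<union> keys n" for p
    by (rule prod.mono_neutral_left) (use that in \<open>auto simp: Poly_Mapping.in_keys_iff\<close>)
  show ?thesis
    by (simp add: * keys_plus_nat lookup_add power_add prod.distrib)
qed

lemma subst_single:
  "subst g (single m c) = single 0 c * (\<Prod>v\<in>keys m. g v ^ lookup m v)"
  by (simp add: subst_def lin_ext_single)

lemma subst_mult_aux:
  fixes g :: "'x \<Rightarrow> ('y, 'k::comm_ring_1) mpoly"
  shows "subst g (f * h) = subst g f * subst g h"
proof (induction f rule: mpoly_induct)
  case zero then show ?case by (simp add: subst_def)
next
  case (single m c)
  show ?case
  proof (induction h rule: mpoly_induct)
    case zero then show ?case by (simp add: subst_def)
  next
    case (single n d)
    have cd: "single 0 (c * d) = (single 0 c * single 0 d :: ('y, 'k) mpoly)"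
      by (simp add: mult_single)
    have "subst g (single m c * single n d) = single 0 (c * d) *
        ((\<Prod>v\<in>keys m. g v ^ lookup m v) * (\<Prod>v\<in>keys n. g v ^ lookup n v))"
      by (simp add: mult_single subst_single prod_power_add)
    then show ?case unfolding subst_single cd by (simp only: mult_ac)
  next
    case (add f g)
    then show ?case by (simp add: subst_def lin_ext_add distrib_left)
  qed
next
  case (add f g)
  then show ?case by (simp add: subst_def lin_ext_add distrib_right)
qed

lemma subst_comm_ring_hom: "comm_ring_hom (subst g)"
proof
  show "subst g 1 = 1"
    using subst_single[of g 0 1] by simp
qed (simp_all add: subst_def lin_ext_add subst_mult_aux[unfolded subst_def])

global_interpretation subst: comm_ring_hom "subst g" for g
  by (rule subst_comm_ring_hom)

declare subst.hom_det [simp del]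

lemma subst_const [simp]: "subst g (single 0 c) = single 0 c"
  by (simp add: subst_single)

lemma subst_indet [simp]: "subst g (indet v) = g v"
  by (simp add: indet_def subst_single)

lemma single_add_indet: "single (m + single v 1) c = single m c * indet v"
  by (simp add: indet_def mult_single)

lemma poly_ring_induct [case_names const indet add mult]:
  assumes const: "\<And>c. P (single 0 c)" and indet: "\<And>v. P (indet v)"
    and add: "\<And>f g. P f \<Longrightarrow> P g \<Longrightarrow> P (f + g)"
    and mult: "\<And>f g. P f \<Longrightarrow> P g \<Longrightarrow> P (f * g)"
  shows "P (f :: ('x, 'k::comm_ring_1) mpoly)"
proof (induction f rule: mpoly_induct)
  case zero
  show ?case using const[of 0] by simp
next
  case (single m c)
  show ?case
  proof (induction m rule: exponent_induct)
    case (add m v)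
    then show ?case using mult[OF add.IH indet] by (simp only: single_add_indet)
  qed (rule const)
qed (rule add)

lemma subst_subst: "subst g (subst h f) = subst (\<lambda>v. subst g (h v)) f"
  by (induction f rule: poly_ring_induct) (simp_all add: subst.hom_add subst.hom_mult)

lemma subst_id [simp]: "subst indet f = f"
  by (induction f rule: poly_ring_induct) (simp_all add: subst.hom_add subst.hom_mult)

section \<open>Polynomials in a given set of variables and their ideals\<close>

lemma carrier_mpoly: "f \<in> carrier (mpoly_ring V) \<longleftrightarrow> (\<forall>m\<in>keys f. keys m \<subseteq> V)"
  by (simp add: mpoly_ring_def)

lemma mpoly_ring_simps [simp]:
  "a \<otimes>\<^bsub>mpoly_ring V\<^esub> b = a * b" "a \<oplus>\<^bsub>mpoly_ring V\<^esub> b = a + b"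
  "\<one>\<^bsub>mpoly_ring V\<^esub> = 1" "\<zero>\<^bsub>mpoly_ring V\<^esub> = 0"
  by (simp_all add: mpoly_ring_def)

lemma carrier_zero [simp]: "0 \<in> carrier (mpoly_ring V)"
  and carrier_one [simp]: "1 \<in> carrier (mpoly_ring V)"
  and carrier_const [simp]: "single 0 c \<in> carrier (mpoly_ring V)"
  by (simp_all add: carrier_mpoly)

lemma carrier_single: "c \<noteq> 0 \<Longrightarrow> single m c \<in> carrier (mpoly_ring V) \<longleftrightarrow> keys m \<subseteq> V"
  by (simp add: carrier_mpoly)

lemma carrier_singleI: "keys m \<subseteq> V \<Longrightarrow> single m c \<in> carrier (mpoly_ring V)"
  by (simp add: carrier_mpoly)

lemma carrier_indet: "v \<in> V \<Longrightarrow> indet v \<in> carrier (mpoly_ring V)"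
  by (simp add: carrier_mpoly indet_def)

lemma carrier_add: "f \<in> carrier (mpoly_ring V) \<Longrightarrow> g \<in> carrier (mpoly_ring V) \<Longrightarrow> f + g \<in> carrier (mpoly_ring V)"
  using Poly_Mapping.keys_add[of f g] by (auto simp: carrier_mpoly)

lemma keys_uminus [simp]: "keys (- f :: 'a \<Rightarrow>\<^sub>0 'b::ab_group_add) = keys f"
  by (auto simp: Poly_Mapping.in_keys_iff)

lemma carrier_uminus: "f \<in> carrier (mpoly_ring V) \<Longrightarrow> - f \<in> carrier (mpoly_ring V)"
  by (auto simp: carrier_mpoly)

lemma carrier_diff: "f \<in> carrier (mpoly_ring V) \<Longrightarrow> g \<in> carrier (mpoly_ring V) \<Longrightarrow> f - g \<in> carrier (mpoly_ring V)"
  using carrier_add[of f V "- g"] carrier_uminus by auto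

lemma keys_multE:
  assumes "m \<in> keys (f * g)"
  obtains a b where "m = a + b" "a \<in> keys f" "b \<in> keys g"
  using assms Poly_Mapping.keys_mult[of f g] by auto

lemma carrier_mult: "f \<in> carrier (mpoly_ring V) \<Longrightarrow> g \<in> carrier (mpoly_ring V) \<Longrightarrow> f * g \<in> carrier (mpoly_ring V)"
  by (fastforce simp: carrier_mpoly keys_plus_nat elim!: keys_multE)

lemma carrier_power: "f \<in> carrier (mpoly_ring V) \<Longrightarrow> f ^ n \<in> carrier (mpoly_ring V)"
  by (induction n) (auto intro: carrier_mult)

lemma carrier_sum: "(\<And>i. i \<in> A \<Longrightarrow> f i \<in> carrier (mpoly_ring V)) \<Longrightarrow> sum f A \<in> carrier (mpoly_ring V)"
  by (induction A rule: infinite_finite_induct) (auto intro: carrier_add)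

lemma carrier_prod: "(\<And>i. i \<in> A \<Longrightarrow> f i \<in> carrier (mpoly_ring V)) \<Longrightarrow> prod f A \<in> carrier (mpoly_ring V)"
  by (induction A rule: infinite_finite_induct) (auto intro: carrier_mult)

lemma carrier_subst:
  assumes "f \<in> carrier (mpoly_ring V)" "\<And>v. v \<in> V \<Longrightarrow> g v \<in> carrier (mpoly_ring W)"
  shows "subst g f \<in> carrier (mpoly_ring W)"
  unfolding subst_def lin_ext_def
  by (intro carrier_sum carrier_mult carrier_const carrier_prod carrier_power assms(2))
     (use assms(1) in \<open>auto simp: carrier_mpoly\<close>)

lemma subst_cong:
  assumes "f \<in> carrier (mpoly_ring V)" "\<And>v. v \<in> V \<Longrightarrow> g v = h v"
  shows "subst g f = subst h f"
  unfolding subst_def lin_ext_def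
  by (intro sum.cong arg_cong2[where f = "(*)"] prod.cong refl)
     (use assms in \<open>auto simp: carrier_mpoly subset_iff\<close>)

lemma ring_mpoly: "cring (mpoly_ring V :: ('x, 'k::comm_ring_1) mpoly ring)"
proof (rule cringI)
  show "abelian_group (mpoly_ring V :: ('x, 'k) mpoly ring)"
  proof (rule abelian_groupI)
    fix x :: "('x, 'k) mpoly" assume "x \<in> carrier (mpoly_ring V)"
    then show "\<exists>y\<in>carrier (mpoly_ring V). y \<oplus>\<^bsub>mpoly_ring V\<^esub> x = \<zero>\<^bsub>mpoly_ring V\<^esub>"
      by (intro bexI[of _ "- x"]) (auto intro: carrier_uminus)
  qed (auto simp: algebra_simps intro: carrier_add)
  show "comm_monoid (mpoly_ring V :: ('x, 'k) mpoly ring)"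
    by (rule comm_monoidI) (auto simp: algebra_simps intro: carrier_mult)
qed (auto simp: algebra_simps)

interpretation mpoly: cring "mpoly_ring V :: ('x, 'k::comm_ring_1) mpoly ring" for V
  by (rule ring_mpoly)

lemma mpoly_uminus [simp]:
  assumes "a \<in> carrier (mpoly_ring V)"
  shows "\<ominus>\<^bsub>mpoly_ring V\<^esub> a = - a"
proof -
  have "- a = \<ominus>\<^bsub>mpoly_ring V\<^esub> a"
    by (rule mpoly.sum_zero_eq_neg) (use assms in \<open>auto intro: carrier_uminus\<close>)
  then show ?thesis by simp
qed

lemma mpoly_minus [simp]:
  assumes "b \<in> carrier (mpoly_ring V)"
  shows "a \<ominus>\<^bsub>mpoly_ring V\<^esub> b = a - b"
  using assms by (simp add: a_minus_def)

lemma ideal_mpolyI: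
  assumes "I \<subseteq> carrier (mpoly_ring V)" "0 \<in> I"
    and "\<And>a b. a \<in> I \<Longrightarrow> b \<in> I \<Longrightarrow> a + b \<in> I"
    and "\<And>a b. a \<in> I \<Longrightarrow> b \<in> carrier (mpoly_ring V) \<Longrightarrow> b * a \<in> I"
  shows "ideal I (mpoly_ring V :: ('x, 'k::comm_ring_1) mpoly ring)"
proof (rule idealI)
  show "ring (mpoly_ring V :: ('x, 'k) mpoly ring)" by (rule mpoly.ring_axioms)
  show "subgroup I (add_monoid (mpoly_ring V))"
  proof (rule group.subgroupI)
    show "group (add_monoid (mpoly_ring V :: ('x, 'k) mpoly ring))"
      by (rule mpoly.add.is_group)
    fix a assume a: "a \<in> I"
    then have "- 1 * a \<in> I" using assms(4)[OF a, of "- 1"] carrier_uminus[OF carrier_one] by blast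
    moreover have "inv\<^bsub>add_monoid (mpoly_ring V)\<^esub> a = - a"
      using mpoly_uminus[of a V] a assms(1) by (auto simp: a_inv_def)
    ultimately show "inv\<^bsub>add_monoid (mpoly_ring V)\<^esub> a \<in> I" by simp
  qed (use assms in auto)
qed (use assms in \<open>auto simp: mult.commute\<close>)

lemma ideal_mpolyD:
  assumes "ideal I (mpoly_ring V)"
  shows "I \<subseteq> carrier (mpoly_ring V)" "0 \<in> I"
    "\<And>a b. a \<in> I \<Longrightarrow> b \<in> I \<Longrightarrow> a + b \<in> I"
    "\<And>a b. a \<in> I \<Longrightarrow> b \<in> carrier (mpoly_ring V) \<Longrightarrow> b * a \<in> I"
    "\<And>a. a \<in> I \<Longrightarrow> - a \<in> I"
proof -
  interpret ideal I "mpoly_ring V" by fact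
  show sub: "I \<subseteq> carrier (mpoly_ring V)" by (rule a_subset)
  show "0 \<in> I" using zero_closed by simp
  show "a + b \<in> I" if "a \<in> I" "b \<in> I" for a b using a_closed[OF that] by simp
  show "b * a \<in> I" if "a \<in> I" "b \<in> carrier (mpoly_ring V)" for a b using I_l_closed[OF that] by simp
  show "- a \<in> I" if "a \<in> I" for a
    using a_inv_closed[OF that] sub that by auto
qed

lemma ideal_sum:
  assumes "ideal I (mpoly_ring V)" "\<And>i. i \<in> A \<Longrightarrow> f i \<in> I"
  shows "sum f A \<in> I"
  using assms(2) by (induction A rule: infinite_finite_induct) (auto intro: ideal_mpolyD[OF assms(1)])

subsection \<open>Partial derivatives\<close>

definition pdiff :: "'x \<Rightarrow> ('x, 'k) mpoly \<Rightarrow> ('x, 'k::comm_ring_1) mpoly"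
  where "pdiff v = lin_ext (\<lambda>m. single (m - single v 1) (of_nat (lookup m v)))"

lemma pdiff_add: "pdiff v (f + g) = pdiff v f + pdiff v g"
  by (simp add: pdiff_def lin_ext_add)

lemma pdiff_zero [simp]: "pdiff v 0 = 0"
  by (simp add: pdiff_def)

lemma pdiff_single: "pdiff v (single m c) = single (m - single v 1) (c * of_nat (lookup m v))"
  by (simp add: pdiff_def lin_ext_single mult_single)

lemma exponent_minus_single:
  "lookup m v \<noteq> 0 \<Longrightarrow> (m - single v 1) + single v 1 = (m :: 'x \<Rightarrow>\<^sub>0 nat)"
  by (intro poly_mapping_eqI) (auto simp: lookup_add lookup_minus lookup_single_if)

lemma pdiff_mult: "pdiff v (f * g) = pdiff v f * g + f * pdiff v g"
proof (induction f rule: mpoly_induct)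
  case (single m c)
  show ?case
  proof (induction g rule: mpoly_induct)
    case (single n d)
    have *: "single (p + q - single v 1) (of_nat (lookup p v) * x) =
        single (p - single v 1 + q) (of_nat (lookup p v) * x)" for p q and x :: 'b
    proof (cases "lookup p v = 0")
      case False
      then have "p + q - single v 1 = p - single v 1 + q"
        by (intro poly_mapping_eqI) (auto simp: lookup_add lookup_minus lookup_single_if)
      then show ?thesis by simp
    qed simp
    show ?case
      using *[of m n "c * d"] *[of n m "c * d"]
      by (simp add: mult_single pdiff_single lookup_add distrib_left single_add mult_ac add_ac)
  qed (simp_all add: pdiff_add algebra_simps)
qed (simp_all add: pdiff_add algebra_simps)

text \<open>Each monomial of the derivative has exactly one source, so nothing cancels; only the
  integer factor could vanish, which characteristic zero excludes.\<close>

lemma lookup_pdiff: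
  "lookup (pdiff v f) m = of_nat (Suc (lookup m v)) * lookup f (m + single v 1)"
proof (induction f rule: mpoly_induct)
  case (single n c)
  show ?case
  proof (cases "lookup n v = 0")
    case True
    then have "n \<noteq> m + single v 1" by (auto simp: lookup_add)
    then show ?thesis using True by (simp add: pdiff_single lookup_single_if)
  next
    case False
    then have "n - single v 1 = m \<longleftrightarrow> n = m + single v 1"
      using exponent_minus_single[of n v] by auto
    then show ?thesis by (auto simp: pdiff_single lookup_single_if lookup_add algebra_simps)
  qed
qed (simp_all add: pdiff_add lookup_add algebra_simps)

lemma carrier_pdiff: "f \<in> carrier (mpoly_ring V) \<Longrightarrow> pdiff v f \<in> carrier (mpoly_ring V)"
proof -
  assume f: "f \<in> carrier (mpoly_ring V)"
  have "keys m \<subseteq> V" if "m \<in> keys (pdiff v f)" for m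
  proof -
    have "m + single v 1 \<in> keys f"
      using that by (auto simp: Poly_Mapping.in_keys_iff lookup_pdiff)
    then have "keys (m + single v 1) \<subseteq> V" using f by (simp only: carrier_mpoly)
    then show ?thesis by (simp add: keys_plus_nat)
  qed
  then show ?thesis by (simp add: carrier_mpoly)
qed

section \<open>Leading monomials for the lexicographic order\<close>

locale variable_order =
  fixes gt :: "'x \<Rightarrow> 'x \<Rightarrow> bool"
  assumes irrefl: "\<not> gt v v"
    and trans: "gt u v \<Longrightarrow> gt v w \<Longrightarrow> gt u w"
    and total: "v \<noteq> w \<Longrightarrow> gt v w \<or> gt w v"
begin

lemma greatest_element:
  assumes "finite A" "A \<noteq> {}"
  shows "\<exists>v\<in>A. \<forall>w. gt w v \<longrightarrow> w \<notin> A"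
  using assms
proof (induction A rule: finite_ne_induct)
  case (singleton x)
  then show ?case using irrefl by auto
next
  case (insert x F)
  then obtain v where v: "v \<in> F" "\<forall>w. gt w v \<longrightarrow> w \<notin> F" by blast
  show ?case
  proof (cases "gt x v")
    case True
    then have "\<forall>w. gt w x \<longrightarrow> w \<notin> insert x F" using v irrefl trans[of _ x v] by blast
    then show ?thesis by blast
  next
    case False
    then have "\<forall>w. gt w v \<longrightarrow> w \<notin> insert x F" using v by blast
    then show ?thesis using v by blast
  qed
qed

abbreviation lt :: "('x \<Rightarrow>\<^sub>0 nat) \<Rightarrow> ('x \<Rightarrow>\<^sub>0 nat) \<Rightarrow> bool" where
  "lt \<equiv> lex_less gt"

lemma lt_irrefl: "\<not> lt m m"
  by (auto simp: lex_less_def)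

lemma lt_trans:
  assumes "lt a b" "lt b c" shows "lt a c"
proof -
  obtain v where v: "lookup a v < lookup b v" "\<And>w. gt w v \<Longrightarrow> lookup a w = lookup b w"
    using assms(1) by (auto simp: lex_less_def)
  obtain u where u: "lookup b u < lookup c u" "\<And>w. gt w u \<Longrightarrow> lookup b w = lookup c w"
    using assms(2) by (auto simp: lex_less_def)
  consider "u = v" | "gt u v" | "gt v u" using total by blast
  then show ?thesis
  proof cases
    case 1
    then have "lookup a v < lookup c v" "\<forall>w. gt w v \<longrightarrow> lookup a w = lookup c w"
      using u v by auto
    then show ?thesis unfolding lex_less_def by blast
  next
    case 2
    then have "lookup a u < lookup c u" "\<forall>w. gt w u \<longrightarrow> lookup a w = lookup c w"
      using u v trans[of _ u v] by auto
    then show ?thesis unfolding lex_less_def by blast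
  next
    case 3
    then have "lookup a v < lookup c v" "\<forall>w. gt w v \<longrightarrow> lookup a w = lookup c w"
      using u v trans[of _ v u] by auto
    then show ?thesis unfolding lex_less_def by blast
  qed
qed

lemma lt_linear: assumes "m \<noteq> m'" shows "lt m m' \<or> lt m' m"
proof -
  let ?A = "{v. lookup m v \<noteq> lookup m' v}"
  have "?A \<subseteq> keys m \<union> keys m'" by (auto simp: Poly_Mapping.in_keys_iff)
  then have "finite ?A" using finite_subset finite_UnI finite_keys by metis
  moreover have "?A \<noteq> {}" using assms poly_mapping_eqI by fastforce
  ultimately obtain v where "v \<in> ?A" "\<forall>w. gt w v \<longrightarrow> w \<notin> ?A" using greatest_element by meson
  then have "lookup m v \<noteq> lookup m' v" "\<forall>w. gt w v \<longrightarrow> lookup m w = lookup m' w"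
    by auto
  then show ?thesis unfolding lex_less_def by (metis linorder_less_linear)
qed

lemma lt_asym: "lt m m' \<Longrightarrow> \<not> lt m' m"
  using lt_trans[of m m' m] lt_irrefl by blast

lemma lt_add_iff [simp]: "lt (m + n) (m' + n) \<longleftrightarrow> lt m m'"
  by (simp add: lex_less_def lookup_add)

lemma lt_add_iff2 [simp]: "lt (n + m) (n + m') \<longleftrightarrow> lt m m'"
  by (simp add: lex_less_def lookup_add)

abbreviation leading :: "('x, 'k::zero) mpoly \<Rightarrow> ('x \<Rightarrow>\<^sub>0 nat) \<Rightarrow> bool" where
  "leading \<equiv> is_leading_monomial lt"

lemma ex_leading: assumes "f \<noteq> 0" shows "\<exists>m. leading f m"
proof -
  have "finite A \<Longrightarrow> A \<noteq> {} \<Longrightarrow> \<exists>m\<in>A. \<forall>m'\<in>A. m' = m \<or> lt m' m" for A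
  proof (induction A rule: finite_ne_induct)
    case (insert x F)
    then obtain m where m: "m \<in> F" "\<forall>m'\<in>F. m' = m \<or> lt m' m" by blast
    show ?case
    proof (cases "lt x m \<or> x = m")
      case True
      then show ?thesis using m by (intro bexI[of _ m]) auto
    next
      case False
      then have "lt m x" using lt_linear by blast
      have "m' = x \<or> lt m' x" if "m' \<in> insert x F" for m'
        using that m(2) lt_trans[of m' m x] \<open>lt m x\<close> by auto
      then show ?thesis by blast
    qed
  qed simp
  from this[OF finite_keys, of f] show ?thesis using assms by (auto simp: is_leading_monomial_def)
qed

lemma leading_mult:
  fixes f g :: "('x, 'k::idom) mpoly"
  assumes "leading f m" "leading g n"
  shows "lookup (f * g) (m + n) = lookup f m * lookup g n" "leading (f * g) (m + n)"
proof -
  define f' where "f' = f - single m (lookup f m)"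
  define g' where "g' = g - single n (lookup g n)"
  have keys_rest: "lt a m" if "leading f m" "a \<in> keys (f - single m (lookup f m))"
    for a m and f :: "('x, 'k) mpoly"
  proof -
    have "lookup f a - (if m = a then lookup f m else 0) \<noteq> 0"
      using that(2) by (simp add: Poly_Mapping.in_keys_iff lookup_minus lookup_single_if)
    then have "a \<noteq> m" "a \<in> keys f" by (auto simp: Poly_Mapping.in_keys_iff split: if_splits)
    then show ?thesis using that(1) by (auto simp: is_leading_monomial_def)
  qed
  have f': "lt a m" if "a \<in> keys f'" for a
    using keys_rest[OF assms(1)] that by (simp add: f'_def)
  have g': "lt a n" if "a \<in> keys g'" for a
    using keys_rest[OF assms(2)] that by (simp add: g'_def)
  define h where "h = single m (lookup f m) * g' + f' * g"
  have fg: "f * g = single (m + n) (lookup f m * lookup g n) + h"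
  proof -
    have "f * g = single m (lookup f m) * single n (lookup g n) + h"
      by (simp add: h_def f'_def g'_def algebra_simps del: mult_single)
    then show ?thesis by (simp add: mult_single)
  qed
  have h: "lt a (m + n)" if "a \<in> keys h" for a
  proof -
    have "a \<in> keys (single m (lookup f m) * g') \<or> a \<in> keys (f' * g)"
      using that Poly_Mapping.keys_add[of "single m (lookup f m) * g'" "f' * g"] by (auto simp: h_def)
    then show ?thesis
    proof
      assume "a \<in> keys (single m (lookup f m) * g')"
      then obtain b c where bc: "a = b + c" "b \<in> keys (single m (lookup f m))" "c \<in> keys g'"
        by (rule keys_multE)
      then have "b = m" by (simp split: if_splits)
      then show ?thesis using g' bc by simp
    next
      assume "a \<in> keys (f' * g)"
      then show ?thesis
      proof (rule keys_multE)
        fix b c assume bc: "a = b + c" "b \<in> keys f'" "c \<in> keys g"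
        then have "c = n \<or> lt c n" using assms(2) by (auto simp: is_leading_monomial_def)
        moreover have "lt b m" using f' bc by simp
        ultimately show ?thesis
          using bc(1) lt_trans[of "b + c" "m + c" "m + n"] by auto
      qed
    qed
  qed
  then have "lookup h (m + n) = 0" using lt_irrefl by (metis Poly_Mapping.in_keys_iff)
  then show l: "lookup (f * g) (m + n) = lookup f m * lookup g n"
    by (simp add: fg lookup_add)
  have "lookup f m * lookup g n \<noteq> 0" using assms by (auto simp: is_leading_monomial_def)
  then have "m + n \<in> keys (f * g)" using l by (simp add: Poly_Mapping.in_keys_iff)
  moreover have "a = m + n \<or> lt a (m + n)" if "a \<in> keys (f * g)" for a
  proof (cases "a \<in> keys h")
    case False
    have "a \<in> keys (single (m + n) (lookup f m * lookup g n)) \<union> keys h"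
      using that Poly_Mapping.keys_add fg by (metis subsetD)
    then show ?thesis using False by (simp split: if_splits)
  qed (use h in blast)
  ultimately show "leading (f * g) (m + n)" by (simp add: is_leading_monomial_def)
qed

lemma leading_single: "c \<noteq> 0 \<Longrightarrow> leading (single m c) m"
  by (simp add: is_leading_monomial_def)

lemma leading_prod:
  fixes f :: "'i \<Rightarrow> ('x, 'k::idom) mpoly"
  assumes "finite A" "\<And>i. i \<in> A \<Longrightarrow> leading (f i) (m i)"
  shows "leading (\<Prod>i\<in>A. f i) (\<Sum>i\<in>A. m i)"
  using assms
proof (induction A)
  case (insert i A)
  then show ?case using leading_mult(2)[of "f i" "m i" "prod f A" "sum m A"] by simp
qed (simp add: is_leading_monomial_def)

end

section \<open>Symbolic powers in a polynomial ring\<close>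

lemma UN_pair_const: "x \<in> X \<Longrightarrow> y \<in> Y \<Longrightarrow> (\<Union>(a, s)\<in>X. \<Union>(b, t)\<in>Y. Z) = Z"
  by auto

text \<open>An order on the variables makes the exponents linearly ordered, which is what turns
  polynomials into an instance of integral domains.\<close>

locale mpoly_localization =
  fixes V :: "'x::linorder set" and S :: "('x, 'k::idom) mpoly set"
  assumes S_carrier: "S \<subseteq> carrier (mpoly_ring V)"
    and one_S: "1 \<in> S" and zero_S: "0 \<notin> S"
    and mult_S: "s \<in> S \<Longrightarrow> t \<in> S \<Longrightarrow> s * t \<in> S"
begin

abbreviation "R \<equiv> mpoly_ring V :: ('x, 'k) mpoly ring"
abbreviation "C \<equiv> carrier R"
abbreviation "quot \<equiv> fraction R S"
abbreviation "L \<equiv> localization R S"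

lemma S_C: "s \<in> S \<Longrightarrow> s \<in> C"
  using S_carrier by blast

text \<open>Over a domain with \<open>0\<close> outside \<open>S\<close>, the cancelling factor
  \<open>u\<close> in the definition of a fraction disappears and equality is
  cross-multiplication.\<close>

lemma frac_mem:
  assumes "a \<in> C" "s \<in> S"
  shows "(b, t) \<in> quot a s \<longleftrightarrow> b \<in> C \<and> t \<in> S \<and> t * a = s * b"
proof -
  have "(\<exists>u\<in>S. u \<otimes>\<^bsub>R\<^esub> (t \<otimes>\<^bsub>R\<^esub> a \<ominus>\<^bsub>R\<^esub> s \<otimes>\<^bsub>R\<^esub> b) = \<zero>\<^bsub>R\<^esub>) \<longleftrightarrow> t * a = s * b"
    if "b \<in> C" "t \<in> S"
    using that assms one_S zero_S S_C by (auto simp: carrier_mult)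
  then show ?thesis by (auto simp: fraction_def)
qed

lemma frac_self: "a \<in> C \<Longrightarrow> s \<in> S \<Longrightarrow> (a, s) \<in> quot a s"
  by (simp add: frac_mem)

lemma nz: "s \<in> S \<Longrightarrow> s \<noteq> 0"
  using zero_S by blast

lemma frac_eq:
  assumes "a \<in> C" "s \<in> S" "b \<in> C" "t \<in> S"
  shows "quot a s = quot b t \<longleftrightarrow> t * a = s * b"
proof
  assume "quot a s = quot b t"
  then have "(b, t) \<in> quot a s" using assms frac_self by blast
  then show "t * a = s * b" using assms by (simp add: frac_mem)
next
  assume eq: "t * a = s * b"
  have "(c, u) \<in> quot a s \<longleftrightarrow> (c, u) \<in> quot b t" for c u
  proof -
    have "u * a = s * c \<longleftrightarrow> u * b = t * c"
    proof -
      have "u * a = s * c \<longleftrightarrow> t * (u * a) = t * (s * c)" using assms nz by simp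
      also have "t * (u * a) = s * (u * b)" using eq by (metis mult.left_commute)
      also have "t * (s * c) = s * (t * c)" by (simp add: mult_ac)
      also have "s * (u * b) = s * (t * c) \<longleftrightarrow> u * b = t * c" using assms nz by simp
      finally show ?thesis .
    qed
    then show ?thesis using assms by (simp add: frac_mem)
  qed
  then show "quot a s = quot b t" by (simp add: set_eq_iff split_paired_all)
qed

lemma L_carrier: "carrier L = {quot a s | a s. a \<in> C \<and> s \<in> S}"
  and L_one: "\<one>\<^bsub>L\<^esub> = quot 1 1" and L_zero: "\<zero>\<^bsub>L\<^esub> = quot 0 1"
  by (simp_all add: localization_def)

lemma L_mult:
  assumes "a \<in> C" "s \<in> S" "b \<in> C" "t \<in> S"
  shows "quot a s \<otimes>\<^bsub>L\<^esub> quot b t = quot (a * b) (s * t)"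
proof -
  have "quot (a' * b') (s' * t') = quot (a * b) (s * t)"
    if "(a', s') \<in> quot a s" "(b', t') \<in> quot b t" for a' s' b' t'
  proof -
    have "s * t * (a' * b') = (s * a') * (t * b')" by (simp add: mult_ac)
    also have "\<dots> = (s' * a) * (t' * b)" using that assms by (simp add: frac_mem)
    finally show ?thesis
      using that assms by (subst frac_eq) (auto simp: frac_mem mult_S carrier_mult mult_ac)
  qed
  then have "(\<Union>(a', s')\<in>quot a s. \<Union>(b', t')\<in>quot b t. quot (a' * b') (s' * t')) =
      (\<Union>(a', s')\<in>quot a s. \<Union>(b', t')\<in>quot b t. quot (a * b) (s * t))"
    by (intro SUP_cong refl) (auto split: prod.splits)
  also have "\<dots> = quot (a * b) (s * t)" by (rule UN_pair_const[OF frac_self frac_self]) (rule assms)+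
  finally show ?thesis by (simp add: localization_def)
qed

lemma L_add:
  assumes "a \<in> C" "s \<in> S" "b \<in> C" "t \<in> S"
  shows "quot a s \<oplus>\<^bsub>L\<^esub> quot b t = quot (t * a + s * b) (s * t)"
proof -
  have "quot (t' * a' + s' * b') (s' * t') = quot (t * a + s * b) (s * t)"
    if "(a', s') \<in> quot a s" "(b', t') \<in> quot b t" for a' s' b' t'
  proof -
    have "s * t * (t' * a' + s' * b') = t * t' * (s * a') + s * s' * (t * b')"
      by (simp add: algebra_simps)
    also have "\<dots> = t * t' * (s' * a) + s * s' * (t' * b)" using that assms by (simp add: frac_mem)
    also have "\<dots> = s' * t' * (t * a + s * b)" by (simp add: algebra_simps)
    finally show ?thesis
      using that assms by (subst frac_eq) (auto simp: frac_mem mult_S carrier_mult carrier_add S_C)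
  qed
  then have "(\<Union>(a', s')\<in>quot a s. \<Union>(b', t')\<in>quot b t. quot (t' * a' + s' * b') (s' * t')) =
      (\<Union>(a', s')\<in>quot a s. \<Union>(b', t')\<in>quot b t. quot (t * a + s * b) (s * t))"
    by (intro SUP_cong refl) (auto split: prod.splits)
  also have "\<dots> = quot (t * a + s * b) (s * t)" by (rule UN_pair_const[OF frac_self frac_self]) (rule assms)+
  finally show ?thesis by (simp add: localization_def)
qed

lemmas closures = S_C mult_S carrier_mult carrier_add carrier_uminus one_S

lemma fracE:
  assumes "X \<in> carrier L"
  obtains a s where "X = quot a s" "a \<in> C" "s \<in> S"
  using assms by (auto simp: L_carrier)

lemma frac_carrier: "a \<in> C \<Longrightarrow> s \<in> S \<Longrightarrow> quot a s \<in> carrier L"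
  by (auto simp: L_carrier)

lemma cring_L: "cring L"
proof (rule cringI)
  show "abelian_group L"
  proof (rule abelian_groupI)
    fix X assume "X \<in> carrier L"
    then obtain a s where X: "X = quot a s" "a \<in> C" "s \<in> S" by (rule fracE)
    show "\<zero>\<^bsub>L\<^esub> \<oplus>\<^bsub>L\<^esub> X = X"
      using X by (simp add: L_zero L_add one_S)
    have "quot (- a) s \<oplus>\<^bsub>L\<^esub> X = \<zero>\<^bsub>L\<^esub>"
      using X by (simp add: L_zero L_add frac_eq closures)
    then show "\<exists>Y\<in>carrier L. Y \<oplus>\<^bsub>L\<^esub> X = \<zero>\<^bsub>L\<^esub>"
      using X frac_carrier carrier_uminus by blast
    fix Y assume "Y \<in> carrier L"
    then obtain b t where Y: "Y = quot b t" "b \<in> C" "t \<in> S" by (rule fracE)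
    show "X \<oplus>\<^bsub>L\<^esub> Y \<in> carrier L"
      using X Y by (simp add: L_add frac_carrier closures)
    show "X \<oplus>\<^bsub>L\<^esub> Y = Y \<oplus>\<^bsub>L\<^esub> X"
      using X Y by (simp add: L_add add_ac mult_ac)
    fix Z assume "Z \<in> carrier L"
    then obtain c u where Z: "Z = quot c u" "c \<in> C" "u \<in> S" by (rule fracE)
    show "X \<oplus>\<^bsub>L\<^esub> Y \<oplus>\<^bsub>L\<^esub> Z = X \<oplus>\<^bsub>L\<^esub> (Y \<oplus>\<^bsub>L\<^esub> Z)"
      using X Y Z by (simp add: L_add closures algebra_simps)
  qed (simp add: L_zero frac_carrier one_S)
  show "comm_monoid L"
  proof (rule comm_monoidI)
    fix X Y assume "X \<in> carrier L" "Y \<in> carrier L"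
    then obtain a s b t where X: "X = quot a s" "a \<in> C" "s \<in> S" and Y: "Y = quot b t" "b \<in> C" "t \<in> S"
      by (metis fracE)
    show "X \<otimes>\<^bsub>L\<^esub> Y \<in> carrier L" using X Y by (simp add: L_mult frac_carrier closures)
    show "X \<otimes>\<^bsub>L\<^esub> Y = Y \<otimes>\<^bsub>L\<^esub> X" using X Y by (simp add: L_mult mult_ac)
    show "\<one>\<^bsub>L\<^esub> \<otimes>\<^bsub>L\<^esub> X = X" using X by (simp add: L_one L_mult one_S)
    fix Z assume "Z \<in> carrier L"
    then obtain c u where Z: "Z = quot c u" "c \<in> C" "u \<in> S" by (rule fracE)
    show "X \<otimes>\<^bsub>L\<^esub> Y \<otimes>\<^bsub>L\<^esub> Z = X \<otimes>\<^bsub>L\<^esub> (Y \<otimes>\<^bsub>L\<^esub> Z)"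
      using X Y Z by (simp add: L_mult closures mult_ac)
  qed (simp add: L_one frac_carrier one_S)
  fix X Y Z assume "X \<in> carrier L" "Y \<in> carrier L" "Z \<in> carrier L"
  then obtain a s b t c u where X: "X = quot a s" "a \<in> C" "s \<in> S" and Y: "Y = quot b t" "b \<in> C" "t \<in> S"
    and Z: "Z = quot c u" "c \<in> C" "u \<in> S"
    by (metis fracE)
  show "(X \<oplus>\<^bsub>L\<^esub> Y) \<otimes>\<^bsub>L\<^esub> Z = X \<otimes>\<^bsub>L\<^esub> Z \<oplus>\<^bsub>L\<^esub> Y \<otimes>\<^bsub>L\<^esub> Z"
    using X Y Z by (simp add: L_add L_mult closures frac_eq) (simp add: algebra_simps)
qed

text \<open>The extended ideal is the set of fractions with numerator in \<open>J\<close>, and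
  \<open>f/1 = a/s\<close> means \<open>s * f = a\<close>.\<close>

lemma frac_in_extension_iff:
  assumes J: "ideal J R" and f: "f \<in> C"
  shows "quot f 1 \<in> Idl\<^bsub>L\<^esub> ((\<lambda>f. quot f 1) ` J) \<longleftrightarrow> (\<exists>s\<in>S. s * f \<in> J)"
proof
  interpret L: cring L by (rule cring_L)
  note J' = ideal_mpolyD[OF J]
  let ?T = "{quot a s | a s. a \<in> J \<and> s \<in> S}"
  have "ideal ?T L"
  proof (rule idealI)
    show "ring L" by (rule L.ring_axioms)
    show "subgroup ?T (add_monoid L)"
    proof (rule group.subgroupI)
      show "group (add_monoid L)" by (rule L.add.is_group)
      show "?T \<subseteq> carrier (add_monoid L)" using J'(1) by (auto simp: L_carrier)
      show "?T \<noteq> {}" using J'(2) one_S by blast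
      fix X assume "X \<in> ?T"
      then obtain a s where X: "X = quot a s" "a \<in> J" "s \<in> S" by blast
      then have aC: "a \<in> C" using J'(1) by blast
      have "quot (- a) s = \<ominus>\<^bsub>L\<^esub> X"
        by (rule L.sum_zero_eq_neg)
           (use X aC in \<open>simp_all add: L_zero L_add frac_eq closures frac_carrier\<close>)
      then have "\<ominus>\<^bsub>L\<^esub> X \<in> ?T" using J'(5) X by (metis (mono_tags, lifting) mem_Collect_eq)
      then show "inv\<^bsub>add_monoid L\<^esub> X \<in> ?T" by (simp add: a_inv_def)
      fix Y assume "Y \<in> ?T"
      then obtain b t where Y: "Y = quot b t" "b \<in> J" "t \<in> S" by blast
      have "X \<oplus>\<^bsub>L\<^esub> Y = quot (t * a + s * b) (s * t)"
        using X Y aC J'(1) by (auto simp: L_add)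
      moreover have "t * a + s * b \<in> J" "s * t \<in> S"
        by (intro J'(3,4) S_C mult_S X Y)+
      ultimately show "X \<otimes>\<^bsub>add_monoid L\<^esub> Y \<in> ?T" by auto
    qed
    fix X Y assume "X \<in> ?T" "Y \<in> carrier L"
    then obtain a s b t where X: "X = quot a s" "a \<in> J" "s \<in> S" and Y: "Y = quot b t" "b \<in> C" "t \<in> S"
      by (auto simp: L_carrier)
    have "X \<otimes>\<^bsub>L\<^esub> Y = quot (b * a) (t * s)" "Y \<otimes>\<^bsub>L\<^esub> X = quot (b * a) (t * s)"
      using X Y J'(1) by (auto simp: L_mult mult_ac)
    moreover have "b * a \<in> J" "t * s \<in> S" by (intro J'(4) mult_S X Y)+
    ultimately show "X \<otimes>\<^bsub>L\<^esub> Y \<in> ?T" "Y \<otimes>\<^bsub>L\<^esub> X \<in> ?T" by blast+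
  qed
  moreover have "(\<lambda>f. quot f 1) ` J \<subseteq> ?T" using one_S by blast
  ultimately have sub: "Idl\<^bsub>L\<^esub> ((\<lambda>f. quot f 1) ` J) \<subseteq> ?T" by (rule L.genideal_minimal)
  assume "quot f 1 \<in> Idl\<^bsub>L\<^esub> ((\<lambda>f. quot f 1) ` J)"
  then obtain a s where as: "quot f 1 = quot a s" "a \<in> J" "s \<in> S" using sub by blast
  then have "s * f = a" using f J'(1) one_S by (auto simp: frac_eq)
  then show "\<exists>s\<in>S. s * f \<in> J" using as by blast
next
  interpret L: cring L by (rule cring_L)
  note J' = ideal_mpolyD[OF J]
  assume "\<exists>s\<in>S. s * f \<in> J"
  then obtain s where s: "s \<in> S" "s * f \<in> J" by blast
  let ?X = "(\<lambda>f. quot f 1) ` J"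
  have sub: "?X \<subseteq> carrier L" using J'(1) one_S by (auto simp: L_carrier)
  have "quot (s * f) 1 \<in> Idl\<^bsub>L\<^esub> ?X"
    using L.genideal_self[OF sub] s by blast
  then have "quot 1 s \<otimes>\<^bsub>L\<^esub> quot (s * f) 1 \<in> Idl\<^bsub>L\<^esub> ?X"
    using ideal.I_l_closed[OF L.genideal_ideal[OF sub]] s frac_carrier carrier_one by blast
  moreover have "quot 1 s \<otimes>\<^bsub>L\<^esub> quot (s * f) 1 = quot f 1"
    using s f by (simp add: L_mult closures frac_eq)
  ultimately show "quot f 1 \<in> Idl\<^bsub>L\<^esub> ?X" by simp
qed

end

section \<open>Powers of ideals and the working form of symbolic powers\<close>

definition ideal_pow :: "'x set \<Rightarrow> ('x, 'k::comm_ring_1) mpoly set \<Rightarrow> nat \<Rightarrow> ('x, 'k) mpoly set"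
  where "ideal_pow V I n = I [^]\<^bsub>ideals_set (mpoly_ring V)\<^esub> n"

lemma ideal_pow_0: "ideal_pow V I 0 = carrier (mpoly_ring V)"
  and ideal_pow_Suc: "ideal_pow V I (Suc n) = ideal_prod (mpoly_ring V) (ideal_pow V I n) I"
  by (simp_all add: ideal_pow_def ideals_set_def nat_pow_def)

lemma ideal_ideal_pow:
  assumes "ideal I (mpoly_ring V)"
  shows "ideal (ideal_pow V I (n::nat)) (mpoly_ring V)"
  by (induction n) (auto simp: ideal_pow_0 ideal_pow_Suc assms mpoly.oneideal intro: mpoly.ideal_prod_is_ideal)

lemma ideal_pow_mult:
  assumes I: "ideal I (mpoly_ring V)"
    and "f \<in> ideal_pow V I (m::nat)" "g \<in> ideal_pow V I (n::nat)"
  shows "f * g \<in> ideal_pow V I (m + n)"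
  using assms(3)
proof (induction n arbitrary: g)
  case 0
  then show ?case
    using ideal_mpolyD(4)[OF ideal_ideal_pow[OF I] assms(2)] by (simp add: ideal_pow_0) (metis mult.commute)
next
  case (Suc n)
  from Suc.prems show ?case unfolding ideal_pow_Suc add_Suc_right
  proof (induction g rule: ideal_prod.induct)
    case (prod i j)
    have "(f * i) \<otimes>\<^bsub>mpoly_ring V\<^esub> j \<in> ideal_prod (mpoly_ring V) (ideal_pow V I (m + n)) I"
      by (intro ideal_prod.prod Suc.IH prod)
    then show ?case by (simp add: mult.assoc)
  next
    case (sum s1 s2)
    have "f * s1 \<oplus>\<^bsub>mpoly_ring V\<^esub> f * s2 \<in> ideal_prod (mpoly_ring V) (ideal_pow V I (m + n)) I"
      by (intro ideal_prod.sum sum.IH)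
    then show ?case by (simp add: distrib_left)
  qed
qed

lemma primeideal_mpolyI:
  assumes "ideal P (mpoly_ring V)" "1 \<notin> P"
    and "\<And>a b. a \<in> carrier (mpoly_ring V) \<Longrightarrow> b \<in> carrier (mpoly_ring V) \<Longrightarrow> a * b \<in> P \<Longrightarrow> a \<in> P \<or> b \<in> P"
  shows "primeideal P (mpoly_ring V :: ('x, 'k::comm_ring_1) mpoly ring)"
  using assms ring_mpoly by (intro primeidealI) auto

lemma primeideal_mpolyD:
  assumes "primeideal P (mpoly_ring V)"
  shows "ideal P (mpoly_ring V)" "1 \<notin> P"
    "\<And>a b. a \<in> carrier (mpoly_ring V) \<Longrightarrow> b \<in> carrier (mpoly_ring V) \<Longrightarrow> a * b \<in> P \<Longrightarrow> a \<in> P \<or> b \<in> P"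
proof -
  interpret primeideal P "mpoly_ring V" by fact
  show i: "ideal P (mpoly_ring V)" by (rule is_ideal)
  show "a \<in> P \<or> b \<in> P"
    if "a \<in> carrier (mpoly_ring V)" "b \<in> carrier (mpoly_ring V)" "a * b \<in> P" for a b
    using I_prime[of a b] that by simp
  show "1 \<notin> P"
  proof
    assume "1 \<in> P"
    then have "P = carrier (mpoly_ring V)"
      using ideal_mpolyD(4)[OF i, of 1] ideal_mpolyD(1)[OF i] by fastforce
    with I_notcarr show False by simp
  qed
qed

lemma prime_prodD:
  assumes P: "primeideal P (mpoly_ring V)" and "finite A" "(\<Prod>i\<in>A. f i) \<in> P"
    "\<And>i. i \<in> A \<Longrightarrow> f i \<in> carrier (mpoly_ring V)"
  shows "\<exists>i\<in>A. f i \<in> P"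
  using assms(2-)
proof (induction A)
  case empty
  then show ?case using primeideal_mpolyD(2)[OF P] by simp
next
  case (insert i A)
  then show ?case using primeideal_mpolyD(3)[OF P, of "f i" "prod f A"] by (auto intro: carrier_prod)
qed

lemma prime_complement_mult:
  assumes "\<And>P. P \<in> \<P> \<Longrightarrow> primeideal P (mpoly_ring V)"
    and "s \<in> carrier (mpoly_ring V) - \<Union>\<P>" "t \<in> carrier (mpoly_ring V) - \<Union>\<P>"
  shows "s * t \<in> carrier (mpoly_ring V) - \<Union>\<P>"
proof -
  have "s * t \<notin> P" if "P \<in> \<P>" for P
    using primeideal_mpolyD(3)[OF assms(1)[OF that], of s t] assms(2,3) that by auto
  then show ?thesis using assms(2,3) by (auto intro: carrier_mult)
qed

text \<open>The complement of a union of primes is multiplicatively closed, and the existence of a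
  minimal prime keeps \<open>0\<close> out of it. From here on localizations no longer
  appear.\<close>

theorem symbolic_power_iff:
  fixes I :: "('x::linorder, 'k::idom) mpoly set"
  assumes I: "ideal I (mpoly_ring V)" and "minimal_primes (mpoly_ring V) I \<noteq> {}"
  shows "f \<in> symbolic_power (mpoly_ring V) I n \<longleftrightarrow> f \<in> carrier (mpoly_ring V) \<and>
    (\<exists>s \<in> carrier (mpoly_ring V) - \<Union>(minimal_primes (mpoly_ring V) I).
      s * f \<in> ideal_pow V I n)"
proof -
  let ?S = "carrier (mpoly_ring V) - \<Union>(minimal_primes (mpoly_ring V) I)"
  have prime: "primeideal P (mpoly_ring V)" if "P \<in> minimal_primes (mpoly_ring V) I" for P
    using that by (simp add: minimal_primes_def)
  interpret mpoly_localization V ?S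
  proof
    obtain P where "P \<in> minimal_primes (mpoly_ring V) I" using assms(2) by auto
    then show "0 \<notin> ?S" using ideal_mpolyD(2)[OF primeideal_mpolyD(1)[OF prime]] by auto
    show "1 \<in> ?S" using primeideal_mpolyD(2)[OF prime] by auto
    show "s * t \<in> ?S" if "s \<in> ?S" "t \<in> ?S" for s t
      by (rule prime_complement_mult[OF prime that])
  qed blast
  show ?thesis
    unfolding symbolic_power_def Let_def ideal_pow_def[symmetric]
    using frac_in_extension_iff[OF ideal_ideal_pow[OF I, of n], of f] by auto
qed

lemma ideal_symbolic_power:
  fixes I :: "('x::linorder, 'k::idom) mpoly set"
  assumes I: "ideal I (mpoly_ring V)" and mp: "minimal_primes (mpoly_ring V) I \<noteq> {}"
  shows "ideal (symbolic_power (mpoly_ring V) I n) (mpoly_ring V)"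
proof -
  note iff = symbolic_power_iff[OF I mp, of _ n]
  note J = ideal_mpolyD[OF ideal_ideal_pow[OF I, of n]]
  let ?S = "carrier (mpoly_ring V) - \<Union>(minimal_primes (mpoly_ring V) I)"
  have prime: "primeideal P (mpoly_ring V)" if "P \<in> minimal_primes (mpoly_ring V) I" for P
    using that by (simp add: minimal_primes_def)
  have S: "s * t \<in> ?S" if "s \<in> ?S" "t \<in> ?S" for s t
    by (rule prime_complement_mult[OF prime that])
  have one: "1 \<in> ?S" using primeideal_mpolyD(2)[OF prime] by auto
  show ?thesis
  proof (rule ideal_mpolyI)
    show "symbolic_power (mpoly_ring V) I n \<subseteq> carrier (mpoly_ring V)" using iff by blast
    show "0 \<in> symbolic_power (mpoly_ring V) I n" using iff one J(2) by auto
    fix a b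
    assume a: "a \<in> symbolic_power (mpoly_ring V) I n"
    then obtain s where s: "s \<in> ?S" "s * a \<in> ideal_pow V I n" "a \<in> carrier (mpoly_ring V)"
      using iff by blast
    show "a + b \<in> symbolic_power (mpoly_ring V) I n" if b: "b \<in> symbolic_power (mpoly_ring V) I n"
    proof -
      obtain t where t: "t \<in> ?S" "t * b \<in> ideal_pow V I n" "b \<in> carrier (mpoly_ring V)"
        using b iff by blast
      have "t * (s * a) + s * (t * b) \<in> ideal_pow V I n"
        by (intro J(3,4) s t) (use s t in auto)
      also have "t * (s * a) + s * (t * b) = (s * t) * (a + b)" by (simp add: algebra_simps)
      finally show ?thesis using iff S[OF s(1) t(1)] carrier_add s t by blast
    qed
    show "b * a \<in> symbolic_power (mpoly_ring V) I n" if b: "b \<in> carrier (mpoly_ring V)"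
    proof -
      have "b * (s * a) \<in> ideal_pow V I n" by (intro J(4) s b)
      also have "b * (s * a) = s * (b * a)" by (simp add: algebra_simps)
      finally show ?thesis using iff s b carrier_mult by blast
    qed
  qed
qed

lemma symbolic_power_mult:
  fixes I :: "('x::linorder, 'k::idom) mpoly set"
  assumes I: "ideal I (mpoly_ring V)" and mp: "minimal_primes (mpoly_ring V) I \<noteq> {}"
    and f: "f \<in> symbolic_power (mpoly_ring V) I m" and g: "g \<in> symbolic_power (mpoly_ring V) I n"
  shows "f * g \<in> symbolic_power (mpoly_ring V) I (m + n)"
proof -
  let ?S = "carrier (mpoly_ring V) - \<Union>(minimal_primes (mpoly_ring V) I)"
  have prime: "primeideal P (mpoly_ring V)" if "P \<in> minimal_primes (mpoly_ring V) I" for P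
    using that by (simp add: minimal_primes_def)
  obtain s where s: "s \<in> ?S" "s * f \<in> ideal_pow V I m" "f \<in> carrier (mpoly_ring V)"
    using f symbolic_power_iff[OF I mp] by blast
  obtain t where t: "t \<in> ?S" "t * g \<in> ideal_pow V I n" "g \<in> carrier (mpoly_ring V)"
    using g symbolic_power_iff[OF I mp] by blast
  have "s * t \<in> ?S"
    by (rule prime_complement_mult[OF prime s(1) t(1)])
  moreover have "(s * f) * (t * g) = (s * t) * (f * g)" by (simp add: mult_ac)
  moreover have "(s * f) * (t * g) \<in> ideal_pow V I (m + n)"
    using ideal_pow_mult[OF I s(2) t(2)] .
  ultimately show ?thesis using symbolic_power_iff[OF I mp] s t carrier_mult by metis
qed

section \<open>Initial ideals and squarefree monomial ideals\<close>

lemma mpoly_eq_sum: "(f :: ('x, 'k::comm_ring_1) mpoly) = (\<Sum>m\<in>keys f. single 0 (lookup f m) * single m 1)"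
  by (simp add: mult_single sum_monomials)

lemma ideal_memI:
  assumes I: "ideal I (mpoly_ring V)" and "\<And>m. m \<in> keys f \<Longrightarrow> single m 1 \<in> I"
  shows "f \<in> I"
  by (subst mpoly_eq_sum) (intro ideal_sum[OF I] ideal_mpolyD(4)[OF I] carrier_const assms(2))

text \<open>Multiplying by a monomial shifts the leading monomial, so the leading monomials are
  already closed under multiples. Comparing initial ideals thus becomes comparing sets of
  exponents.\<close>

lemma (in variable_order) initial_ideal_eq:
  fixes I :: "('x, 'k::idom) mpoly set"
  assumes I: "ideal I (mpoly_ring V)"
  shows "initial_ideal V lt I = {g \<in> carrier (mpoly_ring V). \<forall>m\<in>keys g. \<exists>f\<in>I. leading f m}"
    (is "_ = ?T")
proof
  let ?G = "{single m (1 :: 'k) | m. \<exists>f\<in>I. leading f m}"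
  have G: "?G \<subseteq> carrier (mpoly_ring V)"
    using ideal_mpolyD(1)[OF I] by (auto simp: is_leading_monomial_def carrier_mpoly)
  have T: "ideal ?T (mpoly_ring V)"
  proof (rule ideal_mpolyI)
    fix a b :: "('x, 'k) mpoly"
    assume a: "a \<in> ?T"
    show "a + b \<in> ?T" if "b \<in> ?T"
      using a that Poly_Mapping.keys_add[of a b] carrier_add[of a V b] by blast
    show "b * a \<in> ?T" if b: "b \<in> carrier (mpoly_ring V)"
    proof -
      have "\<exists>f\<in>I. leading f m" if m: "m \<in> keys (b * a)" for m
      proof -
        obtain p q where pq: "m = p + q" "p \<in> keys b" "q \<in> keys a" using m by (rule keys_multE)
        then obtain f where f: "f \<in> I" "leading f q" using a by blast
        have "single p 1 \<in> carrier (mpoly_ring V)"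
          using b pq by (auto simp: carrier_mpoly)
        then have "single p 1 * f \<in> I" using ideal_mpolyD(4)[OF I f(1)] by blast
        moreover have "leading (single p 1 * f) m"
          using leading_mult(2)[OF leading_single[of 1 p] f(2)] pq by simp
        ultimately show ?thesis by blast
      qed
      then show ?thesis using a b carrier_mult by blast
    qed
  qed auto
  show "initial_ideal V lt I \<subseteq> ?T"
    unfolding initial_ideal_def
    by (rule mpoly.genideal_minimal[OF T]) (use G in auto)
  show "?T \<subseteq> initial_ideal V lt I"
  proof
    fix g assume g: "g \<in> ?T"
    show "g \<in> initial_ideal V lt I"
      unfolding initial_ideal_def
    proof (rule ideal_memI[OF mpoly.genideal_ideal[OF G]])
      fix m assume "m \<in> keys g"
      then show "single m 1 \<in> Idl\<^bsub>mpoly_ring V\<^esub> ?G"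
        using g mpoly.genideal_self[OF G] by blast
    qed
  qed
qed

definition restrict_monomials :: "(('x \<Rightarrow>\<^sub>0 nat) \<Rightarrow> bool) \<Rightarrow> ('x, 'k) mpoly \<Rightarrow> ('x, 'k::comm_ring_1) mpoly"
  where "restrict_monomials P = lin_ext (\<lambda>m. if P m then single m 1 else 0)"

lemma lookup_restrict_monomials:
  "lookup (restrict_monomials P f) m = (if P m then lookup f m else 0)"
  by (induction f rule: mpoly_induct)
     (auto simp: restrict_monomials_def lin_ext_add lin_ext_single lookup_add mult_single lookup_single_if)

text \<open>The parts of least weight have a nonzero product because polynomials form a domain, and
  no other product of terms has that weight. Applied below to the degree off a face, to plus and
  minus the total degree, and to minus the exponent of one variable.\<close>

lemma min_weight_mult:
  fixes f g :: "('x::linorder, 'k::idom) mpoly" and w :: "('x \<Rightarrow>\<^sub>0 nat) \<Rightarrow> 'w::linordered_cancel_ab_semigroup_add"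
  assumes w: "\<And>m n. w (m + n) = w m + w n"
    and m: "m \<in> keys f" "\<And>m'. m' \<in> keys f \<Longrightarrow> w m \<le> w m'"
    and n: "n \<in> keys g" "\<And>n'. n' \<in> keys g \<Longrightarrow> w n \<le> w n'"
  shows "\<exists>p\<in>keys (f * g). w p = w m + w n"
proof -
  define f0 where "f0 = restrict_monomials (\<lambda>p. w p = w m) f"
  define g0 where "g0 = restrict_monomials (\<lambda>p. w p = w n) g"
  have f0: "p \<in> keys f0 \<longleftrightarrow> p \<in> keys f \<and> w p = w m" for p
    by (auto simp: f0_def Poly_Mapping.in_keys_iff lookup_restrict_monomials)
  have g0: "p \<in> keys g0 \<longleftrightarrow> p \<in> keys g \<and> w p = w n" for p
    by (auto simp: g0_def Poly_Mapping.in_keys_iff lookup_restrict_monomials)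
  have f1: "w m < w p" if "p \<in> keys (f - f0)" for p
    using that m(2)[of p]
    by (auto simp: f0_def Poly_Mapping.in_keys_iff lookup_minus lookup_restrict_monomials split: if_splits)
  have g1: "w n < w p" if "p \<in> keys (g - g0)" for p
    using that n(2)[of p]
    by (auto simp: g0_def Poly_Mapping.in_keys_iff lookup_minus lookup_restrict_monomials split: if_splits)
  have "f0 \<noteq> 0" "g0 \<noteq> 0" using f0[of m] g0[of n] m n by auto
  then have "f0 * g0 \<noteq> 0" by simp
  then obtain p where p: "p \<in> keys (f0 * g0)" by (metis all_not_in_conv keys_eq_empty)
  have wp: "w p = w m + w n"
    using p by (rule keys_multE) (simp add: f0 g0 w)
  have "p \<notin> keys (f0 * (g - g0))"
  proof
    assume "p \<in> keys (f0 * (g - g0))"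
    then obtain a b where "p = a + b" "a \<in> keys f0" "b \<in> keys (g - g0)" by (rule keys_multE)
    then show False using wp f0 g1[of b] by (simp add: w)
  qed
  moreover have "p \<notin> keys ((f - f0) * g)"
  proof
    assume "p \<in> keys ((f - f0) * g)"
    then obtain a b where "p = a + b" "a \<in> keys (f - f0)" "b \<in> keys g" by (rule keys_multE)
    then show False using wp add_less_le_mono[OF f1[of a] n(2)[of b]] by (simp add: w)
  qed
  moreover have "f * g = f0 * g0 + (f0 * (g - g0) + (f - f0) * g)" by (simp add: algebra_simps)
  then have "lookup (f * g) p =
      lookup (f0 * g0) p + (lookup (f0 * (g - g0)) p + lookup ((f - f0) * g) p)"
    by (simp only: lookup_add)
  ultimately have "p \<in> keys (f * g)" using p by (simp add: Poly_Mapping.in_keys_iff)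
  then show ?thesis using wp by blast
qed

text \<open>Setting the variables outside \<open>F\<close> to zero is a ring homomorphism that
  truncates to the monomials supported on \<open>F\<close>. It presents face primes as kernels and
  detects divisibility by a variable.\<close>

lemma subst_face:
  fixes g :: "('x, 'k::comm_ring_1) mpoly"
  shows "lookup (subst (\<lambda>v. if v \<in> F then indet v else 0) g) m = (if keys m \<subseteq> F then lookup g m else 0)"
proof (induction g rule: mpoly_induct)
  case (single n c)
  have "(\<Prod>v\<in>keys n. (if v \<in> F then indet v else 0) ^ lookup n v) =
    (if keys n \<subseteq> F then single n (1 :: 'k) else 0)"
  proof (cases "keys n \<subseteq> F")
    case True
    then have "(\<Prod>v\<in>keys n. (if v \<in> F then indet v else (0 :: ('x, 'k) mpoly)) ^ lookup n v) =
        (\<Prod>v\<in>keys n. indet v ^ lookup n v)"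
      by (intro prod.cong) auto
    also have "\<dots> = subst indet (single n 1)" by (simp add: subst_single del: subst_id)
    finally show ?thesis using True by simp
  next
    case False
    then obtain v where "v \<in> keys n" "v \<notin> F" by blast
    then have "(if v \<in> F then indet v else (0 :: ('x, 'k) mpoly)) ^ lookup n v = 0"
      by (simp add: Poly_Mapping.in_keys_iff zero_power)
    then have "(\<Prod>v\<in>keys n. (if v \<in> F then indet v else (0 :: ('x, 'k) mpoly)) ^ lookup n v) = 0"
      using \<open>v \<in> keys n\<close> by (intro prod_zero[OF finite_keys] bexI[of _ v])
    then show ?thesis using False by simp
  qed
  then show ?case by (auto simp: subst_single mult_single lookup_single_if)
qed (simp_all add: subst.hom_add lookup_add)

section \<open>Squarefree monomial ideals of simplicial complexes\<close>

locale simplicial_complex =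
  fixes V :: "'x::linorder set" and \<Delta> :: "'x set set"
  assumes finite_V: "finite V" and faces_V: "\<And>F. F \<in> \<Delta> \<Longrightarrow> F \<subseteq> V"
    and empty_face: "{} \<in> \<Delta>" and subface: "\<And>F G. F \<in> \<Delta> \<Longrightarrow> G \<subseteq> F \<Longrightarrow> G \<in> \<Delta>"
begin

text \<open>Singletons need not be faces: in the application with \<open>t = 1\<close> the only face
  is empty, and this is the ideal generated by all variables.\<close>

definition stanley_reisner :: "('x, 'k::comm_ring_1) mpoly set" where
  "stanley_reisner = {g \<in> carrier (mpoly_ring V). \<forall>m\<in>keys g. keys m \<notin> \<Delta>}"

definition face_prime :: "'x set \<Rightarrow> ('x, 'k::comm_ring_1) mpoly set" where
  "face_prime F = {g \<in> carrier (mpoly_ring V). \<forall>m\<in>keys g. \<not> keys m \<subseteq> F}"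

definition facets :: "'x set set" where
  "facets = {F \<in> \<Delta>. \<forall>G\<in>\<Delta>. F \<subseteq> G \<longrightarrow> G = F}"

text \<open>The order of vanishing of a monomial along the coordinate subspace with coordinates
  \<open>F\<close>, that is, its order with respect to powers of
  \<open>face_prime F\<close>.\<close>

definition off_degree :: "'x set \<Rightarrow> ('x \<Rightarrow>\<^sub>0 nat) \<Rightarrow> nat" where
  "off_degree F m = (\<Sum>v\<in>V - F. lookup m v)"

lemma off_degree_add: "off_degree F (m + n) = off_degree F m + off_degree F n"
  by (simp add: off_degree_def lookup_add sum.distrib)

lemma finite_faces: "finite \<Delta>"
  using faces_V finite_V finite_subset[of \<Delta> "Pow V"] by auto

lemma face_facet: assumes "F \<in> \<Delta>" shows "\<exists>G\<in>facets. F \<subseteq> G"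
proof -
  obtain G where "G \<in> {G \<in> \<Delta>. F \<subseteq> G}" "\<forall>H\<in>{G \<in> \<Delta>. F \<subseteq> G}. G \<subseteq> H \<longrightarrow> G = H"
    using finite_has_maximal[of "{G \<in> \<Delta>. F \<subseteq> G}"] finite_faces assms by auto
  then show ?thesis unfolding facets_def by blast
qed

lemma ideal_stanley_reisner: "ideal (stanley_reisner :: ('x, 'k::comm_ring_1) mpoly set) (mpoly_ring V)"
proof (rule ideal_mpolyI)
  fix a b :: "('x, 'k) mpoly"
  assume a: "a \<in> stanley_reisner"
  show "a + b \<in> stanley_reisner" if "b \<in> stanley_reisner"
    using a that Poly_Mapping.keys_add[of a b] carrier_add[of a V b] unfolding stanley_reisner_def by blast
  show "b * a \<in> stanley_reisner" if b: "b \<in> carrier (mpoly_ring V)"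
  proof -
    have "keys m \<notin> \<Delta>" if "m \<in> keys (b * a)" for m
      using that
    proof (rule keys_multE)
      fix p q assume pq: "m = p + q" "p \<in> keys b" "q \<in> keys a"
      then have "keys q \<notin> \<Delta>" using a by (simp add: stanley_reisner_def)
      then show "keys m \<notin> \<Delta>" using subface[of "keys m" "keys q"] by (auto simp: pq keys_plus_nat)
    qed
    then show ?thesis using a b carrier_mult unfolding stanley_reisner_def by blast
  qed
qed (auto simp: stanley_reisner_def)

lemma face_prime_iff:
  "g \<in> face_prime F \<longleftrightarrow>
    g \<in> carrier (mpoly_ring V) \<and> subst (\<lambda>v. if v \<in> F then indet v else 0) g = 0"
proof -
  have "subst (\<lambda>v. if v \<in> F then indet v else 0) g = 0 \<longleftrightarrow> (\<forall>m. keys m \<subseteq> F \<longrightarrow> lookup g m = 0)"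
    by (auto simp: poly_mapping_eq_iff fun_eq_iff subst_face)
  then show ?thesis by (auto simp: face_prime_def Poly_Mapping.in_keys_iff)
qed

lemma primeideal_face_prime: "primeideal (face_prime F :: ('x, 'k::idom) mpoly set) (mpoly_ring V)"
proof (rule primeideal_mpolyI)
  show "ideal (face_prime F :: ('x, 'k) mpoly set) (mpoly_ring V)"
    by (rule ideal_mpolyI) (auto simp: face_prime_iff subst.hom_add subst.hom_mult intro: carrier_add carrier_mult)
qed (auto simp: face_prime_iff subst.hom_mult)

lemma stanley_reisner_subset: "F \<in> \<Delta> \<Longrightarrow> stanley_reisner \<subseteq> face_prime F"
  using subface by (auto simp: stanley_reisner_def face_prime_def)

definition face_exponent :: "'x set \<Rightarrow> 'x \<Rightarrow>\<^sub>0 nat" where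
  "face_exponent F = (\<Sum>v\<in>F. single v 1)"

lemma lookup_face_exponent: "finite F \<Longrightarrow> lookup (face_exponent F) v = (if v \<in> F then 1 else 0)"
  by (auto simp: face_exponent_def lookup_sum lookup_single_if)

lemma keys_face_exponent: "finite F \<Longrightarrow> keys (face_exponent F) = F"
  by (auto simp: Poly_Mapping.in_keys_iff lookup_face_exponent split: if_splits)

lemma prod_indet: "finite A \<Longrightarrow> (\<Prod>v\<in>A. indet v) = single (face_exponent A) (1 :: 'k::comm_ring_1)"
  unfolding face_exponent_def
  by (induction A rule: finite_induct) (simp_all add: indet_def mult_single)

text \<open>The variables outside \<open>Q\<close> form a face: otherwise their product would lie in
  the ideal, hence in \<open>Q\<close>, and so would one of them. All variables outside a facet
  above this face lie in \<open>Q\<close>.\<close>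

lemma prime_contains_face_prime:
  fixes Q :: "('x, 'k::idom) mpoly set"
  assumes Q: "primeideal Q (mpoly_ring V)" "stanley_reisner \<subseteq> Q"
  shows "\<exists>F\<in>facets. face_prime F \<subseteq> Q"
proof -
  note I = primeideal_mpolyD(1)[OF Q(1)]
  let ?F = "{v \<in> V. indet v \<notin> Q}"
  have finF: "finite ?F" using finite_V by simp
  have "?F \<in> \<Delta>"
  proof (rule ccontr)
    assume "?F \<notin> \<Delta>"
    then have "(\<Prod>v\<in>?F. indet v) \<in> (stanley_reisner :: ('x, 'k) mpoly set)"
      unfolding prod_indet[OF finF] by (auto simp: stanley_reisner_def keys_face_exponent[OF finF] carrier_single)
    then have "(\<Prod>v\<in>?F. indet v) \<in> Q" using Q(2) by blast
    then have "\<exists>v\<in>?F. indet v \<in> Q"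
      by (rule prime_prodD[OF Q(1) finF]) (simp add: carrier_indet)
    then show False by blast
  qed
  then obtain F where F: "F \<in> facets" "?F \<subseteq> F" using face_facet by blast
  have "g \<in> Q" if g: "g \<in> face_prime F" for g
  proof (rule ideal_memI[OF I])
    fix m assume m: "m \<in> keys g"
    then obtain v where v: "v \<in> keys m" "v \<notin> F" using g by (auto simp: face_prime_def)
    have mV: "keys m \<subseteq> V" using g m by (auto simp: face_prime_def carrier_mpoly)
    then have "indet v \<in> Q" using v F(2) by blast
    moreover have "single m 1 = single (m - single v 1) 1 * indet v"
      using exponent_minus_single[OF in_keysD[OF v(1)]] by (simp flip: single_add_indet)
    moreover have "keys (m - single v 1) \<subseteq> keys m"
      by (auto simp: Poly_Mapping.in_keys_iff lookup_minus)
    then have "single (m - single v 1) 1 \<in> carrier (mpoly_ring V)"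
      using mV by (intro carrier_singleI) auto
    ultimately show "single m 1 \<in> Q" using ideal_mpolyD(4)[OF I] by metis
  qed
  then show ?thesis using F(1) by blast
qed

lemma face_prime_subsetD:
  assumes "face_prime F \<subseteq> (face_prime G :: ('x, 'k::idom) mpoly set)" "G \<subseteq> V"
  shows "G \<subseteq> F"
proof
  fix v assume v: "v \<in> G"
  show "v \<in> F"
  proof (rule ccontr)
    assume "v \<notin> F"
    then have "indet v \<in> (face_prime F :: ('x, 'k) mpoly set)"
      using v assms(2) by (auto simp: face_prime_iff carrier_indet)
    then have "indet v \<in> (face_prime G :: ('x, 'k) mpoly set)" using assms(1) by blast
    then show False using v by (simp add: face_prime_def indet_def)
  qed
qed

text \<open>Face primes reverse inclusion, so minimality of the prime is maximality of the
  face.\<close>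

lemma minimal_primes_stanley_reisner:
  "minimal_primes (mpoly_ring V) (stanley_reisner :: ('x, 'k::idom) mpoly set) = face_prime ` facets"
proof (intro equalityI subsetI)
  fix Q :: "('x, 'k) mpoly set"
  assume "Q \<in> minimal_primes (mpoly_ring V) stanley_reisner"
  then have Q: "primeideal Q (mpoly_ring V)" "stanley_reisner \<subseteq> Q"
    "\<And>P. primeideal P (mpoly_ring V) \<Longrightarrow> stanley_reisner \<subseteq> P \<Longrightarrow> P \<subseteq> Q \<Longrightarrow> P = Q"
    by (auto simp: minimal_primes_def)
  obtain F where F: "F \<in> facets" "face_prime F \<subseteq> Q" using prime_contains_face_prime[OF Q(1,2)] by blast
  then have "face_prime F = Q"
    using Q(3)[OF primeideal_face_prime] stanley_reisner_subset by (auto simp: facets_def)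
  then show "Q \<in> face_prime ` facets" using F by blast
next
  fix Q :: "('x, 'k) mpoly set"
  assume "Q \<in> face_prime ` facets"
  then obtain F where F: "F \<in> facets" "Q = face_prime F" by blast
  then have F': "F \<in> \<Delta>" "F \<subseteq> V" using faces_V by (auto simp: facets_def)
  have "P = Q" if P: "primeideal P (mpoly_ring V)" "stanley_reisner \<subseteq> P" "P \<subseteq> Q" for P
  proof -
    obtain G where G: "G \<in> facets" "face_prime G \<subseteq> P" using prime_contains_face_prime[OF P(1,2)] by blast
    then have "F \<subseteq> G" using face_prime_subsetD[of G F] P(3) F(2) F'(2) by blast
    then have "G = F" using F(1) G(1) by (auto simp: facets_def)
    then show ?thesis using G P F by blast
  qed
  then show "Q \<in> minimal_primes (mpoly_ring V) stanley_reisner"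
    using F(2) primeideal_face_prime[of F] stanley_reisner_subset[OF F'(1)]
    unfolding minimal_primes_def by blast
qed

lemma ideal_pow_off_degree:
  assumes "F \<in> \<Delta>" "g \<in> ideal_pow V (stanley_reisner :: ('x, 'k::idom) mpoly set) n" "m \<in> keys g"
  shows "n \<le> off_degree F m"
  using assms(2,3)
proof (induction n arbitrary: g m)
  case (Suc n)
  from Suc.prems show ?case unfolding ideal_pow_Suc
  proof (induction g arbitrary: m rule: ideal_prod.induct)
    case (prod i j)
    from prod(3) obtain p q where pq: "m = p + q" "p \<in> keys i" "q \<in> keys j"
      by (simp) (erule keys_multE, blast)
    have "keys q \<notin> \<Delta>" "keys q \<subseteq> V" using prod(2) pq by (auto simp: stanley_reisner_def carrier_mpoly)
    then obtain v where v: "v \<in> keys q" "v \<in> V - F" using subface[OF assms(1)] by blast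
    have "lookup q v \<le> off_degree F q"
      unfolding off_degree_def using v finite_V by (intro member_le_sum) auto
    then have "1 \<le> off_degree F q" using in_keysD[OF v(1)] by linarith
    then show ?case using Suc.IH[OF prod(1) pq(2)] by (simp add: pq off_degree_add)
  next
    case (sum s1 s2)
    then show ?case using Poly_Mapping.keys_add[of s1 s2] by auto
  qed
qed simp

lemma facet_power_mem:
  assumes F: "F \<in> facets" and "keys m \<subseteq> V" "n \<le> off_degree F m"
  shows "single (face_exponent F) 1 ^ n * single m 1 \<in>
    ideal_pow V (stanley_reisner :: ('x, 'k::idom) mpoly set) n"
  using assms(2,3)
proof (induction n arbitrary: m)
  case 0
  then show ?case by (simp add: ideal_pow_0 carrier_single)
next
  case (Suc n)
  have FV: "F \<in> \<Delta>" "F \<subseteq> V" "finite F"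
    using F faces_V finite_V finite_subset[of F V] by (auto simp: facets_def)
  have "off_degree F m \<noteq> 0" using Suc.prems by simp
  then obtain v where v: "v \<in> V - F" "lookup m v \<noteq> 0"
    unfolding off_degree_def by (meson sum.neutral)
  define m' where "m' = m - single v 1"
  have m: "m = m' + single v 1" using exponent_minus_single[OF v(2)] by (simp add: m'_def)
  have "off_degree F (single v 1) = 1"
    using v(1) finite_V by (simp add: off_degree_def lookup_single_if)
  then have "n \<le> off_degree F m'" using Suc.prems by (simp add: m off_degree_add)
  moreover have "keys m' \<subseteq> V" using Suc.prems by (simp add: m keys_plus_nat)
  ultimately have IH: "single (face_exponent F) 1 ^ n * single m' 1 \<in> ideal_pow V (stanley_reisner :: ('x, 'k) mpoly set) n"
    using Suc.IH by blast
  have "F \<union> {v} \<notin> \<Delta>" using F v by (auto simp: facets_def)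
  then have "single (face_exponent F + single v 1) (1 :: 'k) \<in> stanley_reisner"
    using v FV by (auto simp: stanley_reisner_def carrier_single keys_plus_nat keys_face_exponent)
  then have "single (face_exponent F) 1 ^ n * single m' 1 * single (face_exponent F + single v 1) 1 \<in>
      ideal_pow V (stanley_reisner :: ('x, 'k) mpoly set) (Suc n)"
    unfolding ideal_pow_Suc using ideal_prod.prod[OF IH, of _ _ "mpoly_ring V"] by simp
  also have "single (face_exponent F) 1 ^ n * single m' 1 * single (face_exponent F + single v 1) 1 =
      single (face_exponent F) 1 ^ Suc n * (single m 1 :: ('x, 'k) mpoly)"
    unfolding m single_add_indet by (simp only: power_Suc mult_ac)
  finally show ?case .
qed

text \<open>For a facet \<open>F\<close> and a variable \<open>v\<close> outside it, \<open>x\<^sup>F x\<^sub>v\<close> lies in the ideal. So multiplying by a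
  power of \<open>x\<^sup>F\<close> moves a monomial of degree \<open>n\<close> off \<open>F\<close> into the \<open>n\<close>-th power of the ideal, and the
  sum of these powers over all facets avoids every minimal prime.\<close>

theorem symbolic_power_stanley_reisner:
  "symbolic_power (mpoly_ring V) (stanley_reisner :: ('x, 'k::idom) mpoly set) n =
    {g \<in> carrier (mpoly_ring V). \<forall>m\<in>keys g. \<forall>F\<in>\<Delta>. n \<le> off_degree F m}"
proof -
  let ?SR = "stanley_reisner :: ('x, 'k) mpoly set"
  have mp: "minimal_primes (mpoly_ring V) ?SR \<noteq> {}"
    using face_facet[OF empty_face] by (auto simp: minimal_primes_stanley_reisner)
  note iff = symbolic_power_iff[OF ideal_stanley_reisner mp, of _ n]
  show ?thesis
  proof (intro equalityI subsetI)
    fix g :: "('x, 'k) mpoly"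
    assume "g \<in> symbolic_power (mpoly_ring V) ?SR n"
    then obtain s where g: "g \<in> carrier (mpoly_ring V)" and s: "s \<in> carrier (mpoly_ring V)"
      "s \<notin> \<Union>(face_prime ` facets)" "s * g \<in> ideal_pow V ?SR n"
      using iff by (auto simp: minimal_primes_stanley_reisner)
    have "n \<le> off_degree F m" if m: "m \<in> keys g" and F: "F \<in> \<Delta>" for m F
    proof (rule ccontr)
      assume less: "\<not> n \<le> off_degree F m"
      obtain G where G: "G \<in> facets" "F \<subseteq> G" using face_facet[OF F] by blast
      then have G': "G \<in> \<Delta>" by (simp add: facets_def)
      have le: "off_degree G m \<le> off_degree F m"
        unfolding off_degree_def using G(2) finite_V by (intro sum_mono2) auto
      \<comment> \<open>A denominator outside \<open>face_prime G\<close> has a term of weight zero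
        off \<open>G\<close>. Hence the least weight in \<open>s * g\<close> equals that in
        \<open>g\<close>, and the bound for \<open>s * g\<close> passes to \<open>g\<close>.\<close>
      have "s \<notin> face_prime G" using s(2) G(1) by blast
      then obtain p where p: "p \<in> keys s" "keys p \<subseteq> G" using s(1) by (auto simp: face_prime_def)
      have p0: "off_degree G p = 0"
        using p(2) by (auto simp: off_degree_def Poly_Mapping.in_keys_iff intro!: sum.neutral)
      obtain q where q: "q \<in> keys g" "\<And>q'. q' \<in> keys g \<Longrightarrow> off_degree G q \<le> off_degree G q'"
        using arg_min_if_finite(1)[OF finite_keys, of g "off_degree G"]
          arg_min_least[OF finite_keys, of g _ "off_degree G"] m by (metis empty_iff)
      obtain r where r: "r \<in> keys (s * g)" "off_degree G r = off_degree G p + off_degree G q"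
        using min_weight_mult[of "off_degree G" p s q g, OF off_degree_add p(1) _ q] p0 by auto
      have "n \<le> off_degree G r" by (rule ideal_pow_off_degree[OF G' s(3) r(1)])
      then show False using r(2) p0 q(2)[OF m] le less by simp
    qed
    then show "g \<in> {g \<in> carrier (mpoly_ring V). \<forall>m\<in>keys g. \<forall>F\<in>\<Delta>. n \<le> off_degree F m}"
      using g by blast
  next
    fix g :: "('x, 'k) mpoly"
    assume "g \<in> {g \<in> carrier (mpoly_ring V). \<forall>m\<in>keys g. \<forall>F\<in>\<Delta>. n \<le> off_degree F m}"
    then have g: "g \<in> carrier (mpoly_ring V)" "\<And>m F. m \<in> keys g \<Longrightarrow> F \<in> \<Delta> \<Longrightarrow> n \<le> off_degree F m"
      by auto
    have fin: "finite F" "F \<subseteq> V" "F \<in> \<Delta>" if "F \<in> facets" for F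
      using that faces_V finite_V finite_subset[of F V] by (auto simp: facets_def)
    have finfac: "finite facets" using finite_faces by (simp add: facets_def)
    let ?e = "\<lambda>F. single (face_exponent F) (1 :: 'k)"
    \<comment> \<open>The exponent is \<open>Suc n\<close> rather than \<open>n\<close> so that even
      for \<open>n = 0\<close> each summand is a monomial with support exactly \<open>F\<close>;
      summands of distinct facets then cannot cancel.\<close>
    define s where "s = (\<Sum>F\<in>facets. ?e F ^ Suc n)"
    have eC: "?e F \<in> carrier (mpoly_ring V)" if "F \<in> facets" for F
      using fin[OF that] by (simp add: carrier_single keys_face_exponent)
    have sC: "s \<in> carrier (mpoly_ring V)"
      unfolding s_def by (intro carrier_sum carrier_power eC)
    have pow: "\<exists>p. ?e F ^ Suc k = single p 1 \<and> keys p = F \<and> (\<forall>v. lookup p v = Suc k * lookup (face_exponent F) v)"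
      if "F \<in> facets" for F k
    proof (induction k)
      case 0
      then show ?case using fin[OF that] by (intro exI[of _ "face_exponent F"]) (simp add: keys_face_exponent)
    next
      case (Suc k)
      then obtain p where p: "?e F ^ Suc k = single p 1" "keys p = F" "\<forall>v. lookup p v = Suc k * lookup (face_exponent F) v"
        by blast
      have "?e F ^ Suc (Suc k) = single (face_exponent F + p) 1"
        using p(1) by (simp only: power_Suc[of _ "Suc k"] mult_single) simp
      moreover have "keys (face_exponent F + p) = F"
        using p(2) fin[OF that] by (simp add: keys_plus_nat keys_face_exponent)
      moreover have "\<forall>v. lookup (face_exponent F + p) v = Suc (Suc k) * lookup (face_exponent F) v"
        using p(3) by (simp add: lookup_add)
      ultimately show ?case by blast
    qed
    have "s \<notin> face_prime F" if F: "F \<in> facets" for F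
    proof -
      obtain p where p: "?e F ^ Suc n = single p 1" "keys p = F" using pow[OF F] by blast
      have "lookup (?e G ^ Suc n) p = (if G = F then 1 else 0)" if "G \<in> facets" for G
      proof -
        obtain q where q: "?e G ^ Suc n = single q 1" "keys q = G" using pow[OF \<open>G \<in> facets\<close>] by blast
        show ?thesis
        proof (cases "G = F")
          case True
          then show ?thesis by (simp only: p(1) lookup_single_eq if_True simp_thms)
        next
          case False
          then have "q \<noteq> p" using p(2) q(2) by blast
          then show ?thesis using False by (simp only: q(1) lookup_single_not_eq if_False simp_thms)
        qed
      qed
      then have "lookup s p = 1"
        unfolding s_def lookup_sum using F finfac by (simp add: sum.delta cong: sum.cong)
      then have "p \<in> keys s" by (simp add: Poly_Mapping.in_keys_iff)
      then show ?thesis using p(2) by (auto simp: face_prime_def)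
    qed
    moreover have "s * g \<in> ideal_pow V ?SR n"
    proof -
      note J = ideal_ideal_pow[OF ideal_stanley_reisner, of n]
      have mem: "s * single m 1 \<in> ideal_pow V ?SR n" if m: "m \<in> keys g" for m
      proof -
        have "?e F ^ Suc n * single m 1 \<in> ideal_pow V ?SR n" if F: "F \<in> facets" for F
        proof -
          have "?e F * (?e F ^ n * single m 1) \<in> ideal_pow V ?SR n"
            using g m fin(3)[OF F]
            by (intro ideal_mpolyD(4)[OF J facet_power_mem[OF F]] eC F) (auto simp: carrier_mpoly)
          then show ?thesis by (simp add: mult.assoc)
        qed
        then show ?thesis unfolding s_def sum_distrib_right by (intro ideal_sum[OF J])
      qed
      have "s * g = (\<Sum>m\<in>keys g. single 0 (lookup g m) * (s * single m 1))"
        by (subst (1) mpoly_eq_sum[of g]) (simp add: sum_distrib_left mult_ac)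
      also have "\<dots> \<in> ideal_pow V ?SR n"
        by (intro ideal_sum[OF J] ideal_mpolyD(4)[OF J] mem carrier_const)
      finally show ?thesis .
    qed
    ultimately show "g \<in> symbolic_power (mpoly_ring V) ?SR n"
      using iff g(1) sC by (auto simp: minimal_primes_stanley_reisner)
  qed
qed

end

section \<open>Duality between chains and unions of antichains\<close>

subsection \<open>Potentials for an optimal assignment\<close>

fun walk_weight :: "('b \<Rightarrow> 'b \<Rightarrow> int) \<Rightarrow> 'b list \<Rightarrow> int" where
  "walk_weight c (i # j # xs) = c i j + walk_weight c (j # xs)"
| "walk_weight c xs = 0"

lemma walk_weight_append:
  "walk_weight c (as @ i # bs) = walk_weight c (as @ [i]) + walk_weight c (i # bs)"
proof (induction as)
  case (Cons a as)
  then show ?case by (cases as) auto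
qed simp

lemma walk_weight_nth:
  "walk_weight c (i # xs) = (\<Sum>k<length xs. c ((i # xs) ! k) (xs ! k))"
proof (induction xs arbitrary: i)
  case (Cons j xs)
  show ?case by (simp add: Cons sum.lessThan_Suc_shift del: sum.lessThan_Suc)
qed simp

text \<open>Turns a closed walk into a permutation that can be composed with an assignment.\<close>

lemma cyclic_shift_permutes:
  assumes "distinct (i # xs)"
  obtains \<tau> where "\<tau> permutes set (i # xs)"
    "\<And>k. k < length (i # xs) \<Longrightarrow> \<tau> ((i # xs) ! k) = (xs @ [i]) ! k"
proof -
  let ?l = "i # xs" and ?r = "xs @ [i]"
  let ?n = "length ?l"
  have bl: "bij_betw (nth ?l) {..<?n} (set ?l)"
    using assms by (intro bij_betw_nth) auto
  have br: "bij_betw (nth ?r) {..<?n} (set ?l)"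
    using assms by (intro bij_betw_nth) auto
  let ?ind = "the_inv_into {..<?n} (nth ?l)"
  define \<tau> where "\<tau> x = (if x \<in> set ?l then ?r ! ?ind x else x)" for x
  have "bij_betw (nth ?r \<circ> ?ind) (set ?l) (set ?l)"
    by (rule bij_betw_trans[OF bij_betw_the_inv_into[OF bl] br])
  then have "bij_betw \<tau> (set ?l) (set ?l)"
    by (rule bij_betw_cong[THEN iffD1, rotated]) (simp add: \<tau>_def)
  then have "\<tau> permutes set ?l" by (rule bij_imp_permutes) (simp only: \<tau>_def if_False)
  moreover have "\<tau> (?l ! k) = ?r ! k" if "k < ?n" for k
  proof -
    have "?ind (?l ! k) = k" using bl that by (intro the_inv_into_f_f) (auto simp: bij_betw_def)
    moreover have "?l ! k \<in> set ?l" using that by (rule nth_mem)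
    ultimately show ?thesis by (simp only: \<tau>_def if_True)
  qed
  ultimately show ?thesis by (rule that)
qed

text \<open>The potential of \<open>i\<close> is the largest weight of a walk without repetitions that starts at \<open>i\<close>.
  Prepending an arc to such a walk closes at most one cycle, whose weight is not positive.\<close>

lemma potential_exists:
  assumes fin: "finite Y"
    and cyc: "\<And>i xs. distinct (i # xs) \<Longrightarrow> set (i # xs) \<subseteq> Y \<Longrightarrow> successively E (i # xs @ [i]) \<Longrightarrow>
      walk_weight c (i # xs @ [i]) \<le> 0"
  obtains \<pi> :: "'b \<Rightarrow> int" where
    "\<And>i j. i \<in> Y \<Longrightarrow> j \<in> Y \<Longrightarrow> E i j \<Longrightarrow> c i j + \<pi> j \<le> \<pi> i"
proof -
  define S where "S i = {xs. distinct (i # xs) \<and> set (i # xs) \<subseteq> Y \<and> successively E (i # xs)}" for i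
  have finS: "finite (S i)" for i
    by (rule finite_subset[OF _ finite_subset_distinct[OF fin]]) (auto simp: S_def)
  define \<pi> where "\<pi> i = Max ((\<lambda>xs. walk_weight c (i # xs)) ` S i)" for i
  have le: "walk_weight c (i # xs) \<le> \<pi> i" if "xs \<in> S i" for i xs
    unfolding \<pi>_def using finS that by (intro Max_ge) auto
  have "c i j + \<pi> j \<le> \<pi> i" if ij: "i \<in> Y" "j \<in> Y" "E i j" for i j
  proof -
    have "[] \<in> S j" using ij by (simp add: S_def)
    then have "\<pi> j \<in> (\<lambda>xs. walk_weight c (j # xs)) ` S j"
      unfolding \<pi>_def using finS by (intro Max_in) auto
    then obtain xs where xs: "xs \<in> S j" "\<pi> j = walk_weight c (j # xs)" by blast
    have eq: "c i j + \<pi> j = walk_weight c (i # j # xs)" by (simp add: xs)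
    show ?thesis
    proof (cases "i \<in> set (j # xs)")
      case False
      then have "j # xs \<in> S i" using xs(1) ij by (simp add: S_def)
      then show ?thesis using le eq by metis
    next
      case True
      then obtain as bs where ab: "j # xs = as @ i # bs" using split_list by metis
      have s: "successively E (i # as @ i # bs)" "distinct (as @ i # bs)" "set (as @ i # bs) \<subseteq> Y"
        using xs(1) ij unfolding ab[symmetric] S_def by simp_all
      have "successively E ((i # as) @ i # bs)" using s(1) by simp
      then have "successively E ((i # as) @ [i])" "successively E (i # bs)"
        unfolding successively_append_iff by auto
      then have "walk_weight c (i # as @ [i]) \<le> 0" "walk_weight c (i # bs) \<le> \<pi> i"
        using s ij by (auto intro!: cyc le simp: S_def)
      moreover have "walk_weight c (i # j # xs) = walk_weight c (i # as @ [i]) + walk_weight c (i # bs)"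
        unfolding ab using walk_weight_append[of c "i # as" i bs] by simp
      ultimately show ?thesis using eq by linarith
    qed
  qed
  then show ?thesis by (rule that)
qed

text \<open>Linear programming duality for assignments with integer weights. At an assignment of
  maximal weight, rerouting along a cycle never gains, so potentials exist; they are the dual
  solution, and it is integral.\<close>

lemma optimal_assignment:
  fixes W :: "'b \<Rightarrow> 'b \<Rightarrow> int"
  assumes fin: "finite Y" and diag: "\<And>y. y \<in> Y \<Longrightarrow> A y y"
  obtains \<sigma> \<alpha> \<beta> where "\<sigma> permutes Y" "\<And>y. y \<in> Y \<Longrightarrow> A y (\<sigma> y)"
    "\<And>x y. x \<in> Y \<Longrightarrow> y \<in> Y \<Longrightarrow> A x y \<Longrightarrow> W x y \<le> \<alpha> x + \<beta> y"
    "\<And>x. x \<in> Y \<Longrightarrow> W x (\<sigma> x) = \<alpha> x + \<beta> (\<sigma> x)"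
proof -
  let ?P = "{\<sigma>. \<sigma> permutes Y \<and> (\<forall>y\<in>Y. A y (\<sigma> y))}"
  let ?w = "\<lambda>\<sigma>. \<Sum>y\<in>Y. W y (\<sigma> y)"
  have finP: "finite ?P" using finite_permutations[OF fin] by simp
  have "id \<in> ?P" using diag by (auto intro: permutes_id)
  then have "Max (?w ` ?P) \<in> ?w ` ?P" using finP by (intro Max_in) blast+
  then obtain \<sigma> where \<sigma>: "\<sigma> \<in> ?P" "?w \<sigma> = Max (?w ` ?P)" by force
  have opt: "?w \<tau> \<le> ?w \<sigma>" if "\<tau> \<in> ?P" for \<tau>
    unfolding \<sigma>(2) using finP that by (intro Max_ge) blast+
  have \<sigma>Y: "\<sigma> y \<in> Y \<longleftrightarrow> y \<in> Y" for y using \<sigma>(1) permutes_in_image by fastforce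
  \<comment> \<open>\<open>c i j\<close> is the gain when \<open>i\<close> gives up its own target
    for that of \<open>j\<close>; \<open>E\<close> says that this exchange is allowed.\<close>
  define c where "c i j = W i (\<sigma> j) - W i (\<sigma> i)" for i j
  define E where "E i j \<longleftrightarrow> A i (\<sigma> j)" for i j
  have cyc: "walk_weight c (i # xs @ [i]) \<le> 0"
    if xs: "distinct (i # xs)" "set (i # xs) \<subseteq> Y" "successively E (i # xs @ [i])" for i xs
  proof -
    let ?l = "i # xs" and ?r = "xs @ [i]"
    obtain \<tau> where \<tau>: "\<tau> permutes set ?l" "\<And>k. k < length ?l \<Longrightarrow> \<tau> (?l ! k) = ?r ! k"
      using cyclic_shift_permutes[OF xs(1)] by blast
    have \<tau>Y: "\<tau> permutes Y" using \<tau>(1) xs(2) by (rule permutes_subset)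
    have E: "E x (\<tau> x)" if x: "x \<in> set ?l" for x
    proof -
      obtain k where k: "k < length ?l" "x = ?l ! k"
        using x unfolding in_set_conv_nth by blast
      have "E ((i # ?r) ! k) ((i # ?r) ! Suc k)"
      proof -
        have "Suc k < length (i # ?r)" using k(1) by simp
        then show ?thesis using xs(3) by (simp only: successively_conv_nth)
      qed
      moreover have "(i # ?r) ! k = x"
        using k by (cases k) (simp_all add: nth_append)
      moreover have "(i # ?r) ! Suc k = \<tau> x" using \<tau>(2)[OF k(1)] k(2) by simp
      ultimately show ?thesis by simp
    qed
    have "A y (\<sigma> (\<tau> y))" if "y \<in> Y" for y
    proof (cases "y \<in> set ?l")
      case True
      then show ?thesis using E by (simp only: E_def)
    next
      case False
      with \<tau>(1) have "\<tau> y = y" by (rule permutes_not_in)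
      then show ?thesis using \<sigma>(1) that by simp
    qed
    moreover have "\<sigma> \<circ> \<tau> permutes Y" using \<sigma>(1) \<tau>Y by (intro permutes_compose) auto
    ultimately have "?w (\<sigma> \<circ> \<tau>) \<le> ?w \<sigma>" by (intro opt) (simp add: o_def)
    then have "(\<Sum>y\<in>Y. c y (\<tau> y)) \<le> 0"
      by (simp add: c_def sum_subtractf)
    also have "(\<Sum>y\<in>Y. c y (\<tau> y)) = (\<Sum>y\<in>set ?l. c y (\<tau> y))"
    proof (rule sum.mono_neutral_right[OF fin xs(2)], rule ballI)
      fix y assume "y \<in> Y - set ?l"
      then have "y \<notin> set ?l" by simp
      with \<tau>(1) have "\<tau> y = y" by (rule permutes_not_in)
      then show "c y (\<tau> y) = 0" by (simp add: c_def)
    qed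
    also have "\<dots> = (\<Sum>k<length ?l. c (?l ! k) (\<tau> (?l ! k)))"
      by (rule sum.reindex_bij_betw[symmetric], rule bij_betw_nth[OF xs(1)]) auto
    also have "\<dots> = (\<Sum>k<length ?l. c ((i # ?r) ! k) (?r ! k))"
    proof (rule sum.cong[OF refl])
      fix k assume "k \<in> {..<length ?l}"
      then have k: "k < length ?l" by simp
      have "(i # ?r) ! k = ?l ! k"
        using k by (cases k) (simp_all add: nth_append)
      then show "c (?l ! k) (\<tau> (?l ! k)) = c ((i # ?r) ! k) (?r ! k)"
        using \<tau>(2)[OF k] by simp
    qed
    also have "\<dots> = walk_weight c (i # ?r)"
      by (simp only: walk_weight_nth length_append_singleton length_Cons)
    finally show ?thesis by simp
  qed
  obtain \<pi> where \<pi>: "\<And>i j. i \<in> Y \<Longrightarrow> j \<in> Y \<Longrightarrow> E i j \<Longrightarrow> c i j + \<pi> j \<le> \<pi> i"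
    using potential_exists[OF fin cyc] by blast
  have inv: "inv_into UNIV \<sigma> (\<sigma> y) = y" "\<sigma> (inv_into UNIV \<sigma> y) = y" for y
    using \<sigma>(1) permutes_inverses by fastforce+
  show ?thesis
  proof (rule that)
    show "\<sigma> permutes Y" "\<And>y. y \<in> Y \<Longrightarrow> A y (\<sigma> y)" using \<sigma>(1) by auto
    \<comment> \<open>The dual variables are \<open>\<alpha> x = W x (\<sigma> x) + \<pi> x\<close>,
      and \<open>\<beta> y\<close> is minus the potential of the element assigned to
      \<open>y\<close>. Tightness then holds by construction, and feasibility is the inequality for
      \<open>\<pi>\<close>.\<close>
    show "W x (\<sigma> x) = (W x (\<sigma> x) + \<pi> x) + - \<pi> (inv_into UNIV \<sigma> (\<sigma> x))" for x by (simp add: inv)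
    show "W x y \<le> (W x (\<sigma> x) + \<pi> x) + - \<pi> (inv_into UNIV \<sigma> y)" if "x \<in> Y" "y \<in> Y" "A x y" for x y
    proof -
      have "inv_into UNIV \<sigma> y \<in> Y" using \<sigma>Y[of "inv_into UNIV \<sigma> y"] that(2) by (simp add: inv)
      then have "c x (inv_into UNIV \<sigma> y) + \<pi> (inv_into UNIV \<sigma> y) \<le> \<pi> x" using that by (intro \<pi>) (auto simp: E_def inv)
      then show ?thesis by (simp add: c_def inv)
    qed
  qed
qed

subsection \<open>Chain families\<close>

locale strict_poset =
  fixes less :: "'a \<Rightarrow> 'a \<Rightarrow> bool" (infix "\<sqsubset>" 50)
  assumes less_irrefl: "\<not> x \<sqsubset> x" and less_trans: "x \<sqsubset> y \<Longrightarrow> y \<sqsubset> z \<Longrightarrow> x \<sqsubset> z"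
begin

definition chain :: "'a set \<Rightarrow> bool" where
  "chain C \<longleftrightarrow> (\<forall>x\<in>C. \<forall>y\<in>C. x = y \<or> x \<sqsubset> y \<or> y \<sqsubset> x)"

definition chains_le :: "nat \<Rightarrow> 'a set \<Rightarrow> bool" where
  "chains_le k F \<longleftrightarrow> (\<forall>C\<subseteq>F. chain C \<longrightarrow> card C \<le> k)"

lemma chain_subset: "chain C \<Longrightarrow> D \<subseteq> C \<Longrightarrow> chain D"
  unfolding chain_def by blast

text \<open>Mirsky's argument: colour \<open>x\<close> by the length of a longest chain strictly
  below it. This rises along the order, and adding \<open>x\<close> to such a chain shows that the
  colour stays below \<open>k\<close>.\<close>

lemma antichain_colouring:
  assumes fin: "finite F" and "chains_le k F"
  obtains col :: "'a \<Rightarrow> nat" where "\<And>x. x \<in> F \<Longrightarrow> col x < k"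
    "\<And>x y. x \<in> F \<Longrightarrow> y \<in> F \<Longrightarrow> x \<sqsubset> y \<Longrightarrow> col x \<noteq> col y"
proof -
  define S where "S x = {C. C \<subseteq> F \<and> chain C \<and> (\<forall>y\<in>C. y \<sqsubset> x)}" for x
  define col where "col x = Max (card ` S x)" for x
  have finS: "finite (S x)" for x
    by (rule finite_subset[of _ "Pow F"]) (use fin in \<open>auto simp: S_def\<close>)
  have "{} \<in> S x" for x by (simp add: S_def chain_def)
  then have "col x \<in> card ` S x" for x
    unfolding col_def by (intro Max_in) (use finS in auto)
  then have ex: "\<exists>C\<in>S x. col x = card C" for x by blast
  have le: "C \<in> S x \<Longrightarrow> card C \<le> col x" for C x
    unfolding col_def by (intro Max_ge) (use finS in auto)
  have ext: "\<exists>C\<subseteq>F. chain C \<and> card C = Suc (col x) \<and> (\<forall>y\<in>C. y = x \<or> y \<sqsubset> x)" if x: "x \<in> F" for x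
  proof -
    obtain C where C: "C \<in> S x" "col x = card C" using ex by blast
    then have C': "C \<subseteq> F" "chain C" "\<forall>y\<in>C. y \<sqsubset> x" by (auto simp: S_def)
    then have "x \<notin> C" using less_irrefl by blast
    then have "card (insert x C) = Suc (col x)"
      using C(2) finite_subset[OF C'(1) fin] by simp
    moreover have "chain (insert x C)" using C' unfolding chain_def by blast
    ultimately show ?thesis using C' x by (intro exI[of _ "insert x C"]) auto
  qed
  show ?thesis
  proof (rule that[of col])
    fix x assume "x \<in> F"
    then obtain C where "C \<subseteq> F" "chain C" "card C = Suc (col x)" using ext by blast
    then show "col x < k" using assms(2) unfolding chains_le_def by (metis Suc_le_eq)
    fix y assume y: "y \<in> F" "x \<sqsubset> y"
    obtain C where C: "C \<subseteq> F" "chain C" "card C = Suc (col x)" "\<forall>z\<in>C. z = x \<or> z \<sqsubset> x"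
      using ext[OF \<open>x \<in> F\<close>] by blast
    have "z \<sqsubset> y" if "z \<in> C" for z
      using C(4) that y(2) less_trans[of z x y] by auto
    then have "C \<in> S y" using C by (simp add: S_def)
    then show "col x \<noteq> col y" using le C(3) by fastforce
  qed
qed

text \<open>A family of disjoint chains is encoded as a permutation of \<open>X\<close> and \<open>card X + 1\<close> dummies: an
  element is mapped to its successor, the last element of a chain to a dummy, a dummy to the first
  element of a chain, and an unused element to itself. The weights make a chain \<open>C\<close> contribute
  \<open>card C - k\<close>. The surplus dummy forces some dummy to be mapped to a dummy, which normalizes the
  dual solution.\<close>

lemma chain_duality:
  assumes fin: "finite X"
  obtains F St and C :: "'a \<Rightarrow> 'a set" where
    "F \<subseteq> X" "chains_le k F" "St \<subseteq> X" "\<And>s. s \<in> St \<Longrightarrow> C s \<subseteq> X" "\<And>s. s \<in> St \<Longrightarrow> chain (C s)"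
    "\<And>s t. s \<in> St \<Longrightarrow> t \<in> St \<Longrightarrow> s \<noteq> t \<Longrightarrow> C s \<inter> C t = {}"
    "card (X - F) \<le> (\<Sum>s\<in>St. card (C s) - k)"
proof -
  let ?D = "{..card X}"
  define Y :: "('a + nat) set" where "Y = Inl ` X \<union> Inr ` ?D"
  define A :: "'a + nat \<Rightarrow> 'a + nat \<Rightarrow> bool" where
    "A x y = (case (x, y) of (Inl u, Inl v) \<Rightarrow> u = v \<or> u \<sqsubset> v | _ \<Rightarrow> True)" for x y
  define W :: "'a + nat \<Rightarrow> 'a + nat \<Rightarrow> int" where
    "W x y = (case (x, y) of (Inl u, Inl v) \<Rightarrow> (if u = v then 0 else 1) | (Inr d, Inl v) \<Rightarrow> 1 - int k | _ \<Rightarrow> 0)" for x y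
  have finY: "finite Y" using fin by (simp add: Y_def)
  have "A y y" for y by (simp add: A_def split: sum.split)
  then obtain \<sigma> \<alpha> \<beta> where \<sigma>: "\<sigma> permutes Y" "\<And>y. y \<in> Y \<Longrightarrow> A y (\<sigma> y)"
    and dual: "\<And>x y. x \<in> Y \<Longrightarrow> y \<in> Y \<Longrightarrow> A x y \<Longrightarrow> W x y \<le> \<alpha> x + \<beta> y"
    and tight: "\<And>x. x \<in> Y \<Longrightarrow> W x (\<sigma> x) = \<alpha> x + \<beta> (\<sigma> x)"
    using optimal_assignment[OF finY, of A W] by blast
  have inj: "\<sigma> x = \<sigma> y \<longleftrightarrow> x = y" for x y using permutes_inj[OF \<sigma>(1)] by (auto dest: injD)
  have \<sigma>Y: "\<sigma> y \<in> Y \<longleftrightarrow> y \<in> Y" for y using \<sigma>(1) permutes_in_image by fastforce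
  have YX: "Inl v \<in> Y \<longleftrightarrow> v \<in> X" "Inr d \<in> Y \<longleftrightarrow> d \<le> card X" for v d by (auto simp: Y_def)
  \<comment> \<open>\<open>x v\<close> is the slack of the loop at \<open>v\<close>, which has
    weight zero; \<open>F\<close> collects the elements whose loop is tight.\<close>
  define x where "x v = \<alpha> (Inl v) + \<beta> (Inl v)" for v
  define F where "F = {v\<in>X. x v = 0}"
  have x0: "0 \<le> x v" if "v \<in> X" for v
    using dual[of "Inl v" "Inl v"] that by (simp add: YX A_def W_def x_def)
  obtain d d' where dd: "d \<le> card X" "\<sigma> (Inr d) = Inr d'"
  proof (rule ccontr)
    assume "\<not> thesis"
    then have *: "\<exists>v. \<sigma> (Inr d) = Inl v" if "d \<le> card X" for d
      using that \<open>\<And>d' d. d \<le> card X \<Longrightarrow> \<sigma> (Inr d) = Inr d' \<Longrightarrow> thesis\<close> by (metis sum.exhaust)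
    have "(\<lambda>d. \<sigma> (Inr d)) ` ?D \<subseteq> Inl ` X"
    proof (rule image_subsetI)
      fix d assume d: "d \<in> ?D"
      then obtain v where "\<sigma> (Inr d) = Inl v" using * by auto
      moreover have "\<sigma> (Inr d) \<in> Y" using d by (simp add: \<sigma>Y YX)
      ultimately show "\<sigma> (Inr d) \<in> Inl ` X" by (simp add: YX)
    qed
    then have "card ?D \<le> card (Inl ` X :: ('a + nat) set)"
      using fin by (intro card_inj_on_le[of "\<lambda>d. \<sigma> (Inr d)"]) (auto simp: inj_on_def inj)
    then show False using fin by (simp add: card_image)
  qed
  have dY: "Inr d \<in> Y" "Inr d' \<in> Y" using dd \<sigma>Y[of "Inr d"] by (auto simp: YX)
  have d0: "\<alpha> (Inr d) + \<beta> (Inr d') = 0" using tight[OF dY(1)] dd(2) by (simp add: W_def)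
  \<comment> \<open>Along a chain in \<open>F\<close> the values of \<open>\<alpha>\<close> drop
    strictly. The arc from \<open>v\<close> to the dummy \<open>d'\<close> bounds them below by
    \<open>\<alpha> (Inr d)\<close>, the arc from \<open>d\<close> to \<open>v\<close>, of weight
    \<open>1 - k\<close>, bounds them above by \<open>\<alpha> (Inr d) + k - 1\<close>, so only
    \<open>k\<close> integers remain.\<close>
  have chF: "chains_le k F"
    unfolding chains_le_def
  proof (intro allI impI)
    fix C assume C: "C \<subseteq> F" "chain C"
    have drop: "\<alpha> (Inl v) < \<alpha> (Inl u)" if "u \<in> C" "v \<in> C" "u \<sqsubset> v" for u v
    proof -
      have "W (Inl u) (Inl v) \<le> \<alpha> (Inl u) + \<beta> (Inl v)"
        using that C by (intro dual) (auto simp: YX F_def A_def)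
      moreover have "u \<noteq> v" using that less_irrefl by blast
      moreover have "\<alpha> (Inl v) + \<beta> (Inl v) = 0" using that C by (auto simp: F_def x_def)
      ultimately show ?thesis by (simp add: W_def)
    qed
    have "inj_on (\<lambda>v. \<alpha> (Inl v)) C"
    proof (rule inj_onI)
      fix u v assume uv: "u \<in> C" "v \<in> C" "\<alpha> (Inl u) = \<alpha> (Inl v)"
      then have "u = v \<or> u \<sqsubset> v \<or> v \<sqsubset> u" using C(2) unfolding chain_def by blast
      then show "u = v" using drop[of u v] drop[of v u] uv by auto
    qed
    moreover have "(\<lambda>v. \<alpha> (Inl v)) ` C \<subseteq> {\<alpha> (Inr d)..\<alpha> (Inr d) + int k - 1}"
    proof (rule image_subsetI)
      fix v assume "v \<in> C"
      then have v: "v \<in> X" "\<alpha> (Inl v) + \<beta> (Inl v) = 0" using C(1) by (auto simp: F_def x_def)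
      have "W (Inl v) (Inr d') \<le> \<alpha> (Inl v) + \<beta> (Inr d')" "W (Inr d) (Inl v) \<le> \<alpha> (Inr d) + \<beta> (Inl v)"
        using v dY by (auto intro!: dual simp: YX A_def)
      then show "\<alpha> (Inl v) \<in> {\<alpha> (Inr d)..\<alpha> (Inr d) + int k - 1}"
        using v d0 by (simp add: W_def)
    qed
    ultimately have "card C \<le> card {\<alpha> (Inr d)..\<alpha> (Inr d) + int k - 1}"
      by (rule card_inj_on_le) simp
    then show "card C \<le> k" by simp
  qed
  define St where "St = {s \<in> X. \<exists>e. \<sigma> (Inr e) = Inl s}"
  define step where "step u v \<longleftrightarrow> u \<in> X \<and> v \<noteq> u \<and> \<sigma> (Inl u) = Inl v" for u v
  define C where "C s = {v. step\<^sup>*\<^sup>* s v}" for s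
  define U where "U = {v \<in> X. \<sigma> (Inl v) \<noteq> Inl v}"
  have step_less: "u \<sqsubset> v" if "step u v" for u v
    using \<sigma>(2)[of "Inl u"] that by (auto simp: step_def YX A_def)
  have step_X: "v \<in> X" if "step u v" for u v
    using that \<sigma>Y[of "Inl u"] by (auto simp: step_def YX)
  have step_inj: "u = u'" if "step u v" "step u' v" for u u' v
    using that inj[of "Inl u" "Inl u'"] by (simp add: step_def)
  have step_fun: "v = v'" if "step u v" "step u v'" for u v v'
    using that by (simp add: step_def)
  have St_step: "\<not> step u s" if "s \<in> St" for u s
    using that inj by (auto simp: St_def step_def) (metis sum.distinct(1))
  have steps_less: "u = v \<or> u \<sqsubset> v" if "step\<^sup>*\<^sup>* u v" for u v
    using that by (induction rule: rtranclp_induct) (auto dest: step_less less_trans)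
  have C_U: "C s \<subseteq> U" if s: "s \<in> St" for s
  proof
    fix v assume "v \<in> C s"
    then have "step\<^sup>*\<^sup>* s v" by (simp add: C_def)
    then show "v \<in> U"
    proof (cases rule: rtranclp.cases)
      case rtrancl_refl
      then show ?thesis using s inj by (auto simp: St_def U_def) (metis sum.distinct(1))
    next
      case (rtrancl_into_rtrancl b)
      then have "step b v" by simp
      then have "\<sigma> (Inl b) = Inl v" "b \<noteq> v" by (auto simp: step_def)
      then show ?thesis using inj[of "Inl b" "Inl v"] step_X[OF \<open>step b v\<close>] by (auto simp: U_def)
    qed
  qed
  have C_chain: "chain (C s)" for s
  proof -
    have "step\<^sup>*\<^sup>* u v \<or> step\<^sup>*\<^sup>* v u" if "step\<^sup>*\<^sup>* s u" "step\<^sup>*\<^sup>* s v" for u v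
      using that
    proof (induction rule: rtranclp_induct)
      case (step y z)
      then consider "step\<^sup>*\<^sup>* v y" | "step\<^sup>*\<^sup>* y v" by blast
      then show ?case
      proof cases
        case 1
        then show ?thesis using step(2) by (meson rtranclp.rtrancl_into_rtrancl)
      next
        case 2
        then show ?thesis
        proof (cases rule: converse_rtranclpE)
          case base
          then show ?thesis using step(2) by blast
        next
          case (step w)
          then show ?thesis using step_fun \<open>step y z\<close> by blast
        qed
      qed
    qed simp
    then show ?thesis unfolding chain_def C_def using steps_less by blast
  qed
  have C_disj: "s = t" if "s \<in> St" "t \<in> St" "step\<^sup>*\<^sup>* s v" "step\<^sup>*\<^sup>* t v" for s t v
    using that(3,4)
  proof (induction rule: rtranclp_induct)
    case base
    then show ?case using St_step[OF that(1)] by (metis rtranclp.cases)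
  next
    case (step y z)
    from step(4) show ?case
    proof (cases rule: rtranclp.cases)
      case rtrancl_refl
      then show ?thesis using St_step[OF that(2)] step(2) by blast
    next
      case (rtrancl_into_rtrancl b)
      then show ?thesis using step step_inj by blast
    qed
  qed
  \<comment> \<open>Going backwards along \<open>\<sigma>\<close> descends strictly in the order, so
    it cannot cycle and must reach a dummy.\<close>
  have U_C: "\<exists>s\<in>St. v \<in> C s" if "v \<in> U" for v
    using that
  proof (induction "card {u\<in>X. u \<sqsubset> v}" arbitrary: v rule: less_induct)
    case less
    then have v: "v \<in> X" "\<sigma> (Inl v) \<noteq> Inl v" by (auto simp: U_def)
    obtain y where y: "\<sigma> y = Inl v" using permutes_surj[OF \<sigma>(1)] by (metis surjD)
    show ?case
    proof (cases y)
      case (Inr e)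
      then have "v \<in> St" using y v by (auto simp: St_def)
      then show ?thesis by (auto simp: C_def)
    next
      case (Inl u)
      then have "u \<in> X" using y v(1) \<sigma>Y[of y] by (simp add: YX)
      moreover have "u \<noteq> v" using y Inl v(2) by blast
      ultimately have st: "step u v" using y Inl by (simp add: step_def)
      have "{w\<in>X. w \<sqsubset> u} \<subset> {w\<in>X. w \<sqsubset> v}"
        using step_less[OF st] less_trans less_irrefl \<open>u \<in> X\<close> by blast
      then have "card {w\<in>X. w \<sqsubset> u} < card {w\<in>X. w \<sqsubset> v}"
        using fin by (intro psubset_card_mono) auto
      moreover have "u \<in> U" using \<open>u \<in> X\<close> \<open>u \<noteq> v\<close> y Inl by (simp add: U_def)
      ultimately obtain s where "s \<in> St" "u \<in> C s" using less(1) by blast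
      then have "step\<^sup>*\<^sup>* s v" using st by (simp add: C_def)
      then show ?thesis using \<open>s \<in> St\<close> by (auto simp: C_def)
    qed
  qed
  have finSt: "finite St" using fin by (simp add: St_def)
  have finU: "finite U" using fin by (simp add: U_def)
  have "U = (\<Union>s\<in>St. C s)" using U_C C_U by blast
  moreover have "card (\<Union>s\<in>St. C s) = (\<Sum>s\<in>St. card (C s))"
  proof (rule card_UN_disjoint[OF finSt])
    show "\<forall>s\<in>St. finite (C s)" using finite_subset[OF C_U finU] by simp
    show "\<forall>s\<in>St. \<forall>t\<in>St. s \<noteq> t \<longrightarrow> C s \<inter> C t = {}" using C_disj by (auto simp: C_def)
  qed
  ultimately have "card U = (\<Sum>s\<in>St. card (C s))" by simp
  then have cardU: "int (card U) - int k * int (card St) = (\<Sum>s\<in>St. int (card (C s)) - int k)"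
    by (simp add: sum_subtractf mult.commute)
  have inv: "\<sigma> (inv_into UNIV \<sigma> y) = y" for y using permutes_inverses[OF \<sigma>(1)] by simp
  \<comment> \<open>Each arc is charged to its target: one for every element on a chain, minus
    \<open>k\<close> for the first element of a chain.\<close>
  have W_inv: "W (inv_into UNIV \<sigma> (Inl v)) (Inl v) = (if v \<in> U then 1 else 0) - (if v \<in> St then int k else 0)"
    if v: "v \<in> X" for v
  proof (cases "inv_into UNIV \<sigma> (Inl v)")
    case (Inl u)
    then have u: "\<sigma> (Inl u) = Inl v" using inv by metis
    then have "v \<notin> St" using inj by (auto simp: St_def) (metis sum.distinct(1))
    moreover have "v \<in> U \<longleftrightarrow> u \<noteq> v" using u v inj[of "Inl u" "Inl v"] by (auto simp: U_def)
    ultimately show ?thesis by (simp add: Inl W_def)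
  next
    case (Inr e)
    then have e: "\<sigma> (Inr e) = Inl v" using inv by metis
    then have "v \<in> St" using v by (auto simp: St_def)
    moreover have "v \<in> U" using e v inj[of "Inr e" "Inl v"] by (auto simp: U_def)
    ultimately show ?thesis by (simp add: Inr W_def)
  qed
  have sum_Y: "sum f Y = (\<Sum>v\<in>X. f (Inl v)) + (\<Sum>e\<in>?D. f (Inr e))" for f :: "'a + nat \<Rightarrow> int"
    unfolding Y_def using fin by (subst sum.union_disjoint) (auto simp: sum.reindex)
  have bij: "bij_betw \<sigma> Y Y" using \<sigma>(1) by (rule permutes_imp_bij)
  have "(\<Sum>y\<in>Y. W y (\<sigma> y)) = (\<Sum>y\<in>Y. W (inv_into UNIV \<sigma> y) y)"
    using sum.reindex_bij_betw[OF bij, of "\<lambda>y. W (inv_into UNIV \<sigma> y) y"] permutes_inverses[OF \<sigma>(1)] by simp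
  also have "\<dots> = (\<Sum>v\<in>X. W (inv_into UNIV \<sigma> (Inl v)) (Inl v))"
  proof -
    have "W y (Inr e) = 0" for y e by (simp add: W_def split: sum.split)
    then show ?thesis by (simp add: sum_Y)
  qed
  also have "\<dots> = (\<Sum>v\<in>X. (if v \<in> U then 1 else 0) - (if v \<in> St then int k else 0))"
    by (intro sum.cong refl W_inv)
  also have "\<dots> = int (card U) - int k * int (card St)"
  proof -
    have "X \<inter> U = U" "X \<inter> St = St" by (auto simp: U_def St_def)
    then show ?thesis using fin by (simp add: sum_subtractf sum.If_cases)
  qed
  finally have profit: "(\<Sum>y\<in>Y. W y (\<sigma> y)) = (\<Sum>s\<in>St. int (card (C s)) - int k)" using cardU by simp
  have "(\<Sum>y\<in>Y. W y (\<sigma> y)) = (\<Sum>y\<in>Y. \<alpha> y) + (\<Sum>y\<in>Y. \<beta> (\<sigma> y))"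
    using tight by (simp add: sum.distrib)
  also have "(\<Sum>y\<in>Y. \<beta> (\<sigma> y)) = (\<Sum>y\<in>Y. \<beta> y)" by (rule sum.reindex_bij_betw[OF bij])
  finally have "(\<Sum>y\<in>Y. W y (\<sigma> y)) = (\<Sum>v\<in>X. x v) + (\<Sum>e\<in>?D. \<alpha> (Inr e) + \<beta> (Inr e))"
    by (simp add: sum_Y sum.distrib x_def)
  \<comment> \<open>A dummy may be mapped to itself at weight zero, so dual feasibility makes each
    summand nonnegative.\<close>
  moreover have "0 \<le> (\<Sum>e\<in>?D. \<alpha> (Inr e) + \<beta> (Inr e))"
  proof (rule sum_nonneg)
    fix e assume "e \<in> ?D"
    then show "0 \<le> \<alpha> (Inr e) + \<beta> (Inr e)"
      using dual[of "Inr e" "Inr e"] by (simp add: YX A_def W_def)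
  qed
  ultimately have "(\<Sum>v\<in>X. x v) \<le> (\<Sum>s\<in>St. int (card (C s)) - int k)" using profit by simp
  \<comment> \<open>Integrality of the dual solution enters here: a nonzero slack is at least
    one.\<close>
  moreover have "int (card (X - F)) \<le> (\<Sum>v\<in>X. x v)"
  proof -
    have "int (card (X - F)) = (\<Sum>v\<in>X - F. 1)" by simp
    also have "\<dots> \<le> (\<Sum>v\<in>X - F. x v)"
    proof (rule sum_mono)
      fix v assume "v \<in> X - F"
      then show "1 \<le> x v" using x0[of v] by (auto simp: F_def)
    qed
    also have "\<dots> \<le> (\<Sum>v\<in>X. x v)" using fin x0 by (intro sum_mono2) auto
    finally show ?thesis .
  qed
  moreover have "(\<Sum>s\<in>St. int (card (C s)) - int k) \<le> (\<Sum>s\<in>St. int (card (C s) - k))"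
    by (intro sum_mono) simp
  ultimately have "int (card (X - F)) \<le> int (\<Sum>s\<in>St. card (C s) - k)" by simp
  then have "card (X - F) \<le> (\<Sum>s\<in>St. card (C s) - k)" by (simp only: of_nat_le_iff)
  moreover have "C s \<subseteq> X" if "s \<in> St" for s using C_U[OF that] by (auto simp: U_def)
  moreover have "C s \<inter> C t = {}" if "s \<in> St" "t \<in> St" "s \<noteq> t" for s t
    using C_disj that by (auto simp: C_def)
  ultimately show ?thesis
    using that[of F St C] chF C_chain by (auto simp: F_def St_def)
qed

end

context strict_poset
begin

text \<open>Replacing \<open>v\<close> by \<open>w v\<close> pairwise incomparable copies reduces the weighted case to the
  unweighted one.\<close>

theorem weighted_chain_duality:
  fixes w :: "'a \<Rightarrow> nat"
  assumes fin: "finite Q" and bound: "\<And>F. F \<subseteq> Q \<Longrightarrow> chains_le k F \<Longrightarrow> n \<le> (\<Sum>v\<in>Q - F. w v)"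
  obtains J :: "('a \<times> nat) set" and C where "finite J"
    "\<And>j. j \<in> J \<Longrightarrow> C j \<subseteq> Q" "\<And>j. j \<in> J \<Longrightarrow> chain (C j)"
    "\<And>v. v \<in> Q \<Longrightarrow> card {j\<in>J. v \<in> C j} \<le> w v" "n \<le> (\<Sum>j\<in>J. card (C j) - k)"
proof -
  define X where "X = (SIGMA v:Q. {..<w v})"
  have finX: "finite X" using fin by (simp add: X_def)
  interpret X: strict_poset "\<lambda>x y. fst x \<sqsubset> fst y"
    by unfold_locales (auto simp: less_irrefl intro: less_trans)
  obtain F J C where F: "F \<subseteq> X" "X.chains_le k F" and J: "J \<subseteq> X"
    and C: "\<And>s. s \<in> J \<Longrightarrow> C s \<subseteq> X" "\<And>s. s \<in> J \<Longrightarrow> X.chain (C s)"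
      "\<And>s t. s \<in> J \<Longrightarrow> t \<in> J \<Longrightarrow> s \<noteq> t \<Longrightarrow> C s \<inter> C t = {}"
    and card: "card (X - F) \<le> (\<Sum>s\<in>J. card (C s) - k)"
    using X.chain_duality[OF finX, of k] by blast
  \<comment> \<open>Copies of one element are incomparable, so a chain contains at most one of
    them.\<close>
  have inj: "inj_on fst (C s)" if "s \<in> J" for s
  proof (rule inj_onI)
    fix x y assume xy: "x \<in> C s" "y \<in> C s" "fst x = fst y"
    then have "x = y \<or> fst x \<sqsubset> fst y \<or> fst y \<sqsubset> fst x" using C(2)[OF that] unfolding X.chain_def by blast
    then show "x = y" using xy(3) less_irrefl by metis
  qed
  have F0: "chains_le k (fst ` F)"
    unfolding chains_le_def
  proof (intro allI impI)
    fix D assume D: "D \<subseteq> fst ` F" "chain D"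
    then obtain E where E: "E \<subseteq> F" "inj_on fst E" "D = fst ` E" by (meson subset_image_inj)
    then have "X.chain E" using D(2) unfolding X.chain_def chain_def inj_on_def by blast
    then have "card E \<le> k" using F(2) E(1) unfolding X.chains_le_def by blast
    then show "card D \<le> k" using E by (simp add: card_image)
  qed
  have "fst ` F \<subseteq> Q" using F(1) by (auto simp: X_def)
  then have "n \<le> (\<Sum>v\<in>Q - fst ` F. w v)" using F0 by (rule bound)
  also have "\<dots> = card (SIGMA v:Q - fst ` F. {..<w v})" using fin by simp
  also have "\<dots> \<le> card (X - F)"
    using finX by (intro card_mono) (force simp: X_def)+
  finally have n: "n \<le> (\<Sum>s\<in>J. card (fst ` C s) - k)"
    using card inj by (simp add: card_image)
  show ?thesis
  proof (rule that[of J "\<lambda>s. fst ` C s"])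
    show "finite J" using J finX finite_subset by blast
    show "fst ` C j \<subseteq> Q" if "j \<in> J" for j using C(1)[OF that] by (auto simp: X_def)
    show "chain (fst ` C j)" if j: "j \<in> J" for j
    proof -
      have "fst x = fst y \<or> fst x \<sqsubset> fst y \<or> fst y \<sqsubset> fst x" if "x \<in> C j" "y \<in> C j" for x y
        using C(2)[OF j, unfolded X.chain_def, rule_format, OF that] by auto
      then show ?thesis by (simp add: chain_def)
    qed
    \<comment> \<open>Disjoint chains through \<open>v\<close> use different copies of
      \<open>v\<close>, and there are only \<open>w v\<close> copies.\<close>
    show "card {j \<in> J. v \<in> fst ` C j} \<le> w v" if v: "v \<in> Q" for v
    proof -
      have "\<exists>i. (v, i) \<in> C j" if "j \<in> {j \<in> J. v \<in> fst ` C j}" for j using that by force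
      then obtain i where i: "\<And>j. j \<in> {j \<in> J. v \<in> fst ` C j} \<Longrightarrow> (v, i j) \<in> C j" by metis
      have "card {j \<in> J. v \<in> fst ` C j} \<le> card {..<w v}"
      proof (rule card_inj_on_le[of i])
        show "inj_on i {j \<in> J. v \<in> fst ` C j}"
        proof (rule inj_onI)
          fix j j' assume jj: "j \<in> {j \<in> J. v \<in> fst ` C j}" "j' \<in> {j \<in> J. v \<in> fst ` C j}" "i j = i j'"
          have "(v, i j) \<in> C j \<inter> C j'" using i[OF jj(1)] i[OF jj(2)] jj(3) by simp
          then show "j = j'" using C(3)[of j j'] jj(1,2) by auto
        qed
        show "i ` {j \<in> J. v \<in> fst ` C j} \<subseteq> {..<w v}"
        proof (rule image_subsetI)
          fix j assume j: "j \<in> {j \<in> J. v \<in> fst ` C j}"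
          then have "(v, i j) \<in> X" using i[OF j] C(1)[of j] by auto
          then show "i j \<in> {..<w v}" by (simp add: X_def)
        qed
      qed simp
      then show ?thesis by simp
    qed
  qed (rule n)
qed

end

section \<open>Generic skew-symmetric matrices of bounded rank\<close>

definition nests :: "nat \<times> nat \<Rightarrow> nat \<times> nat \<Rightarrow> bool" where
  "nests v w \<longleftrightarrow> fst v < fst w \<and> snd w < snd v"

global_interpretation nest: strict_poset nests
  by unfold_locales (auto simp: nests_def)

global_interpretation skew: variable_order skew_var_greater
  by unfold_locales (auto simp: skew_var_greater_def)

lemma skew_vars_iff [simp]: "(a, b) \<in> skew_vars r \<longleftrightarrow> a < b \<and> b < r"
  by (simp add: skew_vars_def)

lemma finite_skew_vars: "finite (skew_vars r)"
  by (rule finite_subset[of _ "{..<r} \<times> {..<r}"]) (auto simp: skew_vars_def)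

subsection \<open>Tables with prescribed margins\<close>

text \<open>The exponents of one summand: \<open>M\<close> belongs to the diagonal split and is
  strictly upper triangular with no nested positions, while \<open>N\<close> is a competitor that
  may also have entries below the diagonal. Equal margins express that both have the same image
  under the product substitution.\<close>

locale transport_tables =
  fixes r :: nat and N M :: "nat \<Rightarrow> nat \<Rightarrow> nat"
  assumes N_support: "N a b \<noteq> 0 \<Longrightarrow> a < r \<and> b < r \<and> a \<noteq> b"
    and M_support: "M a b \<noteq> 0 \<Longrightarrow> a < b \<and> b < r"
    and antichain: "M a b \<noteq> 0 \<Longrightarrow> M c d \<noteq> 0 \<Longrightarrow> \<not> (a < c \<and> d < b)"
    and rows: "a < r \<Longrightarrow> (\<Sum>b<r. N a b) = (\<Sum>b<r. M a b)"
    and cols: "b < r \<Longrightarrow> (\<Sum>a<r. N a b) = (\<Sum>a<r. M a b)"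
begin

text \<open>By induction on the column: the entries of \<open>N\<close> above the diagonal agree
  with those of \<open>M\<close>, which already exhaust the column sum, so nothing is left at or
  below the diagonal.\<close>

lemma lower_zero:
  assumes "\<And>a b. a < p \<Longrightarrow> a < b \<Longrightarrow> N a b + N b a = M a b" "a \<le> p" "a < y"
  shows "N y a = 0"
  using assms(2,3)
proof (induction a arbitrary: y rule: less_induct)
  case (less a)
  show ?case
  proof (cases "y < r")
    case y: True
    then have a: "a < r" using less.prems by simp
    have eq: "N x a = M x a" if "x < a" for x
      using assms(1)[of x a] less.IH[of x a] that less.prems by simp
    have M0: "M x a = 0" if "a \<le> x" for x using M_support[of x a] that by auto
    have split: "(\<Sum>x<r. g x) = (\<Sum>x<a. g x) + (\<Sum>x\<in>{a..<r}. g x)" for g :: "nat \<Rightarrow> nat"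
      using a by (subst sum.union_disjoint[symmetric]) (auto intro!: sum.cong)
    have "(\<Sum>x\<in>{a..<r}. N x a) = (\<Sum>x\<in>{a..<r}. M x a)"
      using cols[OF a] eq by (simp add: split)
    also have "\<dots> = 0" using M0 by simp
    finally show ?thesis using y less.prems by simp
  qed (use N_support[of y a] in auto)
qed

text \<open>A deficit of \<open>N\<close> at \<open>(p, q)\<close> forces a surplus in row
  \<open>p\<close>, necessarily at some \<open>b\<close> between \<open>p\<close> and
  \<open>q\<close>. The surplus forces a deficit in column \<open>b\<close>, necessarily in a row
  \<open>a\<close> below \<open>p\<close>. Then \<open>(p, q)\<close> and \<open>(a, b)\<close> are
  nested positions in the support of \<open>M\<close>.\<close>

lemma first_difference:
  assumes prev: "\<And>a b. a < p \<Longrightarrow> a < b \<Longrightarrow> N a b + N b a = M a b"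
    and pq: "p < q" "q < r" and row: "\<And>b. q < b \<Longrightarrow> N p b + N b p = M p b"
  shows "M p q \<le> N p q + N q p"
proof (rule ccontr)
  assume "\<not> ?thesis"
  then have less: "N p q < M p q" by simp
  have low: "N y a = 0" if "a \<le> p" "a < y" for a y
    using lower_zero[of p a y] prev that by blast
  have "\<exists>b<r. M p b < N p b"
  proof (rule ccontr)
    assume "\<not> ?thesis"
    then have "(\<Sum>b<r. N p b) < (\<Sum>b<r. M p b)"
      using less pq by (intro sum_strict_mono_ex1) auto
    then show False using rows[of p] pq by simp
  qed
  then obtain b where b: "b < r" "M p b < N p b" by blast
  have "p < b"
    using b(2) low[of b p] N_support[of p b] by (cases b p rule: linorder_cases) auto
  moreover have "b < q"
    using b less row[of b] low[of p b] by (cases b q rule: linorder_cases) auto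
  ultimately have pbq: "p < b" "b < q" by auto
  have "\<exists>a<r. N a b < M a b"
  proof (rule ccontr)
    assume "\<not> ?thesis"
    then have "(\<Sum>a<r. M a b) < (\<Sum>a<r. N a b)"
      using b pq by (intro sum_strict_mono_ex1) (auto intro: bexI[of _ p])
    then show False using cols[of b] b by simp
  qed
  then obtain a where a: "a < r" "N a b < M a b" by blast
  have "p < a"
    using a(2) b(2) prev[of a b] low[of a b] pbq by (cases a p rule: linorder_cases) auto
  then show False using antichain[of p q a b] a less pbq by auto
qed

end

text \<open>All \<open>k\<close> tables are compared at the greatest variable where any of them
  deviates. There \<open>first_difference\<close> applies to every table, so the differences have
  one sign and cannot compensate in the sum.\<close>

lemma transport_compare:
  fixes N M :: "nat \<Rightarrow> nat \<Rightarrow> nat \<Rightarrow> nat"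
  assumes T: "\<And>i. i < k \<Longrightarrow> transport_tables r (N i) (M i)"
  shows "(\<forall>i<k. N i = M i) \<or>
    (\<exists>v\<in>skew_vars r. (\<Sum>i<k. M i (fst v) (snd v)) < (\<Sum>i<k. N i (fst v) (snd v) + N i (snd v) (fst v)) \<and>
      (\<forall>w\<in>skew_vars r. skew_var_greater w v \<longrightarrow>
        (\<Sum>i<k. M i (fst w) (snd w)) = (\<Sum>i<k. N i (fst w) (snd w) + N i (snd w) (fst w))))"
proof -
  let ?bad = "{v\<in>skew_vars r. \<exists>i<k. N i (fst v) (snd v) + N i (snd v) (fst v) \<noteq> M i (fst v) (snd v)}"
  show ?thesis
  proof (cases "?bad = {}")
    case True
    have "N i a b = M i a b" if i: "i < k" for i a b
    proof -
      interpret transport_tables r "N i" "M i" by (rule T[OF i])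
      have eq: "N i a b + N i b a = M i a b" if "a < b" for a b
      proof (cases "b < r")
        case True
        then show ?thesis using \<open>?bad = {}\<close> that i by auto
      next
        case False
        then have "N i a b = 0" "N i b a = 0" "M i a b = 0"
          using N_support[of a b] N_support[of b a] M_support[of a b] by (metis (lifting))+
        then show ?thesis by simp
      qed
      have low: "N i y a = 0" if "a < y" for a y
        using lower_zero[of r a y] eq that N_support[of y a] by (cases "a \<le> r") auto
      consider "a < b" | "a = b" | "b < a" by linarith
      then show ?thesis
      proof cases
        case 1
        then show ?thesis using eq[of a b] low[of a b] by simp
      next
        case 2
        then show ?thesis using N_support[of a b] M_support[of a b] by (metis less_irrefl)
      next
        case 3
        then show ?thesis using low[of b a] M_support[of a b] by (metis not_less_iff_gr_or_eq)
      qed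
    qed
    then show ?thesis by blast
  next
    case False
    have "finite ?bad" using finite_skew_vars by simp
    then obtain v where v: "v \<in> ?bad" "\<And>w. skew_var_greater w v \<Longrightarrow> w \<notin> ?bad"
      using skew.greatest_element[OF _ False] by blast
    obtain p q where pq: "v = (p, q)" by (cases v)
    have pq': "p < q" "q < r" using v(1) by (auto simp: pq)
    have good: "N i a b + N i b a = M i a b"
      if i: "i < k" and ab: "a < b" "a < p \<or> a = p \<and> q < b" for i a b
    proof (cases "b < r")
      case True
      then show ?thesis using v(2)[of "(a, b)"] i ab by (auto simp: pq skew_var_greater_def)
    next
      case False
      interpret transport_tables r "N i" "M i" by (rule T[OF i])
      have "N i a b = 0" "N i b a = 0" "M i a b = 0"
        using False N_support[of a b] N_support[of b a] M_support[of a b] by (metis (lifting))+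
      then show ?thesis by simp
    qed
    have le: "M i p q \<le> N i p q + N i q p" if i: "i < k" for i
    proof -
      interpret transport_tables r "N i" "M i" by (rule T[OF i])
      show ?thesis using good[OF i] pq' by (intro first_difference) auto
    qed
    obtain j where "j < k" "N j p q + N j q p \<noteq> M j p q" using v(1) by (auto simp: pq)
    then have "M j p q < N j p q + N j q p" using le[of j] by simp
    then have "(\<Sum>i<k. M i p q) < (\<Sum>i<k. N i p q + N i q p)"
      using le \<open>j < k\<close> by (intro sum_strict_mono_ex1) auto
    moreover have "(\<Sum>i<k. M i a b) = (\<Sum>i<k. N i a b + N i b a)"
      if "(a, b) \<in> skew_vars r" "skew_var_greater (a, b) v" for a b
      using good that by (intro sum.cong) (auto simp: pq skew_var_greater_def)
    ultimately show ?thesis using pq' by (intro disjI2 bexI[of _ v]) (auto simp: pq)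
  qed
qed

subsection \<open>Substituting a generic matrix of bounded rank\<close>

text \<open>The matrix \<open>\<Sum>\<^sub>i u\<^sub>i v\<^sub>i\<^sup>T - v\<^sub>i u\<^sub>i\<^sup>T\<close> with \<open>k\<close> summands, where the indeterminates \<open>(2i, a)\<close> and
  \<open>(2i + 1, a)\<close> are the \<open>a\<close>-th entries of \<open>u\<^sub>i\<close> and \<open>v\<^sub>i\<close>.\<close>

definition rank_entry :: "nat \<Rightarrow> nat \<times> nat \<Rightarrow> (nat \<times> nat, 'k::comm_ring_1) mpoly" where
  "rank_entry k v = (\<Sum>i<k. indet (2 * i, fst v) * indet (2 * i + 1, snd v)
                        - indet (2 * i, snd v) * indet (2 * i + 1, fst v))"

abbreviation rank_subst :: "nat \<Rightarrow> (nat \<times> nat, 'k) mpoly \<Rightarrow> (nat \<times> nat, 'k::comm_ring_1) mpoly" where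
  "rank_subst k \<equiv> subst (rank_entry k)"

text \<open>The substitution factors through the ring with one indeterminate \<open>(i, a, b)\<close> for each
  product \<open>u\<^sub>i\<^sub>a v\<^sub>i\<^sub>b\<close>.\<close>

definition split_entry :: "nat \<Rightarrow> nat \<times> nat \<Rightarrow> (nat \<times> nat \<times> nat, 'k::comm_ring_1) mpoly" where
  "split_entry k v = (\<Sum>i<k. indet (i, fst v, snd v) - indet (i, snd v, fst v))"

definition product_entry :: "nat \<times> nat \<times> nat \<Rightarrow> (nat \<times> nat, 'k::comm_ring_1) mpoly" where
  "product_entry = (\<lambda>(i, a, b). indet (2 * i, a) * indet (2 * i + 1, b))"

lemma rank_subst_factor: "rank_subst k f = subst product_entry (subst (split_entry k) f)"
  by (simp add: subst_subst split_entry_def subst.hom_sum subst.hom_minus product_entry_def rank_entry_def[abs_def] case_prod_beta)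

text \<open>A necessary condition on the exponents that appear when a monomial \<open>m\<close> is
  expanded: every factor \<open>(a, b)\<close> goes to one summand, in one of two
  orientations.\<close>

definition splits :: "nat \<Rightarrow> nat \<Rightarrow> (nat \<times> nat \<Rightarrow>\<^sub>0 nat) \<Rightarrow> (nat \<times> nat \<times> nat \<Rightarrow>\<^sub>0 nat) \<Rightarrow> bool" where
  "splits k r m N \<longleftrightarrow> (\<forall>(i, a, b)\<in>keys N. i < k \<and> a < r \<and> b < r \<and> a \<noteq> b) \<and>
    (\<forall>(a, b)\<in>skew_vars r. lookup m (a, b) = (\<Sum>i<k. lookup N (i, a, b) + lookup N (i, b, a)))"

lemma splits_add: "splits k r m N \<Longrightarrow> splits k r m' N' \<Longrightarrow> splits k r (m + m') (N + N')"
  by (fastforce simp: splits_def keys_plus_nat lookup_add sum.distrib)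

lemma keys_split_entry:
  assumes "(a, b) \<in> skew_vars r" "N \<in> keys (split_entry k (a, b) :: (_, 'k::comm_ring_1) mpoly)"
  shows "splits k r (single (a, b) 1) N"
proof -
  have "N \<in> (\<Union>i<k. keys (indet (i, a, b) - indet (i, b, a) :: (_, 'k) mpoly))"
    using assms(2) Poly_Mapping.keys_sum unfolding split_entry_def by fastforce
  then obtain i where i: "i < k" "N \<in> keys (indet (i, a, b) - indet (i, b, a) :: (_, 'k) mpoly)" by blast
  then have "N = single (i, a, b) 1 \<or> N = single (i, b, a) 1"
    using Poly_Mapping.keys_diff[of "indet (i, a, b)" "indet (i, b, a) :: (_, 'k) mpoly"]
    by (auto simp: indet_def)
  then show ?thesis
    using i(1) assms(1)
    by (auto simp: splits_def lookup_single_if sum.distrib if_distrib cong: if_cong)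
qed

lemma keys_split_monomial:
  assumes "keys m \<subseteq> skew_vars r" "N \<in> keys (subst (split_entry k) (single m (c :: 'k::comm_ring_1)))"
  shows "splits k r m N"
  using assms
proof (induction m arbitrary: N rule: exponent_induct)
  case zero
  then show ?case by (auto simp: splits_def split: if_splits)
next
  case (add m v)
  have "N \<in> keys (subst (split_entry k) (single m c) * (split_entry k v :: (_, 'k) mpoly))"
    using add.prems(2) by (simp only: single_add_indet subst.hom_mult subst_indet)
  then obtain N1 N2 where N: "N = N1 + N2" "N1 \<in> keys (subst (split_entry k) (single m c))"
    "N2 \<in> keys (split_entry k v :: (_, 'k) mpoly)"
    by (rule keys_multE)
  have v: "v \<in> skew_vars r" "keys m \<subseteq> skew_vars r" using add.prems(1) by (auto simp: keys_plus_nat)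
  then have "splits k r m N1" using add.IH N by blast
  moreover have "splits k r (single v 1) N2"
    using keys_split_entry[of "fst v" "snd v" r N2 k] v N by simp
  ultimately show ?case using splits_add N(1) by blast
qed

lemma keys_split:
  assumes "f \<in> carrier (mpoly_ring (skew_vars r))" "N \<in> keys (subst (split_entry k) f)"
  shows "\<exists>m\<in>keys f. splits k r m N"
proof -
  have "subst (split_entry k) f = (\<Sum>m\<in>keys f. subst (split_entry k) (single m (lookup f m)))"
    by (subst sum_monomials[of f, symmetric]) (rule subst.hom_sum)
  then have "N \<in> (\<Union>m\<in>keys f. keys (subst (split_entry k) (single m (lookup f m))))"
    using assms(2) Poly_Mapping.keys_sum by fastforce
  then show ?thesis
    using keys_split_monomial assms(1) unfolding carrier_mpoly by blast
qed

text \<open>Rows are recorded at even first indices and columns at odd ones, so the image of a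
  monomial is a monomial whose exponents are precisely the margins of its tables.\<close>

lemma product_exponent:
  assumes "keys N \<subseteq> UNIV \<times> {..<r} \<times> {..<r}"
  shows "\<exists>E. (\<forall>c::'k::comm_ring_1. subst product_entry (single N c) = single E c) \<and>
    (\<forall>i a. lookup E (2 * i, a) = (\<Sum>b<r. lookup N (i, a, b))) \<and>
    (\<forall>i b. lookup E (2 * i + 1, b) = (\<Sum>a<r. lookup N (i, a, b)))"
  using assms
proof (induction N rule: exponent_induct)
  case zero
  then show ?case by (intro exI[of _ 0]) simp
next
  case (add N v)
  then have "keys N \<subseteq> UNIV \<times> {..<r} \<times> {..<r}" by (auto simp: keys_plus_nat)
  then obtain E where E: "\<And>c::'k. subst product_entry (single N c) = single E c"
    "\<And>i a. lookup E (2 * i, a) = (\<Sum>b<r. lookup N (i, a, b))"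
    "\<And>i b. lookup E (2 * i + 1, b) = (\<Sum>a<r. lookup N (i, a, b))"
    using add.IH by blast
  obtain j p q where v: "v = (j, p, q)" by (cases v)
  have pq: "p < r" "q < r" using add.prems by (auto simp: keys_plus_nat v)
  define E' where "E' = E + single (2 * j, p) 1 + single (2 * j + 1, q) 1"
  have "subst product_entry (single (N + single v 1) c) = single E' c" for c :: 'k
    unfolding single_add_indet subst.hom_mult subst_indet E
    by (simp add: v product_entry_def E'_def indet_def mult_single add.assoc)
  moreover have "lookup E' (2 * i, a) = (\<Sum>b<r. lookup (N + single v 1) (i, a, b))" for i a
  proof -
    have "Suc (2 * j) \<noteq> 2 * i" by presburger
    then show ?thesis
      using E(2)[of i a] pq by (auto simp: E'_def v lookup_add lookup_single_if sum.distrib)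
  qed
  moreover have "lookup E' (2 * i + 1, b) = (\<Sum>a<r. lookup (N + single v 1) (i, a, b))" for i b
  proof -
    have "2 * j \<noteq> Suc (2 * i)" by presburger
    then show ?thesis
      using E(3)[of i b] pq by (auto simp: E'_def v lookup_add lookup_single_if sum.distrib)
  qed
  ultimately show ?case by blast
qed

subsection \<open>Nonvanishing on matrices of bounded rank\<close>

text \<open>If the classes of \<open>col\<close> are antichains, the diagonal split of \<open>m\<close> that uses the summand
  \<open>col v\<close> for the variable \<open>v\<close> has the lexicographically least collapse among all exponents with
  the same image under the product substitution. Hence its image is a monomial of the substituted
  polynomial that cannot cancel.\<close>

theorem rank_subst_nonzero:
  fixes f :: "(nat \<times> nat, 'k::comm_ring_1) mpoly"
  assumes f: "f \<in> carrier (mpoly_ring (skew_vars r))" and m: "skew.leading f m"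
    and chains: "nest.chains_le k (keys m)"
  shows "rank_subst k f \<noteq> 0"
proof -
  obtain col where col: "\<And>v. v \<in> keys m \<Longrightarrow> col v < k"
    "\<And>v w. v \<in> keys m \<Longrightarrow> w \<in> keys m \<Longrightarrow> nests v w \<Longrightarrow> col v \<noteq> col w"
    using nest.antichain_colouring[OF finite_keys chains] by blast
  have mf: "m \<in> keys f" "\<And>m'. m' \<in> keys f \<Longrightarrow> m' = m \<or> skew.lt m' m"
    using m by (auto simp: is_leading_monomial_def)
  have mV: "keys m \<subseteq> skew_vars r" using f mf(1) by (auto simp: carrier_mpoly)
  define D where "D = (\<Sum>v\<in>keys m. single (col v, fst v, snd v) (lookup m v))"
  have D: "lookup D (i, a, b) = (if i = col (a, b) then lookup m (a, b) else 0)" for i a b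
  proof -
    have "lookup D (i, a, b) = (\<Sum>v\<in>keys m. if v = (a, b) then (if i = col (a, b) then lookup m (a, b) else 0) else 0)"
      unfolding D_def lookup_sum by (intro sum.cong refl) (auto simp: lookup_single_if)
    also have "\<dots> = (if i = col (a, b) then lookup m (a, b) else 0)"
      by (auto simp: Poly_Mapping.in_keys_iff)
    finally show ?thesis .
  qed
  have D_keys: "i = col (a, b) \<and> (a, b) \<in> keys m" if "lookup D (i, a, b) \<noteq> 0" for i a b
    using that by (auto simp: D Poly_Mapping.in_keys_iff split: if_splits)
  have D_mem: "a < b \<and> a < r \<and> b < r \<and> i = col (a, b)" if "(i, a, b) \<in> keys D" for i a b
    using D_keys[OF in_keysD[OF that]] mV by auto
  have D_sum: "(\<Sum>i<k. lookup D (i, a, b)) = lookup m (a, b)" for a b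
    using col(1)[of "(a, b)"] by (auto simp: D Poly_Mapping.in_keys_iff)
  define G where "G = subst (split_entry k) f"
  have coeff: "lookup G D = lookup f m"
  proof -
    \<comment> \<open>A partial inverse of the splitting: it keeps only the positively oriented
      variable of the summand prescribed by \<open>col\<close>. The only exponent that it sends to
      \<open>m\<close> is \<open>D\<close>, so the coefficient at \<open>D\<close> can be read off
      from \<open>f\<close>.\<close>
    define \<epsilon> :: "nat \<times> nat \<times> nat \<Rightarrow> (nat \<times> nat, 'k) mpoly" where
      "\<epsilon> = (\<lambda>(i, a, b). if a < b \<and> i = col (a, b) then indet (a, b) else 0)"
    \<comment> \<open>Off \<open>keys m\<close> the colouring is arbitrary; variables with a colour
      outside the range are sent to zero, but none of them occurs in \<open>m\<close>.\<close>
    let ?T = "{v. col v < k}"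
    have "subst \<epsilon> G = subst (\<lambda>v. if v \<in> ?T then indet v else 0) f"
      unfolding G_def subst_subst
    proof (rule subst_cong[OF f])
      fix v assume "v \<in> skew_vars r"
      then obtain a b where v: "v = (a, b)" "a < b" by (cases v) auto
      have "subst \<epsilon> (split_entry k v) = (\<Sum>i<k. if i = col v then indet v else 0)"
        unfolding split_entry_def subst.hom_sum using v
        by (intro sum.cong refl) (auto simp: subst.hom_minus \<epsilon>_def)
      then show "subst \<epsilon> (split_entry k v) = (if v \<in> ?T then indet v else 0)" by simp
    qed
    then have "lookup (subst \<epsilon> G) m = lookup f m"
      using subst_face[of ?T f m] col(1) by auto
    moreover have "lookup (subst \<epsilon> G) m = lookup G D"
    proof -
      have \<epsilon>: "(subst \<epsilon> (single N (1::'k)) = 0 \<and> (\<exists>(i, a, b)\<in>keys N. \<not> (a < b \<and> i = col (a, b)))) \<or>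
          (\<exists>E. subst \<epsilon> (single N (1::'k)) = single E 1 \<and> (\<forall>(i, a, b)\<in>keys N. a < b \<and> i = col (a, b)) \<and>
            (\<forall>a b. lookup E (a, b) = lookup N (col (a, b), a, b)))" for N
      proof (induction N rule: exponent_induct)
        case zero
        show ?case by (intro disjI2 exI[of _ 0]) simp
      next
        case (add N v)
        obtain i a b where v: "v = (i, a, b)" by (cases v)
        have step: "subst \<epsilon> (single (N + single v 1) (1::'k)) = subst \<epsilon> (single N 1) * \<epsilon> v"
          by (simp only: single_add_indet subst.hom_mult subst_indet)
        show ?case
        proof (cases "a < b \<and> i = col (a, b)")
          case False
          then have "\<epsilon> v = 0" by (auto simp: v \<epsilon>_def)
          then have "subst \<epsilon> (single (N + single v 1) (1::'k)) = 0" by (simp only: step mult_zero_right)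
          moreover have "\<exists>(i, a, b)\<in>keys (N + single v 1). \<not> (a < b \<and> i = col (a, b))"
            using False by (intro bexI[of _ v]) (auto simp: v keys_plus_nat)
          ultimately show ?thesis by blast
        next
          case True
          then have \<epsilon>v: "\<epsilon> v = indet (a, b)" by (simp add: v \<epsilon>_def)
          from add show ?thesis
          proof
            assume "subst \<epsilon> (single N (1::'k)) = 0 \<and> (\<exists>(i, a, b)\<in>keys N. \<not> (a < b \<and> i = col (a, b)))"
            then have "subst \<epsilon> (single (N + single v 1) (1::'k)) = 0"
              "\<exists>(i, a, b)\<in>keys (N + single v 1). \<not> (a < b \<and> i = col (a, b))"
              by (simp_all only: step mult_zero_left keys_plus_nat) blast
            then show ?thesis by blast
          next
            assume "\<exists>E. subst \<epsilon> (single N (1::'k)) = single E 1 \<and> (\<forall>(i, a, b)\<in>keys N. a < b \<and> i = col (a, b)) \<and>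
              (\<forall>a b. lookup E (a, b) = lookup N (col (a, b), a, b))"
            then obtain E where E: "subst \<epsilon> (single N (1::'k)) = single E 1"
              "\<forall>(i, a, b)\<in>keys N. a < b \<and> i = col (a, b)"
              "\<And>a b. lookup E (a, b) = lookup N (col (a, b), a, b)" by blast
            have "subst \<epsilon> (single (N + single v 1) (1::'k)) = single (E + single (a, b) 1) 1"
              unfolding step E(1) \<epsilon>v by (simp only: single_add_indet)
            moreover have "\<forall>(i, a, b)\<in>keys (N + single v 1). a < b \<and> i = col (a, b)"
              using E(2) True by (auto simp: keys_plus_nat v)
            moreover have "lookup (E + single (a, b) 1) (c, d) = lookup (N + single v 1) (col (c, d), c, d)" for c d
              using E(3) True by (auto simp: lookup_add lookup_single_if v)
            ultimately show ?thesis by blast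
          qed
        qed
      qed
      have "lookup (subst \<epsilon> (single N 1)) m = (if N = D then 1 else (0::'k))" for N
      proof -
        have ND: "N = D" if "\<forall>(i, a, b)\<in>keys N. a < b \<and> i = col (a, b)"
          "\<And>a b. lookup m (a, b) = lookup N (col (a, b), a, b)"
        proof (rule poly_mapping_eqI)
          fix x :: "nat \<times> nat \<times> nat"
          obtain i a b where x: "x = (i, a, b)" by (cases x)
          show "lookup N x = lookup D x"
          proof (cases "i = col (a, b)")
            case False
            then have "(i, a, b) \<notin> keys N" using that(1) by blast
            then show ?thesis using False by (simp add: x D Poly_Mapping.in_keys_iff)
          qed (simp add: x D that(2))
        qed
        have Dkeys: "\<forall>(i, a, b)\<in>keys D. a < b \<and> i = col (a, b)"
          using D_mem by blast
        from \<epsilon>[of N] show ?thesis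
        proof
          assume "subst \<epsilon> (single N (1::'k)) = 0 \<and> (\<exists>(i, a, b)\<in>keys N. \<not> (a < b \<and> i = col (a, b)))"
          then show ?thesis using Dkeys by auto
        next
          assume "\<exists>E. subst \<epsilon> (single N (1::'k)) = single E 1 \<and> (\<forall>(i, a, b)\<in>keys N. a < b \<and> i = col (a, b)) \<and>
              (\<forall>a b. lookup E (a, b) = lookup N (col (a, b), a, b))"
          then obtain E where E: "subst \<epsilon> (single N (1::'k)) = single E 1"
              "\<forall>(i, a, b)\<in>keys N. a < b \<and> i = col (a, b)"
              "\<And>a b. lookup E (a, b) = lookup N (col (a, b), a, b)" by blast
          have "E = m \<longleftrightarrow> N = D"
          proof
            assume "E = m"
            then show "N = D" using ND E by auto
          next
            assume "N = D"
            then show "E = m" using E(3) by (intro poly_mapping_eqI) (auto simp: D split_paired_all)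
          qed
          then show ?thesis by (simp add: E(1) lookup_single_if)
        qed
      qed
      note one = this
      have "subst \<epsilon> G = (\<Sum>N\<in>keys G. single 0 (lookup G N) * subst \<epsilon> (single N 1))"
        by (subst (1) mpoly_eq_sum[of G]) (simp add: subst.hom_sum subst.hom_mult)
      then have "lookup (subst \<epsilon> G) m = (\<Sum>N\<in>keys G. lookup (single 0 (lookup G N) * subst \<epsilon> (single N 1)) m)"
        by (simp add: lookup_sum)
      also have "\<dots> = (\<Sum>N\<in>keys G. if N = D then lookup G D else 0)"
      proof (rule sum.cong[OF refl])
        fix N
        have const: "lookup (single 0 c * g) m = c * lookup g m" for c and g :: "(nat \<times> nat, 'k) mpoly"
          by (induction g rule: mpoly_induct)
             (simp_all add: mult_single lookup_single_if distrib_left lookup_add)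
        show "lookup (single 0 (lookup G N) * subst \<epsilon> (single N 1)) m = (if N = D then lookup G D else 0)"
          by (simp add: const one)
      qed
      also have "\<dots> = lookup G D" by (simp add: Poly_Mapping.in_keys_iff)
      finally show ?thesis .
    qed
    ultimately show ?thesis by simp
  qed
  have cube: "keys N \<subseteq> UNIV \<times> {..<r} \<times> {..<r}" if "splits k r m' N" for m' N
    using that by (auto simp: splits_def)
  have D_cube: "keys D \<subseteq> UNIV \<times> {..<r} \<times> {..<r}"
    by (auto dest: D_mem)
  obtain \<mu> where \<mu>: "\<And>c::'k. subst product_entry (single D c) = single \<mu> c"
    "\<And>i a. lookup \<mu> (2 * i, a) = (\<Sum>b<r. lookup D (i, a, b))"
    "\<And>i b. lookup \<mu> (2 * i + 1, b) = (\<Sum>a<r. lookup D (i, a, b))"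
    using product_exponent[OF D_cube, where 'k = 'k] by blast
  \<comment> \<open>A competitor with the same image has the same margins. If it differed from
    \<open>D\<close>, its origin \<open>m'\<close> would be greater than the leading monomial
    \<open>m\<close>.\<close>
  have image_coeff: "lookup (subst product_entry (single N c)) \<mu> = (if N = D then c else (0::'k))"
    if N: "N \<in> keys G" for N c
  proof -
    obtain m' where m': "m' \<in> keys f" "splits k r m' N" using keys_split[OF f] N by (auto simp: G_def)
    obtain E where E: "\<And>c::'k. subst product_entry (single N c) = single E c"
      "\<And>i a. lookup E (2 * i, a) = (\<Sum>b<r. lookup N (i, a, b))"
      "\<And>i b. lookup E (2 * i + 1, b) = (\<Sum>a<r. lookup N (i, a, b))"
      using product_exponent[OF cube[OF m'(2)], where 'k = 'k] by blast
    have "N = D" if "E = \<mu>"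
    proof -
      have N_supp: "i < k \<and> a < r \<and> b < r \<and> a \<noteq> b" if "lookup N (i, a, b) \<noteq> 0" for i a b
      proof -
        have "(i, a, b) \<in> keys N" using that by (simp add: Poly_Mapping.in_keys_iff)
        then show ?thesis using m'(2) unfolding splits_def by fastforce
      qed
      have T: "transport_tables r (\<lambda>a b. lookup N (i, a, b)) (\<lambda>a b. lookup D (i, a, b))" for i
      proof
        fix a b c d
        show "lookup N (i, a, b) \<noteq> 0 \<Longrightarrow> a < r \<and> b < r \<and> a \<noteq> b" using N_supp by blast
        show "lookup D (i, a, b) \<noteq> 0 \<Longrightarrow> a < b \<and> b < r" using D_keys[of i a b] mV by auto
        show "\<not> (a < c \<and> d < b)" if "lookup D (i, a, b) \<noteq> 0" "lookup D (i, c, d) \<noteq> 0"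
          using D_keys[OF that(1)] D_keys[OF that(2)] col(2)[of "(a, b)" "(c, d)"] by (auto simp: nests_def)
        show "(\<Sum>b<r. lookup N (i, a, b)) = (\<Sum>b<r. lookup D (i, a, b))"
          using \<open>E = \<mu>\<close> E(2)[of i a] \<mu>(2)[of i a] by simp
        show "(\<Sum>a<r. lookup N (i, a, b)) = (\<Sum>a<r. lookup D (i, a, b))"
          using \<open>E = \<mu>\<close> E(3)[of i b] \<mu>(3)[of i b] by simp
      qed
      from transport_compare[OF T, of k] show ?thesis
      proof
        assume eq: "\<forall>i<k. (\<lambda>a b. lookup N (i, a, b)) = (\<lambda>a b. lookup D (i, a, b))"
        show ?thesis
        proof (rule poly_mapping_eqI)
          fix x :: "nat \<times> nat \<times> nat"
          obtain i a b where x: "x = (i, a, b)" by (cases x)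
          show "lookup N x = lookup D x"
          proof (cases "i < k")
            case True
            then show ?thesis using eq by (simp add: x fun_eq_iff)
          next
            case False
            then have "lookup N (i, a, b) = 0" "lookup D (i, a, b) = 0"
              using N_supp[of i a b] D_keys[of i a b] col(1)[of "(a, b)"] by auto
            then show ?thesis by (simp add: x)
          qed
        qed
      next
        assume "\<exists>v\<in>skew_vars r. (\<Sum>i<k. lookup D (i, fst v, snd v)) <
            (\<Sum>i<k. lookup N (i, fst v, snd v) + lookup N (i, snd v, fst v)) \<and>
          (\<forall>w\<in>skew_vars r. skew_var_greater w v \<longrightarrow> (\<Sum>i<k. lookup D (i, fst w, snd w)) =
            (\<Sum>i<k. lookup N (i, fst w, snd w) + lookup N (i, snd w, fst w)))"
        moreover have "lookup m' v = (\<Sum>i<k. lookup N (i, fst v, snd v) + lookup N (i, snd v, fst v))"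
          if "v \<in> skew_vars r" for v
          using m'(2) that unfolding splits_def by (cases v) auto
        ultimately obtain v where v: "v \<in> skew_vars r" "lookup m v < lookup m' v"
          "\<And>w. w \<in> skew_vars r \<Longrightarrow> skew_var_greater w v \<Longrightarrow> lookup m w = lookup m' w"
          unfolding D_sum by auto
        have "lookup m w = lookup m' w" if "skew_var_greater w v" for w
        proof (cases "w \<in> skew_vars r")
          case False
          moreover have "keys m' \<subseteq> skew_vars r" using f m'(1) by (auto simp: carrier_mpoly)
          ultimately show ?thesis using mV by (metis Poly_Mapping.in_keys_iff subsetD)
        qed (use v(3) that in blast)
        then have "skew.lt m m'" using v(2) unfolding lex_less_def by blast
        then show ?thesis using mf(2)[OF m'(1)] skew.lt_asym skew.lt_irrefl by blast
      qed
    qed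
    moreover have "E = \<mu>" if "N = D"
      using E(1)[of 1] \<mu>(1)[of 1] that by (metis lookup_single_eq lookup_single_not_eq zero_neq_one)
    ultimately show ?thesis by (auto simp: E(1) lookup_single_if)
  qed
  have "rank_subst k f = (\<Sum>N\<in>keys G. subst product_entry (single N (lookup G N)))"
    unfolding rank_subst_factor G_def[symmetric]
    by (subst sum_monomials[of G, symmetric]) (rule subst.hom_sum)
  then have "lookup (rank_subst k f) \<mu> = (\<Sum>N\<in>keys G. if N = D then lookup G D else 0)"
    by (simp add: lookup_sum image_coeff cong: sum.cong)
  also have "\<dots> = lookup f m" using coeff by (simp add: Poly_Mapping.in_keys_iff)
  also have "\<dots> \<noteq> 0" using mf(1) by (simp add: Poly_Mapping.in_keys_iff)
  finally show ?thesis by auto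
qed

section \<open>Pfaffians\<close>

subsection \<open>A fraction-free Schur complement\<close>

text \<open>This is \<open>det B\<close> times the usual complement \<open>D + C^T B^(-1) C\<close>
  of the block matrix with lower left block \<open>- C^T\<close>, with \<open>adj_mat B\<close> in
  place of \<open>det B\<close> times the inverse.\<close>

definition schur :: "'a::comm_ring_1 mat \<Rightarrow> 'a mat \<Rightarrow> 'a mat \<Rightarrow> 'a mat" where
  "schur B C D = det B \<cdot>\<^sub>m D + transpose_mat C * (adj_mat B * C)"

lemma schur_carrier:
  assumes "B \<in> carrier_mat n n" "C \<in> carrier_mat n l" "D \<in> carrier_mat l l"
  shows "schur B C D \<in> carrier_mat l l"
  using assms adj_mat(1)[OF assms(1)] unfolding schur_def by auto

text \<open>Multiplication by \<open>?X\<close> clears the upper right block by column operations,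
  scaling the last \<open>l\<close> columns by \<open>det B\<close>; this accounts for the factor
  \<open>det B ^ l\<close>.\<close>

lemma det_schur:
  fixes B :: "'a::idom mat"
  assumes B: "B \<in> carrier_mat n n" and C: "C \<in> carrier_mat n l" and D: "D \<in> carrier_mat l l"
  shows "det (four_block_mat B C (- transpose_mat C) D) * det B ^ l = det B * det (schur B C D)"
proof -
  note adj = adj_mat[OF B]
  let ?A = "four_block_mat B C (- transpose_mat C) D"
  let ?X = "four_block_mat (1\<^sub>m n) (- (adj_mat B * C)) (0\<^sub>m l n) (det B \<cdot>\<^sub>m 1\<^sub>m l)"
  have adjC: "adj_mat B * C \<in> carrier_mat n l" using adj(1) C by auto
  have Ct: "transpose_mat C \<in> carrier_mat l n" using C by simp
  have c: "1\<^sub>m n \<in> carrier_mat n n" "- (adj_mat B * C) \<in> carrier_mat n l" "0\<^sub>m l n \<in> carrier_mat l n"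
    "det B \<cdot>\<^sub>m 1\<^sub>m l \<in> carrier_mat l l" "- transpose_mat C \<in> carrier_mat l n"
    using adjC Ct by simp_all
  have "?A * ?X = four_block_mat (B * 1\<^sub>m n + C * 0\<^sub>m l n) (B * - (adj_mat B * C) + C * (det B \<cdot>\<^sub>m 1\<^sub>m l))
      (- transpose_mat C * 1\<^sub>m n + D * 0\<^sub>m l n) (- transpose_mat C * - (adj_mat B * C) + D * (det B \<cdot>\<^sub>m 1\<^sub>m l))"
    by (rule mult_four_block_mat[OF B C c(5) D c(1-4)])
  also have "\<dots> = four_block_mat B (0\<^sub>m n l) (- transpose_mat C) (schur B C D)"
  proof (rule cong_four_block_mat)
    show "B * 1\<^sub>m n + C * 0\<^sub>m l n = B"
      using B C by (simp add: right_mult_zero_mat[OF C])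
    show "- transpose_mat C * 1\<^sub>m n + D * 0\<^sub>m l n = - transpose_mat C"
      using Ct D by (simp add: right_mult_zero_mat[OF D])
    have "B * (adj_mat B * C) = B * adj_mat B * C" using assoc_mult_mat[OF B adj(1) C] by simp
    also have "\<dots> = det B \<cdot>\<^sub>m C"
      unfolding adj(2) using mult_smult_assoc_mat[of "1\<^sub>m n" n n C l "det B"] C by simp
    finally have 1: "B * (adj_mat B * C) = det B \<cdot>\<^sub>m C" .
    have 2: "C * (det B \<cdot>\<^sub>m 1\<^sub>m l) = det B \<cdot>\<^sub>m C"
      using mult_smult_distrib[OF C, of "1\<^sub>m l" l "det B"] C by simp
    show "B * - (adj_mat B * C) + C * (det B \<cdot>\<^sub>m 1\<^sub>m l) = 0\<^sub>m n l"
    proof -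
      have "B * - (adj_mat B * C) = - (B * (adj_mat B * C))"
        by (rule uminus_mult_right_mat) (simp only: carrier_matD[OF B] carrier_matD[OF adjC])
      moreover have "det B \<cdot>\<^sub>m C \<in> carrier_mat n l" using C by simp
      ultimately show ?thesis unfolding 1 2 by simp
    qed
    have "D * (det B \<cdot>\<^sub>m 1\<^sub>m l) = det B \<cdot>\<^sub>m D"
      using mult_smult_distrib[OF D, of "1\<^sub>m l" l "det B"] D by simp
    moreover have "transpose_mat C * (adj_mat B * C) \<in> carrier_mat l l" using Ct adjC by auto
    moreover have "det B \<cdot>\<^sub>m D \<in> carrier_mat l l" using D by simp
    moreover have "- transpose_mat C * - (adj_mat B * C) = transpose_mat C * (adj_mat B * C)"
    proof -
      have "- transpose_mat C * - (adj_mat B * C) = - (transpose_mat C * - (adj_mat B * C))"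
        by (rule uminus_mult_left_mat) (use Ct adjC carrier_matD in \<open>simp only: carrier_matD[OF Ct] carrier_matD[OF adjC] index_uminus_mat\<close>)
      also have "transpose_mat C * - (adj_mat B * C) = - (transpose_mat C * (adj_mat B * C))"
        by (rule uminus_mult_right_mat) (simp only: carrier_matD[OF Ct] carrier_matD[OF adjC])
      finally show ?thesis by simp
    qed
    ultimately show "- transpose_mat C * - (adj_mat B * C) + D * (det B \<cdot>\<^sub>m 1\<^sub>m l) = schur B C D"
      using comm_add_mat[of "transpose_mat C * (adj_mat B * C)" l l "det B \<cdot>\<^sub>m D"]
      by (simp only: schur_def)
  qed
  finally have AX: "?A * ?X = four_block_mat B (0\<^sub>m n l) (- transpose_mat C) (schur B C D)" .
  have "?A \<in> carrier_mat (n + l) (n + l)" "?X \<in> carrier_mat (n + l) (n + l)"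
    by (rule four_block_carrier_mat[OF B D], rule four_block_carrier_mat[OF c(1,4)])
  then have "det (?A * ?X) = det ?A * det ?X" by (rule det_mult)
  moreover have "det ?X = det B ^ l"
  proof -
    have "det ?X = det (1\<^sub>m n :: 'a mat) * det (det B \<cdot>\<^sub>m 1\<^sub>m l)"
      by (rule det_four_block_mat_lower_left_zero[OF c(1,2) refl c(4)])
    then show ?thesis by simp
  qed
  moreover have "det (four_block_mat B (0\<^sub>m n l) (- transpose_mat C) (schur B C D)) = det B * det (schur B C D)"
    by (rule det_four_block_mat_upper_right_zero[OF B refl c(5) schur_carrier[OF B C D]])
  ultimately show ?thesis using AX by simp
qed

lemma transpose_smult_mat: "transpose_mat (a \<cdot>\<^sub>m A) = a \<cdot>\<^sub>m transpose_mat A"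
  by (intro eq_matI) auto

lemma smult_mat_cancel:
  fixes d :: "'a::idom"
  assumes X: "X \<in> carrier_mat n m" and Y: "Y \<in> carrier_mat n m" and eq: "d \<cdot>\<^sub>m X = d \<cdot>\<^sub>m Y" and "d \<noteq> 0"
  shows "X = Y"
proof (rule eq_matI)
  fix i j assume ij: "i < dim_row Y" "j < dim_col Y"
  have "(d \<cdot>\<^sub>m X) $$ (i, j) = (d \<cdot>\<^sub>m Y) $$ (i, j)" by (simp only: eq)
  then show "X $$ (i, j) = Y $$ (i, j)" using ij X Y \<open>d \<noteq> 0\<close> by simp
qed (use X Y in auto)

lemma uminus_add_uminus_mat:
  "A \<in> carrier_mat n m \<Longrightarrow> B \<in> carrier_mat n m \<Longrightarrow> - A + - B = - (A + B :: 'a::ab_group_add mat)"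
  by (intro eq_matI) auto

text \<open>The adjugate of \<open>B\<close> is itself skew-symmetric: its transpose and its
  negative agree after multiplication by \<open>det B\<close>, which can be cancelled.\<close>

lemma transpose_schur:
  fixes B :: "'a::idom mat"
  assumes B: "B \<in> carrier_mat n n" and C: "C \<in> carrier_mat n l" and D: "D \<in> carrier_mat l l"
    and skew: "transpose_mat B = - B" "transpose_mat D = - D" and "det B \<noteq> 0"
  shows "transpose_mat (schur B C D) = - schur B C D"
proof -
  note adj = adj_mat[OF B]
  let ?T = "transpose_mat (adj_mat B)"
  have T: "?T \<in> carrier_mat n n" using adj(1) by simp
  have "transpose_mat (B * adj_mat B) = ?T * transpose_mat B" by (rule transpose_mult[OF B adj(1)])
  then have "- (?T * B) = det B \<cdot>\<^sub>m 1\<^sub>m n"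
    unfolding adj(2) skew using uminus_mult_right_mat[of ?T B] T B
    by (simp add: transpose_smult_mat carrier_matD)
  then have TB: "?T * B = - (det B \<cdot>\<^sub>m 1\<^sub>m n)" by (metis uminus_uminus_mat)
  have "?T * (B * adj_mat B) = (?T * B) * adj_mat B" using assoc_mult_mat[OF T B adj(1)] by simp
  then have "det B \<cdot>\<^sub>m ?T = - (det B \<cdot>\<^sub>m adj_mat B)"
    unfolding TB adj(2)
    using mult_smult_distrib[OF T, of "1\<^sub>m n" n "det B"] T
      mult_smult_assoc_mat[of "1\<^sub>m n" n n "adj_mat B" n "det B"] adj(1) by simp
  also have "\<dots> = det B \<cdot>\<^sub>m - adj_mat B" by (intro eq_matI) auto
  finally have "det B \<cdot>\<^sub>m ?T = det B \<cdot>\<^sub>m - adj_mat B" .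
  moreover have "- adj_mat B \<in> carrier_mat n n" using adj(1) by simp
  ultimately have adjT: "?T = - adj_mat B" using smult_mat_cancel[OF T] \<open>det B \<noteq> 0\<close> by blast
  have adjC: "adj_mat B * C \<in> carrier_mat n l" using adj(1) C by auto
  have Ct: "transpose_mat C \<in> carrier_mat l n" using C by simp
  have "transpose_mat (transpose_mat C * (adj_mat B * C)) = transpose_mat (adj_mat B * C) * C"
    using transpose_mult[OF Ct adjC] by simp
  also have "\<dots> = transpose_mat C * ?T * C" using transpose_mult[OF adj(1) C] by simp
  also have "\<dots> = - (transpose_mat C * (adj_mat B * C))"
  proof -
    have "transpose_mat C * - adj_mat B = - (transpose_mat C * adj_mat B)"
      by (rule uminus_mult_right_mat) (simp only: carrier_matD[OF Ct] carrier_matD[OF adj(1)])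
    moreover have "- (transpose_mat C * adj_mat B) * C = - (transpose_mat C * adj_mat B * C)"
      by (rule uminus_mult_left_mat) (simp only: index_mult_mat carrier_matD[OF C] carrier_matD[OF adj(1)])
    ultimately show ?thesis unfolding adjT assoc_mult_mat[OF Ct adj(1) C, symmetric] by simp
  qed
  finally have 1: "transpose_mat (transpose_mat C * (adj_mat B * C)) = - (transpose_mat C * (adj_mat B * C))" .
  have 2: "transpose_mat (det B \<cdot>\<^sub>m D) = - (det B \<cdot>\<^sub>m D)"
    unfolding transpose_smult_mat skew by (intro eq_matI) auto
  have c: "det B \<cdot>\<^sub>m D \<in> carrier_mat l l" "transpose_mat C * (adj_mat B * C) \<in> carrier_mat l l"
    using D by simp (rule mult_carrier_mat[OF Ct adjC])
  show ?thesis
    unfolding schur_def transpose_add[OF c] 1 2 by (rule uminus_add_uminus_mat[OF c])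
qed

text \<open>The zero diagonal is listed separately because sign reversal alone does not imply it in
  characteristic two.\<close>

definition skew_mat :: "nat \<Rightarrow> 'a::ring_1 mat \<Rightarrow> bool" where
  "skew_mat n A \<longleftrightarrow> A \<in> carrier_mat n n \<and> (\<forall>i<n. A $$ (i, i) = 0) \<and> (\<forall>i<n. \<forall>j<n. A $$ (i, j) = - A $$ (j, i))"

lemma skew_matD:
  assumes "skew_mat n A"
  shows "A \<in> carrier_mat n n" "i < n \<Longrightarrow> A $$ (i, i) = 0"
    "i < n \<Longrightarrow> j < n \<Longrightarrow> A $$ (i, j) = - A $$ (j, i)"
  using assms unfolding skew_mat_def by blast+

lemma skew_mat_transpose:
  assumes "skew_mat n A" shows "transpose_mat A = - A"
proof (rule eq_matI)
  fix i j assume "i < dim_row (- A)" "j < dim_col (- A)"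
  then have ij: "i < n" "j < n" using skew_matD(1)[OF assms] by auto
  then show "transpose_mat A $$ (i, j) = (- A) $$ (i, j)"
    using skew_matD(3)[OF assms ij(2,1)] skew_matD(1)[OF assms] by simp
qed (use skew_matD(1)[OF assms] in auto)

lemma skew_matI:
  fixes A :: "'a::{idom, ring_char_0} mat"
  assumes A: "A \<in> carrier_mat n n" and T: "transpose_mat A = - A"
  shows "skew_mat n A"
proof -
  have eq: "A $$ (i, j) = - A $$ (j, i)" if "i < n" "j < n" for i j
  proof -
    have "transpose_mat A $$ (j, i) = (- A) $$ (j, i)" using T by simp
    then show ?thesis using A that by simp
  qed
  moreover have "A $$ (i, i) = 0" if "i < n" for i
  proof -
    have "2 * A $$ (i, i) = 0" using eq[OF that that] by (metis add.right_inverse mult_2)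
    then show ?thesis by simp
  qed
  ultimately show ?thesis using A unfolding skew_mat_def by blast
qed

lemma schur_skew:
  fixes B :: "'a::{idom, ring_char_0} mat"
  assumes "skew_mat n B" "C \<in> carrier_mat n l" "skew_mat l D" "det B \<noteq> 0"
  shows "skew_mat l (schur B C D)"
  by (rule skew_matI[OF schur_carrier transpose_schur])
     (use assms skew_matD(1)[OF assms(1)] skew_matD(1)[OF assms(3)] in \<open>simp_all add: skew_mat_transpose\<close>)

lemma det_skew_2:
  fixes A :: "'a::comm_ring_1 mat"
  assumes "skew_mat 2 A"
  shows "det A = (A $$ (0, 1))\<^sup>2"
proof -
  have two: "{0..<2::nat} = {0, 1}" by auto
  have perms: "{p. p permutes {0..<2::nat}} = {id, Transposition.transpose 0 1}"
    unfolding two permutes_doubleton_iff by blast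
  have "Transposition.transpose 0 (1::nat) 0 \<noteq> id 0" by simp
  then have ne: "id \<noteq> Transposition.transpose 0 (1::nat)" by (metis (full_types))
  have A: "A \<in> carrier_mat 2 2" "A $$ (0, 0) = 0" using skew_matD(1,2)[OF assms] by auto
  have A1: "A $$ (1, 0) = - A $$ (0, 1)" using skew_matD(3)[OF assms, of 1 0] by simp
  have [simp]: "sign (Transposition.transpose 0 (Suc 0)) = - 1" by (simp add: sign_swap_id)
  have "det A = (\<Sum>p\<in>{id, Transposition.transpose 0 1}. signof p * (\<Prod>i = 0..<2. A $$ (i, p i)))"
    using det_def'[OF A(1)] perms by simp
  also have "\<dots> = (A $$ (0, 1))\<^sup>2"
    using ne A(2) A1 by (simp add: two power2_eq_square)
  finally show ?thesis .
qed

subsection \<open>Homogeneous polynomials\<close>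

definition total_degree :: "('x \<Rightarrow>\<^sub>0 nat) \<Rightarrow> nat" where
  "total_degree m = (\<Sum>v\<in>keys m. lookup m v)"

lemma total_degree_superset: "finite A \<Longrightarrow> keys m \<subseteq> A \<Longrightarrow> total_degree m = (\<Sum>v\<in>A. lookup m v)"
  unfolding total_degree_def
  by (intro sum.mono_neutral_left) (auto simp: Poly_Mapping.in_keys_iff)

lemma total_degree_add: "total_degree (m + n) = total_degree m + total_degree n"
  using total_degree_superset[of "keys m \<union> keys n" m] total_degree_superset[of "keys m \<union> keys n" n]
    total_degree_superset[of "keys m \<union> keys n" "m + n"]
  by (simp add: keys_plus_nat lookup_add sum.distrib)

definition homogeneous :: "nat \<Rightarrow> ('x, 'k::zero) mpoly \<Rightarrow> bool" where
  "homogeneous d f \<longleftrightarrow> (\<forall>m\<in>keys f. total_degree m = d)"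

lemma homogeneous_mult: "homogeneous c f \<Longrightarrow> homogeneous d g \<Longrightarrow> homogeneous (c + d) (f * g)"
  unfolding homogeneous_def by (metis keys_multE total_degree_add)

lemma homogeneous_const: "homogeneous 0 (single 0 c)"
  by (simp add: homogeneous_def total_degree_def)

lemma homogeneous_prod:
  fixes f :: "'i \<Rightarrow> ('x, 'k::comm_ring_1) mpoly"
  shows "(\<And>i. i \<in> A \<Longrightarrow> homogeneous (d i) (f i)) \<Longrightarrow> homogeneous (sum d A) (prod f A)"
proof (induction A rule: infinite_finite_induct)
  case (insert x F)
  then show ?case by (simp add: homogeneous_mult)
qed (simp_all add: homogeneous_def total_degree_def)

lemma homogeneous_sum:
  assumes "\<And>i. i \<in> A \<Longrightarrow> homogeneous d (f i)"
  shows "homogeneous d (sum f A)"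
  using assms Poly_Mapping.keys_sum[of f A] unfolding homogeneous_def by blast

lemma homogeneous_uminus: "homogeneous d f \<Longrightarrow> homogeneous d (- f :: ('x, 'k::ab_group_add) mpoly)"
  by (simp add: homogeneous_def)

lemma homogeneous_indet: "homogeneous 1 (indet v)"
  by (simp add: homogeneous_def indet_def total_degree_def)

text \<open>Lowest and highest degrees of \<open>f\<close> both reappear doubled in
  \<open>f ^ 2\<close>: use the least-weight argument for the degree and for its negative.\<close>

lemma homogeneous_sqrt:
  fixes f :: "('x::linorder, 'k::idom) mpoly"
  assumes "homogeneous (2 * d) (f ^ 2)"
  shows "homogeneous d f"
proof (cases "f = 0")
  case False
  have *: "\<exists>m\<in>keys f. total_degree m = d \<and> (\<forall>n\<in>keys f. w m \<le> w n)"
    if add: "\<And>m n. w (m + n) = w m + w n"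
      and double: "\<And>p m. w p = w m + w m \<Longrightarrow> total_degree p = 2 * total_degree m"
    for w :: "('x \<Rightarrow>\<^sub>0 nat) \<Rightarrow> int"
  proof -
    have fin: "finite (keys f)" "keys f \<noteq> {}" using False by auto
    obtain m where m: "m \<in> keys f" "\<And>n. n \<in> keys f \<Longrightarrow> w m \<le> w n"
      using arg_min_if_finite(1)[OF fin, of w] arg_min_least[OF fin, of _ w] by blast
    obtain p where p: "p \<in> keys (f * f)" "w p = w m + w m"
      using min_weight_mult[of w m f m f, OF add m m] by blast
    then have "total_degree p = 2 * d" using assms by (simp add: homogeneous_def power2_eq_square)
    then show ?thesis using p m double by fastforce
  qed
  have "d \<le> total_degree n \<and> total_degree n \<le> d" if "n \<in> keys f" for n
    using *[of "\<lambda>m. int (total_degree m)"] *[of "\<lambda>m. - int (total_degree m)"] that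
    by (force simp: total_degree_add)
  then show ?thesis by (simp add: homogeneous_def antisym)
qed (simp add: homogeneous_def)

subsection \<open>Existence of Pfaffians\<close>

definition skew_entry :: "nat \<Rightarrow> nat \<Rightarrow> (nat \<times> nat, 'k::comm_ring_1) mpoly" where
  "skew_entry i j = (if i < j then indet (i, j) else if j < i then - indet (j, i) else 0)"

text \<open>Indexing by a map instead of a set permits repeated and unordered indices, which occur
  when a block is bordered by two arbitrary further indices.\<close>

definition skew_at :: "(nat \<Rightarrow> nat) \<Rightarrow> nat \<Rightarrow> (nat \<times> nat, 'k::comm_ring_1) mpoly mat" where
  "skew_at e n = mat n n (\<lambda>(i, j). skew_entry (e i) (e j))"

definition cross_at :: "(nat \<Rightarrow> nat) \<Rightarrow> nat \<Rightarrow> nat \<Rightarrow> (nat \<times> nat, 'k::comm_ring_1) mpoly mat" where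
  "cross_at e n l = mat n l (\<lambda>(i, j). skew_entry (e i) (e (n + j)))"

lemma skew_at_carrier: "skew_at e n \<in> carrier_mat n n"
  and cross_at_carrier: "cross_at e n l \<in> carrier_mat n l"
  by (simp_all add: skew_at_def cross_at_def)

lemma skew_entry_swap: "skew_entry i j = - skew_entry j i"
  by (simp add: skew_entry_def)

lemma skew_mat_skew_at: "skew_mat n (skew_at e n)"
  unfolding skew_mat_def
proof (intro conjI allI impI)
  show "skew_at e n $$ (i, j) = - skew_at e n $$ (j, i)" if "i < n" "j < n" for i j
    using that skew_entry_swap[of "e i" "e j"] by (simp add: skew_at_def)
qed (simp_all add: skew_at_def skew_entry_def)

lemma skew_at_four_block:
  "skew_at e (n + l) = four_block_mat (skew_at e n) (cross_at e n l)
     (- transpose_mat (cross_at e n l)) (skew_at (\<lambda>i. e (n + i)) l)"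
proof (rule eq_matI)
  fix i j
  assume "i < dim_row (four_block_mat (skew_at e n) (cross_at e n l)
      (- transpose_mat (cross_at e n l)) (skew_at (\<lambda>i. e (n + i)) l) :: (nat \<times> nat, 'a) mpoly mat)"
    "j < dim_col (four_block_mat (skew_at e n) (cross_at e n l)
      (- transpose_mat (cross_at e n l)) (skew_at (\<lambda>i. e (n + i)) l) :: (nat \<times> nat, 'a) mpoly mat)"
  then have ij: "i < n + l" "j < n + l" by (simp_all add: skew_at_def)
  then show "skew_at e (n + l) $$ (i, j) = (four_block_mat (skew_at e n) (cross_at e n l)
      (- transpose_mat (cross_at e n l)) (skew_at (\<lambda>i. e (n + i)) l) :: (nat \<times> nat, 'a) mpoly mat) $$ (i, j)"
    by (simp add: skew_at_def cross_at_def) (intro impI skew_entry_swap)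
qed (simp_all add: skew_at_def)

lemma homogeneous_skew_entry: "homogeneous 1 (skew_entry i j)"
  using homogeneous_indet[of "(i, j)"] homogeneous_uminus[OF homogeneous_indet[of "(j, i)"]]
  by (auto simp: skew_entry_def homogeneous_def)

lemma const_of_int: "single 0 (of_int z) = (of_int z :: ('x, 'k::comm_ring_1) mpoly)"
  by simp

lemma homogeneous_det_skew_at: "homogeneous n (det (skew_at e n) :: (_, 'k::comm_ring_1) mpoly)"
  unfolding det_def'[OF skew_at_carrier]
proof (rule homogeneous_sum)
  fix p assume "p \<in> {p. p permutes {0..<n}}"
  then have p: "p i < n" if "i < n" for i using that permutes_in_image[of p "{0..<n}" i] by auto
  have "homogeneous (\<Sum>i\<in>{0..<n}. 1) (\<Prod>i = 0..<n. skew_at e n $$ (i, p i) :: (_, 'k) mpoly)"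
    by (rule homogeneous_prod) (simp add: skew_at_def p homogeneous_skew_entry[unfolded One_nat_def])
  then have "homogeneous n (\<Prod>i = 0..<n. skew_at e n $$ (i, p i) :: (_, 'k) mpoly)" by simp
  from homogeneous_mult[OF homogeneous_const[of "of_int (sign p) :: 'k"] this]
  show "homogeneous n (signof p * (\<Prod>i = 0..<n. skew_at e n $$ (i, p i)) :: (_, 'k) mpoly)"
    by (simp only: const_of_int add_0)
qed

lemma carrier_det:
  assumes "A \<in> carrier_mat n n" "\<And>i j. i < n \<Longrightarrow> j < n \<Longrightarrow> A $$ (i, j) \<in> carrier (mpoly_ring V)"
  shows "det A \<in> carrier (mpoly_ring V)"
  unfolding det_def'[OF assms(1)]
proof (intro carrier_sum carrier_mult carrier_prod)
  fix p assume "p \<in> {p. p permutes {0..<n}}"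
  then have p: "p i < n" if "i < n" for i using that permutes_in_image[of p "{0..<n}" i] by auto
  show "signof p \<in> carrier (mpoly_ring V)"
    using carrier_const[of "of_int (sign p)" V] by (simp only: const_of_int)
  show "A $$ (i, p i) \<in> carrier (mpoly_ring V)" if "i \<in> {0..<n}" for i
    using that p assms(2) by simp
qed

lemma carrier_skew_entry:
  "i < r \<Longrightarrow> j < r \<Longrightarrow> skew_entry i j \<in> carrier (mpoly_ring (skew_vars r))"
  by (auto simp: skew_entry_def intro!: carrier_indet carrier_uminus)

lemma carrier_det_skew_at:
  assumes "\<And>i. i < n \<Longrightarrow> e i < r"
  shows "det (skew_at e n) \<in> carrier (mpoly_ring (skew_vars r))"
  by (rule carrier_det[OF skew_at_carrier]) (simp add: skew_at_def assms carrier_skew_entry)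

text \<open>The largest exponent of a variable in \<open>f\<close> reappears doubled in
  \<open>f ^ 2\<close>, so a variable missing from the square is missing from the root.\<close>

lemma carrier_sqrt:
  fixes f :: "('x::linorder, 'k::idom) mpoly"
  assumes "f ^ 2 \<in> carrier (mpoly_ring V)"
  shows "f \<in> carrier (mpoly_ring V)"
proof (cases "f = 0")
  case False
  have "lookup m v = 0" if m: "m \<in> keys f" and v: "v \<notin> V" for m v
  proof -
    let ?w = "\<lambda>m :: 'x \<Rightarrow>\<^sub>0 nat. - int (lookup m v)"
    have fin: "finite (keys f)" "keys f \<noteq> {}" using False by auto
    obtain n where n: "n \<in> keys f" "\<And>n'. n' \<in> keys f \<Longrightarrow> ?w n \<le> ?w n'"
      using arg_min_if_finite(1)[OF fin, of ?w] arg_min_least[OF fin, of _ ?w] by blast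
    obtain p where p: "p \<in> keys (f * f)" "?w p = ?w n + ?w n"
      using min_weight_mult[of ?w n f n f, OF _ n n] by (auto simp: lookup_add)
    then have "keys p \<subseteq> V" using assms by (auto simp: carrier_mpoly power2_eq_square)
    then have "lookup p v = 0" using v by (metis Poly_Mapping.in_keys_iff subsetD)
    then show ?thesis using p(2) n(2)[OF m] by simp
  qed
  then show ?thesis by (auto simp: carrier_mpoly Poly_Mapping.in_keys_iff)
qed simp

lemma subst_skew_mat:
  assumes "skew_mat n N"
  shows "map_mat (subst (\<lambda>(i, j). N $$ (i, j))) (skew_at id n) = N"
proof (rule eq_matI)
  fix i j assume "i < dim_row N" "j < dim_col N"
  then have ij: "i < n" "j < n" using skew_matD(1)[OF assms] by auto
  show "map_mat (subst (\<lambda>(i, j). N $$ (i, j))) (skew_at id n) $$ (i, j) = N $$ (i, j)"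
    using ij skew_matD(3)[OF assms ij] skew_matD(2)[OF assms ij(1)]
    by (cases i j rule: linorder_cases) (simp_all add: skew_at_def skew_entry_def subst.hom_uminus)
qed (use skew_matD(1)[OF assms] in \<open>auto simp: skew_at_def\<close>)

text \<open>A root for the generic matrix is universal: specializing the entries above the diagonal
  gives a root for every skew-symmetric matrix.\<close>

lemma subst_sqrt_det:
  assumes "f ^ 2 = det (skew_at id n)" "skew_mat n N"
  shows "subst (\<lambda>(i, j). N $$ (i, j)) f ^ 2 = det N"
proof -
  have "subst (\<lambda>(i, j). N $$ (i, j)) f ^ 2 = subst (\<lambda>(i, j). N $$ (i, j)) (det (skew_at id n))"
    by (simp only: assms(1)[symmetric] subst.hom_power)
  also have "\<dots> = det (map_mat (subst (\<lambda>(i, j). N $$ (i, j))) (skew_at id n))"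
    by (simp only: subst.hom_det)
  finally show ?thesis by (simp only: subst_skew_mat[OF assms(2)])
qed

lemma indet_nonzero: "indet v \<noteq> (0 :: ('x, 'k::comm_ring_1) mpoly)"
  by (metis indet_def keys_eq_empty keys_single insert_not_empty zero_neq_one)

text \<open>Setting \<open>v\<close> to zero kills \<open>h ^ 2\<close> and hence \<open>h\<close>,
  so \<open>v\<close> occurs in every monomial of \<open>h\<close>.\<close>

lemma indet_dvd_sqrt:
  fixes h :: "('x::linorder, 'k::idom) mpoly"
  assumes "h ^ 2 = indet v * g"
  obtains h' where "h = indet v * h'"
proof -
  let ?\<rho> = "\<lambda>w. if w \<in> - {v} then indet w else (0 :: ('x, 'k) mpoly)"
  have "subst ?\<rho> h ^ 2 = 0"
    using arg_cong[OF assms, of "subst ?\<rho>"] by (simp add: subst.hom_power subst.hom_mult)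
  then have "subst ?\<rho> h = 0" by simp
  then have v: "lookup m v \<noteq> 0" if "m \<in> keys h" for m
    using that subst_face[of "- {v}" h m] by (auto simp: Poly_Mapping.in_keys_iff subset_iff split: if_splits)
  have "h = (\<Sum>m\<in>keys h. single m (lookup h m))" by (rule sum_monomials[symmetric])
  also have "\<dots> = (\<Sum>m\<in>keys h. indet v * single (m - single v 1) (lookup h m))"
  proof (rule sum.cong[OF refl])
    fix m assume "m \<in> keys h"
    then have "m = m - single v 1 + single v 1" using exponent_minus_single[OF v] by metis
    then show "single m (lookup h m) = indet v * single (m - single v 1) (lookup h m)"
      by (metis single_add_indet mult.commute)
  qed
  finally have "h = indet v * (\<Sum>m\<in>keys h. single (m - single v 1) (lookup h m))"
    by (simp only: sum_distrib_left)
  then show ?thesis by (rule that)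
qed

lemma indet_power_sqrt:
  fixes h :: "('x::linorder, 'k::idom) mpoly"
  assumes "h ^ 2 = indet v ^ (2 * n) * g"
  shows "\<exists>h'. h = indet v ^ n * h' \<and> h' ^ 2 = g"
  using assms
proof (induction n arbitrary: h)
  case (Suc n)
  have "h ^ 2 = indet v * (indet v ^ (2 * n + 1) * g)"
    unfolding Suc.prems by (simp add: mult.assoc)
  then obtain h1 where h1: "h = indet v * h1" by (rule indet_dvd_sqrt)
  have "indet v ^ 2 * h1 ^ 2 = h ^ 2" by (simp only: h1 power_mult_distrib)
  also have "\<dots> = indet v ^ 2 * (indet v ^ (2 * n) * g)"
    unfolding Suc.prems by (simp add: power2_eq_square mult.assoc)
  finally have eq: "indet v ^ 2 * h1 ^ 2 = indet v ^ 2 * (indet v ^ (2 * n) * g)" .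
  have "indet v ^ 2 \<noteq> (0 :: ('x, 'k) mpoly)" by (rule power_not_zero[OF indet_nonzero])
  then have "h1 ^ 2 = indet v ^ (2 * n) * g"
    using eq by (rule mult_left_cancel[THEN iffD1])
  then obtain h' where h': "h1 = indet v ^ n * h'" "h' ^ 2 = g" using Suc.IH by blast
  then have "h = indet v ^ Suc n * h'" unfolding h1 by (simp add: mult.assoc)
  then show ?case using h'(2) by blast
qed simp

lemma schur_index:
  assumes B: "B \<in> carrier_mat n n" and C: "C \<in> carrier_mat n l" and D: "D \<in> carrier_mat l l"
    and ij: "i < l" "j < l"
  shows "schur B C D $$ (i, j) = det B * D $$ (i, j) + col C i \<bullet> (adj_mat B *\<^sub>v col C j)"
proof -
  have adj: "adj_mat B \<in> carrier_mat n n" by (rule adj_mat(1)[OF B])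
  have "(transpose_mat C * (adj_mat B * C)) $$ (i, j) = row (transpose_mat C) i \<bullet> col (adj_mat B * C) j"
    using ij C adj by (intro index_mult_mat) auto
  also have "row (transpose_mat C) i = col C i" using ij C by simp
  also have "col (adj_mat B * C) j = adj_mat B *\<^sub>v col C j"
    using ij C adj by (intro col_mult2) auto
  finally show ?thesis
    using ij C D adj by (simp add: schur_def)
qed

text \<open>Eliminating the leading block of size two by a fraction-free Schur complement introduces only
  powers of the single indeterminate in this block, which can be cancelled from the square root.\<close>

lemma pfaffian_exists:
  "\<exists>f :: (nat \<times> nat, 'k::field_char_0) mpoly. f \<in> carrier (mpoly_ring (skew_vars (2 * s))) \<and>
     f ^ 2 = det (skew_at id (2 * s)) \<and> f \<noteq> 0"
proof (induction s)
  case 0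
  have "skew_at e 0 = (1\<^sub>m 0 :: (nat \<times> nat, 'k) mpoly mat)" for e
    by (rule eq_matI) (auto simp: skew_at_def)
  then show ?case by (intro exI[of _ 1]) simp
next
  case (Suc s)
  then obtain f :: "(nat \<times> nat, 'k) mpoly" where f: "f \<in> carrier (mpoly_ring (skew_vars (2 * s)))"
    "f ^ 2 = det (skew_at id (2 * s))" "f \<noteq> 0" by blast
  let ?B = "skew_at id 2 :: (nat \<times> nat, 'k) mpoly mat"
  let ?C = "cross_at id 2 (2 * s) :: (nat \<times> nat, 'k) mpoly mat"
  let ?D = "skew_at (\<lambda>i. id (2 + i)) (2 * s) :: (nat \<times> nat, 'k) mpoly mat"
  let ?z = "indet (0, 1) :: (nat \<times> nat, 'k) mpoly"
  have detB: "det ?B = ?z ^ 2"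
  proof -
    have "det ?B = (?B $$ (0, 1))\<^sup>2" by (rule det_skew_2[OF skew_mat_skew_at])
    then show ?thesis by (simp add: skew_at_def skew_entry_def)
  qed
  then have B0: "det ?B \<noteq> 0" by (simp add: indet_nonzero)
  let ?N = "schur ?B ?C ?D"
  have N: "skew_mat (2 * s) ?N"
    by (rule schur_skew[OF skew_mat_skew_at cross_at_carrier skew_mat_skew_at B0])
  let ?\<nu> = "\<lambda>(i, j). ?N $$ (i, j)"
  define h where "h = subst ?\<nu> f"
  have h2: "h ^ 2 = det ?N" unfolding h_def by (rule subst_sqrt_det[OF f(2) N])
  have "det (skew_at id (2 + 2 * s)) * det ?B ^ (2 * s) = det ?B * det ?N"
    unfolding skew_at_four_block
    by (rule det_schur[OF skew_at_carrier cross_at_carrier skew_at_carrier])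
  \<comment> \<open>As \<open>det ?B\<close> is the square of \<open>?z\<close>, one side is a
    square and the other carries an even power of \<open>?z\<close>. Dividing the root by
    \<open>?z ^ (2 * s)\<close> leaves the root of the larger determinant.\<close>
  then have "(?z * h) ^ 2 = ?z ^ (2 * (2 * s)) * det (skew_at id (2 + 2 * s))"
    unfolding detB h2[symmetric] by (simp only: power_mult_distrib power_mult[symmetric] mult.commute)
  then obtain f' where f': "?z * h = ?z ^ (2 * s) * f'" "f' ^ 2 = det (skew_at id (2 + 2 * s))"
    using indet_power_sqrt by blast
  have "h \<noteq> 0"
  proof
    assume "h = 0"
    \<comment> \<open>Setting the leading block to its standard form and the cross block to zero
      turns the Schur complement back into the generic matrix of size \<open>2 * s\<close>, with
      indices shifted by two. So \<open>h\<close> specializes to \<open>f\<close>, which is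
      nonzero.\<close>
    define \<theta> :: "nat \<times> nat \<Rightarrow> (nat \<times> nat, 'k) mpoly" where
      "\<theta> = (\<lambda>(i, j). if i = 0 \<and> j = 1 then 1 else if i < 2 then 0 else indet (i - 2, j - 2))"
    have "subst \<theta> h = subst (\<lambda>v. subst \<theta> (?\<nu> v)) f" by (simp only: h_def subst_subst)
    also have "\<dots> = subst indet f"
    proof (rule subst_cong[OF f(1)])
      fix v assume "v \<in> skew_vars (2 * s)"
      then obtain i j where v: "v = (i, j)" "i < j" "j < 2 * s" by (cases v) auto
      have adjB: "adj_mat ?B \<in> carrier_mat 2 2" by (rule adj_mat(1)[OF skew_at_carrier])
      have "subst \<theta> (col ?C i \<bullet> (adj_mat ?B *\<^sub>v col ?C j)) =
          (\<Sum>k = 0..<2. subst \<theta> (col ?C i $ k) * subst \<theta> ((adj_mat ?B *\<^sub>v col ?C j) $ k))"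
        using adjB by (simp add: scalar_prod_def subst.hom_add subst.hom_mult numeral_2_eq_2)
      also have "\<dots> = 0"
        using v by (intro sum.neutral) (auto simp: cross_at_def skew_entry_def \<theta>_def)
      finally have col0: "subst \<theta> (col ?C i \<bullet> (adj_mat ?B *\<^sub>v col ?C j)) = 0" .
      have "?N $$ (i, j) = det ?B * ?D $$ (i, j) + col ?C i \<bullet> (adj_mat ?B *\<^sub>v col ?C j)"
        by (rule schur_index[OF skew_at_carrier cross_at_carrier skew_at_carrier]) (use v in auto)
      then have "subst \<theta> (?N $$ (i, j)) = subst \<theta> (det ?B) * subst \<theta> (?D $$ (i, j))"
        by (simp add: subst.hom_add subst.hom_mult col0)
      then show "subst \<theta> (?\<nu> v) = indet v"
        using v unfolding detB by (simp add: subst.hom_power skew_at_def skew_entry_def \<theta>_def)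
    qed
    finally show False using \<open>h = 0\<close> f(3) by simp
  qed
  then have "?z * h \<noteq> 0" by (simp add: indet_nonzero)
  then have "f' \<noteq> 0" using f'(1) by auto
  moreover have "f' \<in> carrier (mpoly_ring (skew_vars (2 * Suc s)))"
    by (rule carrier_sqrt) (simp add: f'(2) carrier_det_skew_at)
  moreover have "f' ^ 2 = det (skew_at id (2 * Suc s))" using f'(2) by (simp only: mult_Suc_right)
  ultimately show ?case by blast
qed

text \<open>The choice fixes a sign for each size; ideals and leading monomials do not depend on
  it.\<close>

definition pfaffian :: "nat \<Rightarrow> (nat \<times> nat, 'k::field_char_0) mpoly" where
  "pfaffian s = (SOME f. f \<in> carrier (mpoly_ring (skew_vars (2 * s))) \<and>
     f ^ 2 = det (skew_at id (2 * s)) \<and> f \<noteq> 0)"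

lemma pfaffian:
  "(pfaffian s :: (nat \<times> nat, 'k::field_char_0) mpoly) \<in> carrier (mpoly_ring (skew_vars (2 * s)))"
  "(pfaffian s :: (nat \<times> nat, 'k) mpoly) ^ 2 = det (skew_at id (2 * s))"
  "pfaffian s \<noteq> (0 :: (nat \<times> nat, 'k) mpoly)"
  using someI_ex[OF pfaffian_exists[of s, where 'k = 'k]] unfolding pfaffian_def by auto

lemma homogeneous_pfaffian: "homogeneous s (pfaffian s)"
  by (rule homogeneous_sqrt) (simp add: pfaffian homogeneous_det_skew_at)

definition pfaffian_at :: "(nat \<Rightarrow> nat) \<Rightarrow> nat \<Rightarrow> (nat \<times> nat, 'k::field_char_0) mpoly" where
  "pfaffian_at e s = subst (\<lambda>(i, j). skew_entry (e i) (e j)) (pfaffian s)"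

lemma pfaffian_at_square: "pfaffian_at e s ^ 2 = det (skew_at e (2 * s))"
proof -
  have eq: "pfaffian_at e s = subst (\<lambda>(i, j). skew_at e (2 * s) $$ (i, j)) (pfaffian s)"
    unfolding pfaffian_at_def
    by (rule subst_cong[OF pfaffian(1)]) (auto simp: skew_at_def)
  show ?thesis unfolding eq by (rule subst_sqrt_det[OF pfaffian(2) skew_mat_skew_at])
qed

lemma homogeneous_pfaffian_at: "homogeneous s (pfaffian_at e s)"
  by (rule homogeneous_sqrt) (simp add: pfaffian_at_square homogeneous_det_skew_at)

lemma carrier_pfaffian_at:
  assumes "\<And>i. i < 2 * s \<Longrightarrow> e i < r"
  shows "pfaffian_at e s \<in> carrier (mpoly_ring (skew_vars r))"
  unfolding pfaffian_at_def
  by (rule carrier_subst[OF pfaffian(1)]) (auto intro!: carrier_skew_entry assms)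

lemma pfaffian_at_nonzero:
  assumes e: "strict_mono_on {..<2 * s} e"
  shows "pfaffian_at e s \<noteq> (0 :: (nat \<times> nat, 'k::field_char_0) mpoly)"
proof
  assume 0: "pfaffian_at e s = (0 :: (nat \<times> nat, 'k) mpoly)"
  let ?d = "the_inv_into {..<2 * s} e"
  have d: "?d (e i) = i" if "i < 2 * s" for i
    using strict_mono_on_imp_inj_on[OF e] that by (intro the_inv_into_f_f) auto
  have "subst (\<lambda>(a, b). skew_entry (?d a) (?d b)) (pfaffian_at e s) = subst indet (pfaffian s :: (nat \<times> nat, 'k) mpoly)"
    unfolding pfaffian_at_def subst_subst
  proof (rule subst_cong[OF pfaffian(1)])
    fix v assume "v \<in> skew_vars (2 * s)"
    then obtain i j where v: "v = (i, j)" "i < j" "j < 2 * s" by (cases v) auto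
    then have "e i < e j" using e by (auto simp: strict_mono_on_def)
    then show "subst (\<lambda>(a, b). skew_entry (?d a) (?d b)) (case v of (i, j) \<Rightarrow> skew_entry (e i) (e j)) =
        (indet v :: (nat \<times> nat, 'k) mpoly)"
      using v d by (simp add: skew_entry_def)
  qed
  then show False using 0 pfaffian(3)[of s, where 'k = 'k] by simp
qed

subsection \<open>Vanishing in bounded rank\<close>

lemma rank_subst_skew_entry:
  "rank_subst k (skew_entry a b) = (\<Sum>i<k. indet (2 * i, a) * indet (2 * i + 1, b) - indet (2 * i, b) * indet (2 * i + 1, a))"
  by (cases a b rule: linorder_cases)
     (auto simp: skew_entry_def rank_entry_def subst.hom_uminus sum_negf[symmetric] mult.commute intro!: sum.cong)

lemma sum_pairs: "(\<Sum>c<2 * k. g c) = (\<Sum>i<k. g (2 * i) + g (2 * i + 1))" for g :: "nat \<Rightarrow> 'a::comm_monoid_add"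
  by (induction k) (simp_all add: add.assoc)

lemma det_zero_column:
  assumes "A \<in> carrier_mat n n" "c < n" "\<And>i. i < n \<Longrightarrow> A $$ (i, c) = 0"
  shows "det A = (0 :: 'a::comm_ring_1)"
  unfolding det_def'[OF assms(1)]
proof (rule sum.neutral, rule ballI)
  fix p assume "p \<in> {p. p permutes {0..<n}}"
  then have p: "p permutes {0..<n}" by simp
  then obtain i where "i \<in> {0..<n}" "p i = c"
    using permutes_image[OF p] assms(2) by (metis atLeast0LessThan imageE lessThan_iff)
  then have "(\<Prod>i = 0..<n. A $$ (i, p i)) = 0"
    using assms(3)[of i] by (intro prod_zero[OF finite_atLeastLessThan] bexI[of _ i]) auto
  then show "signof p * (\<Prod>i = 0..<n. A $$ (i, p i)) = 0" by simp
qed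

text \<open>The substituted matrix factors through \<open>2 * k\<close> columns. Padding the factors
  to square matrices makes the determinant multiplicative, and the last column of \<open>X\<close>
  is zero.\<close>

lemma rank_subst_det:
  assumes "2 * k < n"
  shows "rank_subst k (det (skew_at e n)) = (0 :: (nat \<times> nat, 'k::comm_ring_1) mpoly)"
proof -
  define X :: "(nat \<times> nat, 'k) mpoly mat" where
    "X = mat n n (\<lambda>(a, c). if c < 2 * k then indet (c, e a) else 0)"
  \<comment> \<open>Column \<open>2 * i\<close> of \<open>X\<close> holds the vector
    \<open>u_i\<close> and has to meet \<open>v_i\<close>; column \<open>2 * i + 1\<close> holds
    \<open>v_i\<close> and has to meet \<open>- u_i\<close>.\<close>
  define Y :: "(nat \<times> nat, 'k) mpoly mat" where
    "Y = mat n n (\<lambda>(c, b). if even c then indet (c + 1, e b) else - indet (c - 1, e b))"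
  have "map_mat (rank_subst k) (skew_at e n) = X * Y"
  proof (rule eq_matI)
    fix a b assume "a < dim_row (X * Y)" "b < dim_col (X * Y)"
    then have ab: "a < n" "b < n" by (simp_all add: X_def Y_def)
    have "(X * Y) $$ (a, b) = (\<Sum>c = 0..<n. X $$ (a, c) * Y $$ (c, b))"
      using ab by (simp add: X_def Y_def scalar_prod_def)
    also have "\<dots> = (\<Sum>c<2 * k. X $$ (a, c) * Y $$ (c, b))"
      using assms ab by (intro sum.mono_neutral_right) (auto simp: X_def)
    also have "\<dots> = (\<Sum>i<k. indet (2 * i, e a) * indet (2 * i + 1, e b) - indet (2 * i, e b) * indet (2 * i + 1, e a))"
      unfolding sum_pairs using assms ab by (intro sum.cong refl) (simp add: X_def Y_def mult.commute)
    finally show "map_mat (rank_subst k) (skew_at e n) $$ (a, b) = (X * Y) $$ (a, b)"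
      using ab by (simp add: skew_at_def rank_subst_skew_entry)
  qed (simp_all add: X_def Y_def skew_at_def)
  then have "rank_subst k (det (skew_at e n)) = det (X * Y)"
    by (simp only: subst.hom_det[symmetric])
  also have "\<dots> = det X * det Y" by (rule det_mult[of _ n]) (simp_all add: X_def Y_def)
  also have "det X = 0"
    by (rule det_zero_column[of _ n "n - 1"]) (use assms in \<open>auto simp: X_def\<close>)
  finally show ?thesis by simp
qed

lemma rank_subst_pfaffian_at:
  "k < s \<Longrightarrow> rank_subst k (pfaffian_at e s) = (0 :: (nat \<times> nat, 'k::field_char_0) mpoly)"
proof -
  assume "k < s"
  then have "rank_subst k (pfaffian_at e s ^ 2) = (0 :: (nat \<times> nat, 'k) mpoly)"
    unfolding pfaffian_at_square by (intro rank_subst_det) simp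
  then show ?thesis by (simp add: subst.hom_power)
qed

subsection \<open>Leading monomials of Pfaffians\<close>

text \<open>In a chain of nested intervals every left endpoint precedes every right endpoint, so a
  chain of \<open>s\<close> variables uses \<open>2 * s\<close> distinct indices.\<close>

lemma nest_chain_endpoints:
  assumes C: "nest.chain C" "\<And>v. v \<in> C \<Longrightarrow> fst v < snd v"
  shows "inj_on fst C" "inj_on snd C" "fst ` C \<inter> snd ` C = {}"
proof -
  have cmp: "v = w \<or> nests v w \<or> nests w v" if "v \<in> C" "w \<in> C" for v w
    using C(1) that unfolding nest.chain_def by blast
  show "inj_on fst C" using cmp by (fastforce simp: inj_on_def nests_def)
  show "inj_on snd C" using cmp by (fastforce simp: inj_on_def nests_def)
  have "fst v < snd w" if vw: "v \<in> C" "w \<in> C" for v w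
    using cmp[OF vw] C(2)[OF vw(1)] C(2)[OF vw(2)] by (auto simp: nests_def)
  then show "fst ` C \<inter> snd ` C = {}" by fastforce
qed

lemma card_nest_chain:
  assumes C: "nest.chain C" "\<And>v. v \<in> C \<Longrightarrow> fst v < snd v"
    and sub: "\<And>v. v \<in> C \<Longrightarrow> l \<le> fst v \<and> snd v < u"
  shows "2 * card C \<le> u - l"
proof -
  note ends = nest_chain_endpoints[OF C]
  have incl: "fst ` C \<union> snd ` C \<subseteq> {l..<u}"
    using sub C(2) by fastforce
  then have fin: "finite (fst ` C)" "finite (snd ` C)" using finite_subset by blast+
  have "card (fst ` C \<union> snd ` C) = 2 * card C"
    using card_Un_disjoint[OF fin ends(3)] ends(1,2) by (simp add: card_image)
  then show ?thesis using card_mono[OF _ incl] by simp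
qed

text \<open>For \<open>v\<close> in \<open>T\<close> let \<open>o\<close> and \<open>i\<close> count
  the members outside and inside it. Then \<open>o\<close> is at most \<open>fst v\<close> and at
  most \<open>2 * s - 1 - snd v\<close>, and \<open>2 * i\<close> is at most
  \<open>snd v - fst v - 1\<close>. These bounds add up to \<open>2 * s - 2 = 2 * (o + i)\<close>,
  so all are equalities.\<close>

lemma full_nest_chain:
  assumes T: "T \<subseteq> skew_vars (2 * s)" "nest.chain T" "card T = s"
  shows "T = (\<lambda>i. (i, 2 * s - 1 - i)) ` {..<s}"
proof -
  have finT: "finite T" using T(1) finite_skew_vars finite_subset by blast
  have lt: "fst v < snd v" "snd v < 2 * s" if "v \<in> T" for v using T(1) that by (cases v; auto)+
  have cmp: "v = w \<or> nests v w \<or> nests w v" if "v \<in> T" "w \<in> T" for v w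
    using T(2) that unfolding nest.chain_def by blast
  have snd_eq: "snd v = 2 * s - 1 - fst v" if v: "v \<in> T" for v
  proof -
    let ?O = "{w\<in>T. nests w v}" and ?I = "{w\<in>T. nests v w}"
    have chO: "nest.chain ?O" and chI: "nest.chain ?I"
      using T(2) by (rule nest.chain_subset, blast)+
    note O = nest_chain_endpoints[OF chO]
    have "T = insert v (?O \<union> ?I)" using cmp v by blast
    then have "s = card (insert v (?O \<union> ?I))" using T(3) by simp
    also have "\<dots> = Suc (card ?O + card ?I)"
    proof -
      have "?O \<inter> ?I = {}" by (auto simp: nests_def)
      moreover have "v \<notin> ?O \<union> ?I" by (auto simp: nests_def)
      ultimately show ?thesis using finT by (simp add: card_Un_disjoint)
    qed
    finally have s: "s = Suc (card ?O + card ?I)" .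
    have "card ?O = card (fst ` ?O)" using O(1) lt by (simp add: card_image)
    also have "\<dots> \<le> card {..<fst v}" by (intro card_mono) (auto simp: nests_def)
    finally have 1: "card ?O \<le> fst v" by simp
    have "card ?O = card (snd ` ?O)" using O(2) lt by (simp add: card_image)
    also have "\<dots> \<le> card {snd v<..<2 * s}" using lt by (intro card_mono) (auto simp: nests_def)
    finally have 2: "card ?O \<le> 2 * s - 1 - snd v" by simp
    have 3: "2 * card ?I \<le> snd v - Suc (fst v)"
      by (rule card_nest_chain[OF chI]) (use lt in \<open>auto simp: nests_def\<close>)
    show ?thesis using s 1 2 3 lt[OF v] by linarith
  qed
  have "T \<subseteq> (\<lambda>i. (i, 2 * s - 1 - i)) ` {..<s}"
  proof
    fix v assume v: "v \<in> T"
    then have "fst v < s" using snd_eq[OF v] lt[OF v] by linarith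
    then show "v \<in> (\<lambda>i. (i, 2 * s - 1 - i)) ` {..<s}"
      using snd_eq[OF v] by (intro image_eqI[of _ _ "fst v"]) (auto simp: prod_eq_iff)
  qed
  moreover have "card ((\<lambda>i. (i, 2 * s - 1 - i)) ` {..<s}) = s"
    by (subst card_image) (auto simp: inj_on_def)
  ultimately show ?thesis using T(3) by (intro card_subset_eq) auto
qed

definition nest_set :: "(nat \<Rightarrow> nat) \<Rightarrow> nat \<Rightarrow> (nat \<times> nat) set" where
  "nest_set e s = (\<lambda>i. (e i, e (2 * s - 1 - i))) ` {..<s}"

lemma full_nest_chain_image:
  assumes e: "strict_mono_on {..<2 * s} e"
    and C: "C \<subseteq> {(e i, e j) | i j. i < j \<and> j < 2 * s}" "nest.chain C" "card C = s"
  shows "C = nest_set e s"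
proof -
  define T where "T = {(i, j). i < j \<and> j < 2 * s \<and> (e i, e j) \<in> C}"
  have less: "e i < e j \<longleftrightarrow> i < j" if "i < 2 * s" "j < 2 * s" for i j
    using strict_mono_on_less[OF e] that by simp
  have C_T: "C = map_prod e e ` T" using C(1) by (force simp: T_def)
  have "T \<subseteq> {..<2 * s} \<times> {..<2 * s}" by (auto simp: T_def)
  then have "inj_on (map_prod e e) T"
    using map_prod_inj_on[OF strict_mono_on_imp_inj_on[OF e] strict_mono_on_imp_inj_on[OF e]] inj_on_subset by blast
  then have "card T = s" using C(3) C_T by (simp add: card_image)
  moreover have "nest.chain T"
    unfolding nest.chain_def
  proof (intro ballI)
    fix v w assume vw: "v \<in> T" "w \<in> T"
    obtain i j k l where ij: "v = (i, j)" "w = (k, l)" by (cases v, cases w)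
    have b: "i < j" "j < 2 * s" "k < l" "l < 2 * s" "(e i, e j) \<in> C" "(e k, e l) \<in> C"
      using vw by (auto simp: T_def ij)
    then have cmp: "(e i, e j) = (e k, e l) \<or> nests (e i, e j) (e k, e l) \<or> nests (e k, e l) (e i, e j)"
      using C(2) unfolding nest.chain_def by blast
    show "v = w \<or> nests v w \<or> nests w v"
    proof -
      have "i < 2 * s" "k < 2 * s" using b by auto
      then have lk: "e i < e k \<longleftrightarrow> i < k" "e k < e i \<longleftrightarrow> k < i" "e j < e l \<longleftrightarrow> j < l" "e l < e j \<longleftrightarrow> l < j"
        using b by (simp_all add: less)
      have "e i = e k \<Longrightarrow> i = k" "e j = e l \<Longrightarrow> j = l" using lk by (metis linorder_neqE_nat less_irrefl)+
      then show ?thesis using cmp by (auto simp: ij nests_def lk)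
    qed
  qed
  ultimately have "T = (\<lambda>i. (i, 2 * s - 1 - i)) ` {..<s}"
    by (intro full_nest_chain) (auto simp: T_def)
  then show ?thesis by (simp add: C_T nest_set_def image_image)
qed

text \<open>Listing the endpoints in increasing order by \<open>pick\<close> transports the chain to
  \<open>2 * s\<close> indices, where a full chain is unique.\<close>

lemma nest_chain_enumeration:
  assumes C: "C \<subseteq> skew_vars r" "nest.chain C" "card C = s"
  obtains e where "strict_mono_on {..<2 * s} e" "\<And>i. i < 2 * s \<Longrightarrow> e i < r" "C = nest_set e s"
proof -
  have finC: "finite C" using C(1) finite_skew_vars finite_subset by blast
  have lt: "fst v < snd v" "snd v < r" if "v \<in> C" for v using C(1) that by (cases v; auto)+
  note ends = nest_chain_endpoints[OF C(2) lt(1)]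
  define E where "E = fst ` C \<union> snd ` C"
  have card: "card E = 2 * s"
    unfolding E_def using finC ends C(3) by (subst card_Un_disjoint) (auto simp: card_image)
  let ?e = "pick E"
  have mono: "strict_mono_on {..<2 * s} ?e"
    using pick_mono_le[of _ E] card by (auto simp: strict_mono_on_def)
  have surj: "\<exists>i<2 * s. ?e i = a" if "a \<in> E" for a
  proof (intro exI conjI)
    show "?e (card {x\<in>E. x < a}) = a" using that by (rule pick_card_in_set)
    have "finite E" using finC by (simp add: E_def)
    then have "card {x\<in>E. x < a} < card E" using that by (intro psubset_card_mono) auto
    then show "card {x\<in>E. x < a} < 2 * s" by (simp add: card)
  qed
  show ?thesis
  proof (rule that[OF mono])
    fix i assume "i < 2 * s"
    then have "?e i \<in> E" using pick_in_set_le card by simp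
    then show "?e i < r" using lt by (fastforce simp: E_def)
  next
    have "C \<subseteq> {(?e i, ?e j) | i j. i < j \<and> j < 2 * s}"
    proof
      fix v assume v: "v \<in> C"
      then obtain i j where ij: "i < 2 * s" "?e i = fst v" "j < 2 * s" "?e j = snd v"
        using surj[of "fst v"] surj[of "snd v"] by (auto simp: E_def)
      then have "i < j" using lt(1)[OF v] strict_mono_on_less[OF mono, of i j] by simp
      then show "v \<in> {(?e i, ?e j) | i j. i < j \<and> j < 2 * s}"
        using ij by (intro CollectI exI[of _ i] exI[of _ j]) (simp add: prod_eq_iff)
    qed
    then show "C = nest_set ?e s" by (rule full_nest_chain_image[OF mono _ C(2,3)])
  qed
qed

lemma squarefree_exponent:
  assumes m: "total_degree m = s" and C: "C \<subseteq> keys m" "card C \<ge> s"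
  shows "keys m = C" "\<And>v. v \<in> C \<Longrightarrow> lookup m v = 1"
proof -
  have pos: "1 \<le> lookup m v" if "v \<in> keys m" for v using in_keysD[OF that] by simp
  have finC: "finite C" by (rule finite_subset[OF C(1) finite_keys])
  have split: "total_degree m = (\<Sum>v\<in>C. lookup m v) + (\<Sum>v\<in>keys m - C. lookup m v)"
    unfolding total_degree_def by (subst sum.subset_diff[OF C(1)]) (simp_all add: add.commute)
  have cC: "card C \<le> (\<Sum>v\<in>C. lookup m v)"
    using sum_mono[of C "\<lambda>_. 1" "lookup m"] pos subsetD[OF C(1)] by simp
  have "(\<Sum>v\<in>keys m - C. lookup m v) = 0" using split cC m C(2) by linarith
  then have "\<forall>v\<in>keys m - C. lookup m v = 0" by simp
  then have "v \<in> C" if "v \<in> keys m" for v using in_keysD[OF that] that by blast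
  then show "keys m = C" using C(1) by blast
  have eq: "(\<Sum>v\<in>C. lookup m v) = card C" using split cC m C(2) by linarith
  show "lookup m v = 1" if v: "v \<in> C" for v
  proof (rule ccontr)
    assume "lookup m v \<noteq> 1"
    then have "1 < lookup m v" using pos[of v] v C(1) by force
    then have "(\<Sum>v\<in>C. 1) < (\<Sum>v\<in>C. lookup m v)"
      using finC pos subsetD[OF C(1)] v by (intro sum_strict_mono_ex1) auto
    then show False using eq by simp
  qed
qed

text \<open>Vanishing in lower rank yields at least \<open>s\<close> nested variables, and degree
  \<open>s\<close> leaves room for exactly these, each to the first power. Uniqueness of the full
  chain identifies them.\<close>

lemma pfaffian_at_leading:
  assumes e: "strict_mono_on {..<2 * s} e" and er: "\<And>i. i < 2 * s \<Longrightarrow> e i < r"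
  obtains m where "skew.leading (pfaffian_at e s :: (nat \<times> nat, 'k::field_char_0) mpoly) m"
    "keys m = nest_set e s" "\<And>v. v \<in> nest_set e s \<Longrightarrow> lookup m v = 1"
proof -
  let ?f = "pfaffian_at e s :: (nat \<times> nat, 'k) mpoly"
  obtain m where m: "skew.leading ?f m" using skew.ex_leading[OF pfaffian_at_nonzero[OF e]] by blast
  then have mf: "m \<in> keys ?f" by (simp add: is_leading_monomial_def)
  then have deg: "total_degree m = s" using homogeneous_pfaffian_at unfolding homogeneous_def by blast
  have less: "e i < e j" if "i < j" "j < 2 * s" for i j
    using strict_mono_onD[OF e, of i j] that by simp
  let ?W = "{(e i, e j) | i j. i < j \<and> j < 2 * s}"
  have "?f \<in> carrier (mpoly_ring ?W)"
    unfolding pfaffian_at_def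
  proof (rule carrier_subst[OF pfaffian(1)])
    fix v assume "v \<in> skew_vars (2 * s)"
    then obtain i j where v: "v = (i, j)" "i < j" "j < 2 * s" by (cases v) auto
    then have "(e i, e j) \<in> ?W" by blast
    then show "(case v of (i, j) \<Rightarrow> skew_entry (e i) (e j)) \<in> carrier (mpoly_ring ?W :: (nat \<times> nat, 'k) mpoly ring)"
      using v less[of i j] by (simp add: skew_entry_def carrier_indet)
  qed
  then have W: "keys m \<subseteq> ?W" using mf by (auto simp: carrier_mpoly)
  obtain C where C: "C \<subseteq> keys m" "nest.chain C" "s \<le> card C"
  \<comment> \<open>For \<open>s = 0\<close> the truncated \<open>s - 1\<close> gives no smaller
    number of summands, but the empty chain suffices.\<close>
  proof (cases "s = 0")
    case True
    then show ?thesis using that[of "{}"] by (simp add: nest.chain_def)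
  next
    case False
    then have "rank_subst (s - 1) ?f = 0" by (intro rank_subst_pfaffian_at) simp
    then have "\<not> nest.chains_le (s - 1) (keys m)"
      using rank_subst_nonzero[OF carrier_pfaffian_at[OF er] m] by blast
    then obtain C where "C \<subseteq> keys m" "nest.chain C" "\<not> card C \<le> s - 1"
      unfolding nest.chains_le_def by blast
    then show ?thesis using that[of C] by simp
  qed
  note eq = squarefree_exponent[OF deg C(1,3)]
  have "card C = s"
  proof -
    have "total_degree m = (\<Sum>v\<in>C. 1)" unfolding total_degree_def eq(1) using eq(2) by (intro sum.cong) auto
    then show ?thesis using deg by simp
  qed
  then have "C = nest_set e s" using full_nest_chain_image[OF e _ C(2)] W C(1) by blast
  then show ?thesis using that[OF m] eq by blast
qed

subsection \<open>The ideal of Pfaffians\<close>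

definition rank_ideal :: "nat \<Rightarrow> nat \<Rightarrow> (nat \<times> nat, 'k::comm_ring_1) mpoly set" where
  "rank_ideal r k = {f \<in> carrier (mpoly_ring (skew_vars r)). rank_subst k f = 0}"

lemma primeideal_rank_ideal:
  "primeideal (rank_ideal r k :: (nat \<times> nat, 'k::idom) mpoly set) (mpoly_ring (skew_vars r))"
proof (rule primeideal_mpolyI)
  show "ideal (rank_ideal r k :: (nat \<times> nat, 'k) mpoly set) (mpoly_ring (skew_vars r))"
    by (rule ideal_mpolyI)
       (auto simp: rank_ideal_def subst.hom_add subst.hom_mult intro: carrier_add carrier_mult)
qed (auto simp: rank_ideal_def subst.hom_mult)

lemma submatrix_generic_skew_mat:
  assumes A: "A \<subseteq> {..<r}"
  shows "submatrix (generic_skew_mat r) A A = skew_at (pick A) (card A)"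
proof -
  have eq: "{i. i < r \<and> i \<in> A} = A" using A by auto
  have pick_r: "pick A i < r" if "i < card A" for i
    using pick_in_set_le[OF that] A by auto
  show ?thesis
    unfolding submatrix_def
    by (rule eq_matI) (simp_all add: skew_at_def generic_skew_mat_def eq pick_r skew_entry_def)
qed

lemma pfaffian_ideal_subset:
  assumes "1 \<le> t"
  shows "pfaffian_ideal r t \<subseteq> (rank_ideal r (t - 1) :: (nat \<times> nat, 'k::field_char_0) mpoly set)"
  unfolding pfaffian_ideal_def
proof (rule mpoly.genideal_minimal[OF primeideal_mpolyD(1)[OF primeideal_rank_ideal]], rule subsetI)
  fix f :: "(nat \<times> nat, 'k) mpoly" assume "f \<in> pfaffians r t"
  then obtain A where f: "f \<in> carrier (mpoly_ring (skew_vars r))" and A: "A \<subseteq> {..<r}" "card A = 2 * t"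
    "f ^ 2 = det (submatrix (generic_skew_mat r) A A)" by (auto simp: pfaffians_def)
  have "rank_subst (t - 1) (f ^ 2) = 0"
    unfolding A(3) submatrix_generic_skew_mat[OF A(1)] A(2) using assms by (intro rank_subst_det) simp
  then show "f \<in> rank_ideal r (t - 1)" using f by (simp add: rank_ideal_def subst.hom_power)
qed

lemma pfaffian_at_mem_pfaffians:
  assumes e: "strict_mono_on {..<2 * t} e" and er: "\<And>i. i < 2 * t \<Longrightarrow> e i < r"
  shows "pfaffian_at e t \<in> (pfaffians r t :: (nat \<times> nat, 'k::field_char_0) mpoly set)"
proof -
  let ?A = "e ` {..<2 * t}"
  have inj: "inj_on e {..<2 * t}" by (rule strict_mono_on_imp_inj_on[OF e])
  have A: "?A \<subseteq> {..<r}" "card ?A = 2 * t" using er inj by (auto simp: card_image)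
  have "pick ?A i = e i" if i: "i < 2 * t" for i
  proof -
    have "{x\<in>?A. x < e i} = e ` {..<i}"
      using i strict_mono_on_less[OF e] by force
    then have "card {x\<in>?A. x < e i} = i"
      using inj_on_subset[OF inj, of "{..<i}"] i by (simp add: card_image)
    then show ?thesis using pick_card_in_set[of "e i" ?A] i by simp
  qed
  then have "skew_at (pick ?A) (2 * t) = (skew_at e (2 * t) :: (nat \<times> nat, 'k) mpoly mat)"
    by (intro eq_matI) (simp_all add: skew_at_def)
  then have "(pfaffian_at e t :: (nat \<times> nat, 'k) mpoly) ^ 2 = det (submatrix (generic_skew_mat r) ?A ?A)"
    unfolding submatrix_generic_skew_mat[OF A(1)] A(2) by (simp add: pfaffian_at_square)
  then show ?thesis
    unfolding pfaffians_def
    by (intro CollectI conjI exI[of _ ?A] carrier_pfaffian_at er A)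
qed

text \<open>With finitely many variables, exponents become lists of the common length
  \<open>r * r\<close>, compared by \<open>lex less_than\<close>. This provides termination of the
  division in \<open>pfaffian_ideal_eq\<close>.\<close>

lemma wf_lex_skew:
  "wf {(m, m'). keys m \<subseteq> skew_vars r \<and> keys m' \<subseteq> skew_vars r \<and> skew.lt m m'}" (is "wf ?R")
proof -
  \<comment> \<open>\<open>dec\<close> lists the variables in decreasing order, interspersed with pairs that are no variables\<close>
  define dec where "dec n = (n div r, r - 1 - n mod r)" for n
  define L where "L m = map (\<lambda>n. lookup m (dec n)) [0..<r * r]" for m :: "nat \<times> nat \<Rightarrow>\<^sub>0 nat"
  have "(L m, L m') \<in> lex less_than" if R: "(m, m') \<in> ?R" for m m'
  proof -
    obtain v where v: "lookup m v < lookup m' v" "\<And>w. skew_var_greater w v \<Longrightarrow> lookup m w = lookup m' w"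
      and V: "keys m' \<subseteq> skew_vars r" using R unfolding lex_less_def by blast
    obtain i j where ij: "v = (i, j)" by (cases v)
    have "v \<in> keys m'" using v(1) by (simp add: Poly_Mapping.in_keys_iff)
    then have "i < j" "j < r" using V by (auto simp: ij)
    \<comment> \<open>The position of \<open>(i, j)\<close> in the list: rows upwards, and columns
      downwards within a row.\<close>
    define n where "n = i * r + (r - 1 - j)"
    have jr: "r - 1 - j < r" using \<open>j < r\<close> by simp
    have n_div: "n div r = i" "n mod r = r - 1 - j" using jr by (simp_all add: n_def)
    then have dec_n: "dec n = v" using \<open>j < r\<close> by (simp add: dec_def ij)
    have "Suc i * r \<le> r * r" using \<open>i < j\<close> \<open>j < r\<close> by (intro mult_right_mono) auto
    then have n_r: "n < r * r" using jr by (simp add: n_def)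
    have less: "skew_var_greater (dec n') v" if "n' < n" for n'
    proof -
      have le: "n' div r \<le> i" using that div_le_mono[of n' n r] n_div by simp
      show ?thesis
      proof (cases "n' div r = i")
        case True
        then have "n' mod r < n mod r"
          using that div_mult_mod_eq[of n' r] div_mult_mod_eq[of n r] n_div(1) by (metis nat_add_left_cancel_less)
        then show ?thesis using True n_div \<open>j < r\<close> by (simp add: dec_def ij skew_var_greater_def)
      next
        case False
        then show ?thesis using le by (simp add: dec_def ij skew_var_greater_def)
      qed
    qed
    have len: "length (L p) = r * r" for p by (simp add: L_def)
    have "take n (L m) = take n (L m')"
      using n_r v(2)[OF less] by (intro nth_equalityI) (simp_all add: L_def)
    then have "L m = take n (L m) @ L m ! n # drop (Suc n) (L m)"
      "L m' = take n (L m) @ L m' ! n # drop (Suc n) (L m')"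
      using id_take_nth_drop[of n "L m"] id_take_nth_drop[of n "L m'"] n_r by (simp_all only: len)
    moreover have "(L m ! n, L m' ! n) \<in> less_than" using n_r v(1) by (simp add: L_def dec_n)
    ultimately have "\<exists>xys x y xs' ys'. L m = xys @ x # xs' \<and> L m' = xys @ y # ys' \<and> (x, y) \<in> less_than"
      by blast
    then show ?thesis unfolding lex_conv by (intro CollectI case_prodI conjI) (simp only: len)
  qed
  then have "?R \<subseteq> inv_image (lex less_than) L" by (auto simp: inv_image_def)
  then show ?thesis by (rule wf_subset[OF wf_inv_image[OF wf_lex[OF wf_less_than]]])
qed

lemma exponent_diff_add:
  assumes "\<And>v. v \<in> C \<Longrightarrow> lookup e v \<le> lookup m v" "keys e = C"
  shows "m = (m - e) + (e :: 'x \<Rightarrow>\<^sub>0 nat)"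
proof (rule poly_mapping_eqI)
  fix v
  have "lookup e v \<le> lookup m v"
    using assms(1)[of v] assms(2) by (cases "v \<in> C") (auto simp: Poly_Mapping.in_keys_iff)
  then show "lookup m v = lookup ((m - e) + e) v" by (simp add: lookup_add lookup_minus)
qed

text \<open>Division with remainder: the leading monomial of an element of the kernel contains a
  \<open>t\<close>-chain, hence is a multiple of the squarefree leading monomial of a Pfaffian.
  Subtracting a multiple of this Pfaffian stays in the kernel and lowers the leading
  monomial.\<close>

theorem pfaffian_ideal_eq:
  assumes "1 \<le> t"
  shows "pfaffian_ideal r t = (rank_ideal r (t - 1) :: (nat \<times> nat, 'k::field_char_0) mpoly set)"
proof
  let ?P = "pfaffian_ideal r t :: (nat \<times> nat, 'k) mpoly set"
  let ?V = "skew_vars r"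
  have G: "(pfaffians r t :: (nat \<times> nat, 'k) mpoly set) \<subseteq> carrier (mpoly_ring ?V)" by (auto simp: pfaffians_def)
  have P: "ideal ?P (mpoly_ring ?V)" unfolding pfaffian_ideal_def by (rule mpoly.genideal_ideal[OF G])
  have reduce: "f \<in> ?P" if "skew.leading f m" "f \<in> rank_ideal r (t - 1)" for f m
    using that
  proof (induction m arbitrary: f rule: wf_induct_rule[OF wf_lex_skew[of r]])
    case (1 m)
    have f: "f \<in> carrier (mpoly_ring ?V)" "rank_subst (t - 1) f = 0" using 1(3) by (auto simp: rank_ideal_def)
    have mf: "m \<in> keys f" "\<And>m'. m' \<in> keys f \<Longrightarrow> m' = m \<or> skew.lt m' m"
      using 1(2) by (auto simp: is_leading_monomial_def)
    have mV: "keys m \<subseteq> ?V" using f(1) mf(1) by (auto simp: carrier_mpoly)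
    have "\<not> nest.chains_le (t - 1) (keys m)" using rank_subst_nonzero[OF f(1) 1(2)] f(2) by blast
    then obtain C' where C': "C' \<subseteq> keys m" "nest.chain C'" "\<not> card C' \<le> t - 1"
      unfolding nest.chains_le_def by blast
    have "t \<le> card C'" using C'(3) by simp
    then obtain C where C: "C \<subseteq> C'" "card C = t" by (rule obtain_subset_with_card_n)
    have C_chain: "nest.chain C" using C'(2) C(1) by (rule nest.chain_subset)
    obtain e where e: "strict_mono_on {..<2 * t} e" "\<And>i. i < 2 * t \<Longrightarrow> e i < r" "C = nest_set e t"
      using nest_chain_enumeration[of C r t] C_chain C C'(1) mV by blast
    let ?g = "pfaffian_at e t :: (nat \<times> nat, 'k) mpoly"
    obtain n where n: "skew.leading ?g n" "keys n = C" "\<And>v. v \<in> C \<Longrightarrow> lookup n v = 1"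
      using pfaffian_at_leading[OF e(1,2), where 'k = 'k] e(3) by blast
    have g: "?g \<in> ?P" "?g \<in> rank_ideal r (t - 1)"
    proof -
      have "?g \<in> pfaffians r t" by (rule pfaffian_at_mem_pfaffians[OF e(1,2)])
      then show "?g \<in> ?P" unfolding pfaffian_ideal_def using mpoly.genideal_self[OF G] by blast
      then show "?g \<in> rank_ideal r (t - 1)" using pfaffian_ideal_subset[OF assms] by blast
    qed
    have m: "m = (m - n) + n"
    proof (rule exponent_diff_add[OF _ n(2)])
      fix v assume "v \<in> C"
      then have "v \<in> keys m" using C(1) C'(1) by blast
      then show "lookup n v \<le> lookup m v" using n(3)[OF \<open>v \<in> C\<close>] in_keysD[of v m] by simp
    qed
    define c where "c = lookup f m / lookup ?g n"
    have lc: "lookup f m \<noteq> 0" "lookup ?g n \<noteq> 0"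
      using mf(1) n(1) by (auto simp: is_leading_monomial_def)
    define h where "h = single (m - n) c * ?g"
    have c0: "c \<noteq> 0" using lc by (simp add: c_def)
    have h_lead: "skew.leading h m" "lookup h m = lookup f m"
      using skew.leading_mult[OF skew.leading_single[OF c0, of "m - n"] n(1)] m lc
      by (simp_all add: h_def c_def)
    have "keys (m - n) \<subseteq> keys m" by (auto simp: Poly_Mapping.in_keys_iff lookup_minus)
    then have mnV: "keys (m - n) \<subseteq> ?V" using mV by blast
    have h: "h \<in> ?P" "h \<in> rank_ideal r (t - 1)"
      unfolding h_def
      using ideal_mpolyD(4)[OF P g(1)] ideal_mpolyD(4)[OF primeideal_mpolyD(1)[OF primeideal_rank_ideal] g(2)]
        carrier_singleI[OF mnV] by blast+
    have fh: "f - h \<in> rank_ideal r (t - 1)"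
      using 1(3) h(2) by (auto simp: rank_ideal_def subst.hom_minus intro: carrier_diff)
    have "f - h \<in> ?P"
    proof (cases "f - h = 0")
      case True
      then show ?thesis using ideal_mpolyD(2)[OF P] by simp
    next
      case False
      then obtain m' where m': "skew.leading (f - h) m'" using skew.ex_leading by blast
      then have mem: "m' \<in> keys (f - h)" by (simp add: is_leading_monomial_def)
      then have "m' \<noteq> m" using h_lead(2) by (auto simp: Poly_Mapping.in_keys_iff lookup_minus)
      moreover have "m' \<in> keys f \<or> m' \<in> keys h"
        using mem by (auto simp: Poly_Mapping.in_keys_iff lookup_minus)
      ultimately have "skew.lt m' m" using mf(2) h_lead(1) by (auto simp: is_leading_monomial_def)
      moreover have "keys m' \<subseteq> ?V" using mem fh by (auto simp: rank_ideal_def carrier_mpoly)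
      ultimately show ?thesis using 1(1)[of m' "f - h"] m' fh mV by blast
    qed
    then have "(f - h) + h \<in> ?P" using ideal_mpolyD(3)[OF P] h(1) by blast
    then show ?case by simp
  qed
  show "rank_ideal r (t - 1) \<subseteq> ?P"
  proof
    fix f :: "(nat \<times> nat, 'k) mpoly" assume f: "f \<in> rank_ideal r (t - 1)"
    show "f \<in> ?P"
    proof (cases "f = 0")
      case True
      then show ?thesis using ideal_mpolyD(2)[OF P] by simp
    next
      case False
      then show ?thesis using skew.ex_leading[OF False] reduce[OF _ f] by blast
    qed
  qed
qed (rule pfaffian_ideal_subset[OF assms])

section \<open>Symbolic powers of Pfaffian ideals\<close>

lemma minimal_primes_prime: "primeideal P R \<Longrightarrow> minimal_primes R P = {P}"
  unfolding minimal_primes_def by blast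

lemma ideal_pow_antimono:
  assumes I: "ideal I (mpoly_ring V)" and "m \<le> n"
  shows "ideal_pow V I n \<subseteq> ideal_pow V I m"
proof -
  have "ideal_pow V I (Suc n) \<subseteq> ideal_pow V I n" for n
  proof
    fix f assume "f \<in> ideal_pow V I (Suc n)"
    then show "f \<in> ideal_pow V I n" unfolding ideal_pow_Suc
    proof (induction f rule: ideal_prod.induct)
      case (prod i j)
      then have "j * i \<in> ideal_pow V I n"
        using ideal_mpolyD(4)[OF ideal_ideal_pow[OF I]] ideal_mpolyD(1)[OF I] by blast
      then show ?case by (simp add: mult.commute)
    next
      case (sum s1 s2)
      then show ?case using ideal_mpolyD(3)[OF ideal_ideal_pow[OF I]] by simp
    qed
  qed
  then show ?thesis using assms(2) by (rule lift_Suc_antimono_le)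
qed

lemma ideal_pow_subset:
  assumes I: "ideal I (mpoly_ring V)" and "1 \<le> n"
  shows "ideal_pow V I n \<subseteq> I"
proof -
  have "ideal_pow V I (Suc 0) \<subseteq> I"
  proof
    fix f assume "f \<in> ideal_pow V I (Suc 0)"
    then show "f \<in> I" unfolding ideal_pow_Suc ideal_pow_0
    proof (induction f rule: ideal_prod.induct)
      case (prod i j)
      then show ?case using ideal_mpolyD(4)[OF I] by simp
    next
      case (sum s1 s2)
      then show ?case using ideal_mpolyD(3)[OF I] by simp
    qed
  qed
  then show ?thesis using ideal_pow_antimono[OF I, of "Suc 0" n] assms(2) by simp
qed

text \<open>By the product rule every term of the derivative keeps all but one of its factors in
  \<open>I\<close>.\<close>

lemma pdiff_ideal_pow:
  assumes I: "ideal I (mpoly_ring V)" and f: "f \<in> ideal_pow V I (Suc n)"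
  shows "pdiff v f \<in> ideal_pow V I n"
  using f
proof (induction n arbitrary: f)
  case 0
  then have "f \<in> carrier (mpoly_ring V)" using ideal_mpolyD(1)[OF ideal_ideal_pow[OF I]] by blast
  then show ?case by (simp add: ideal_pow_0 carrier_pdiff)
next
  case (Suc n)
  note J = ideal_mpolyD[OF ideal_ideal_pow[OF I, of "Suc n"]]
  from Suc.prems show ?case unfolding ideal_pow_Suc[of _ _ "Suc n"]
  proof (induction f rule: ideal_prod.induct)
    case (prod i j)
    have "pdiff v i \<otimes>\<^bsub>mpoly_ring V\<^esub> j \<in> ideal_pow V I (Suc n)"
      unfolding ideal_pow_Suc by (intro ideal_prod.prod Suc.IH prod)
    moreover have "pdiff v j * i \<in> ideal_pow V I (Suc n)"
      by (intro J(4) prod carrier_pdiff subsetD[OF ideal_mpolyD(1)[OF I]])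
    ultimately show ?case using J(3) by (simp add: pdiff_mult mult.commute)
  next
    case (sum s1 s2)
    then show ?case using J(3) by (simp add: pdiff_add)
  qed
qed

context
  fixes V :: "'x::linorder set" and P :: "('x, 'k::idom) mpoly set"
  assumes P: "primeideal P (mpoly_ring V)"
begin

lemma symbolic_power_prime_iff:
  "f \<in> symbolic_power (mpoly_ring V) P n \<longleftrightarrow> f \<in> carrier (mpoly_ring V) \<and>
    (\<exists>s \<in> carrier (mpoly_ring V) - P. s * f \<in> ideal_pow V P n)"
  using symbolic_power_iff[OF primeideal_mpolyD(1)[OF P]] minimal_primes_prime[OF P] by simp

lemma symbolic_power_antimono:
  assumes "m \<le> n"
  shows "symbolic_power (mpoly_ring V) P n \<subseteq> symbolic_power (mpoly_ring V) P m"
  unfolding subset_iff symbolic_power_prime_iff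
  using ideal_pow_antimono[OF primeideal_mpolyD(1)[OF P] assms] by blast

lemma symbolic_power_subset:
  assumes "1 \<le> n"
  shows "symbolic_power (mpoly_ring V) P n \<subseteq> P"
  unfolding subset_iff symbolic_power_prime_iff
  using ideal_pow_subset[OF primeideal_mpolyD(1)[OF P] assms] primeideal_mpolyD(3)[OF P] by blast

lemma symbolic_power_0: "symbolic_power (mpoly_ring V) P 0 = carrier (mpoly_ring V)"
proof -
  have "1 \<in> carrier (mpoly_ring V) - P" using primeideal_mpolyD(2)[OF P] by simp
  moreover have "1 * f \<in> ideal_pow V P 0" if "f \<in> carrier (mpoly_ring V)" for f
    using that by (simp add: ideal_pow_0)
  ultimately show ?thesis unfolding set_eq_iff symbolic_power_prime_iff by blast
qed

lemma ideal_symbolic_power_prime: "ideal (symbolic_power (mpoly_ring V) P n) (mpoly_ring V)"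
  by (rule ideal_symbolic_power[OF primeideal_mpolyD(1)[OF P]]) (simp add: minimal_primes_prime[OF P])

lemma symbolic_power_prod:
  assumes "finite J" "\<And>j. j \<in> J \<Longrightarrow> f j \<in> symbolic_power (mpoly_ring V) P (d j)"
  shows "prod f J \<in> symbolic_power (mpoly_ring V) P (sum d J)"
  using assms
proof (induction J)
  case empty
  then show ?case by (simp add: symbolic_power_0)
next
  case (insert j J)
  have "f j * prod f J \<in> symbolic_power (mpoly_ring V) P (d j + sum d J)"
    by (rule symbolic_power_mult[OF primeideal_mpolyD(1)[OF P]])
       (use insert in \<open>auto simp: minimal_primes_prime[OF P]\<close>)
  then show ?case using insert.hyps by simp
qed

text \<open>If \<open>s f\<close> lies in the \<open>(n + 1)\<close>-st power, then
  \<open>s\<^sup>2 \<partial>f = s \<partial>(s f) - (\<partial>s) s f\<close> lies in the \<open>n\<close>-th power.\<close>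

lemma pdiff_symbolic_power:
  assumes f: "f \<in> symbolic_power (mpoly_ring V) P (Suc n)"
  shows "pdiff v f \<in> symbolic_power (mpoly_ring V) P n"
proof -
  note I = primeideal_mpolyD(1)[OF P]
  note J = ideal_mpolyD[OF ideal_ideal_pow[OF I, of n]]
  obtain s where s: "s \<in> carrier (mpoly_ring V) - P" "s * f \<in> ideal_pow V P (Suc n)"
    and fC: "f \<in> carrier (mpoly_ring V)"
    using f symbolic_power_prime_iff by blast
  have "s * s \<in> carrier (mpoly_ring V) - \<Union>{P}"
    by (rule prime_complement_mult) (use P s in auto)
  moreover have "(s * s) * pdiff v f \<in> ideal_pow V P n"
  proof -
    have "s * f \<in> ideal_pow V P n" using s(2) ideal_pow_antimono[OF I, of n "Suc n"] by auto
    then have "- pdiff v s * (s * f) \<in> ideal_pow V P n"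
      by (rule J(4)) (use s in \<open>auto intro: carrier_uminus carrier_pdiff\<close>)
    moreover have "s * pdiff v (s * f) \<in> ideal_pow V P n"
      using J(4)[OF pdiff_ideal_pow[OF I s(2), of v], of s] s(1) by blast
    ultimately have "s * pdiff v (s * f) + - pdiff v s * (s * f) \<in> ideal_pow V P n" by (rule J(3)[rotated])
    also have "s * pdiff v (s * f) + - pdiff v s * (s * f) = (s * s) * pdiff v f"
      by (simp add: pdiff_mult algebra_simps)
    finally show ?thesis .
  qed
  ultimately show ?thesis using symbolic_power_prime_iff carrier_pdiff[OF fC] by auto
qed

end

lemma ideal_pow_power_prod:
  assumes I: "ideal I (mpoly_ring V)" and "finite A" "\<And>v. v \<in> A \<Longrightarrow> g v \<in> I"
  shows "(\<Prod>v\<in>A. g v ^ d v) \<in> ideal_pow V I (\<Sum>v\<in>A. d v)"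
  using assms(2,3)
proof (induction A)
  case (insert v A)
  have one: "g v \<in> ideal_pow V I 1"
  proof -
    have "1 \<otimes>\<^bsub>mpoly_ring V\<^esub> g v \<in> ideal_prod (mpoly_ring V) (carrier (mpoly_ring V)) I"
      by (intro ideal_prod.prod insert.prems) auto
    then show ?thesis using ideal_pow_Suc[of V I 0] by (simp add: ideal_pow_0)
  qed
  have "g v ^ n \<in> ideal_pow V I n" for n
  proof (induction n)
    case (Suc n)
    then show ?case using ideal_pow_mult[OF I one Suc] by simp
  qed (simp add: ideal_pow_0)
  then have "g v ^ d v * (\<Prod>v\<in>A. g v ^ d v) \<in> ideal_pow V I (d v + (\<Sum>v\<in>A. d v))"
    using insert by (intro ideal_pow_mult[OF I]) auto
  then show ?case using insert.hyps by simp
qed (simp add: ideal_pow_0)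

text \<open>The leading monomial has only \<open>k\<close> variables, so it contains no longer
  chain. This makes powers of the \<open>2k\<close>-Pfaffian admissible denominators.\<close>

lemma rank_subst_pfaffian_at_nonzero:
  assumes e: "strict_mono_on {..<2 * k} e"
  shows "rank_subst k (pfaffian_at e k) \<noteq> (0 :: (nat \<times> nat, 'k::field_char_0) mpoly)"
proof -
  have "finite (e ` {..<2 * k})" by simp
  then obtain r where r: "\<And>i. i < 2 * k \<Longrightarrow> e i < r" using finite_nat_set_iff_bounded by auto
  obtain m where m: "skew.leading (pfaffian_at e k :: (nat \<times> nat, 'k) mpoly) m" "keys m = nest_set e k"
    using pfaffian_at_leading[OF e r, where 'k = 'k] by blast
  have "nest.chains_le k (keys m)"
    unfolding nest.chains_le_def
  proof (intro allI impI)
    fix C assume "C \<subseteq> keys m"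
    then have "card C \<le> card (nest_set e k)" unfolding m(2) by (intro card_mono) (simp_all add: nest_set_def)
    also have "\<dots> \<le> k" unfolding nest_set_def using card_image_le[of "{..<k}"] by simp
    finally show "card C \<le> k" .
  qed
  then show ?thesis using rank_subst_nonzero[OF carrier_pfaffian_at[OF r] m(1)] by blast
qed

text \<open>Up to sign and a power of the \<open>2k\<close>-Pfaffian of the first rows and columns, the
  \<open>2(k + q)\<close>-Pfaffian is the Pfaffian of the Schur complement, whose \<open>2q \<times> 2q\<close> entries are
  multiples of \<open>2(k + 1)\<close>-Pfaffians.\<close>

theorem pfaffian_at_symbolic_power:
  assumes e: "strict_mono_on {..<2 * (k + q)} e" and er: "\<And>i. i < 2 * (k + q) \<Longrightarrow> e i < r"
  shows "(pfaffian_at e (k + q) :: (nat \<times> nat, 'k::field_char_0) mpoly) \<in>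
    symbolic_power (mpoly_ring (skew_vars r)) (rank_ideal r k) q"
proof -
  let ?V = "skew_vars r" and ?P = "rank_ideal r k :: (nat \<times> nat, 'k) mpoly set"
  note P = primeideal_rank_ideal[of r k, where 'k = 'k]
  note I = primeideal_mpolyD(1)[OF P]
  let ?f = "pfaffian_at e (k + q) :: (nat \<times> nat, 'k) mpoly"
  define p :: "(nat \<times> nat, 'k) mpoly" where "p = pfaffian_at e k"
  let ?B = "skew_at e (2 * k) :: (nat \<times> nat, 'k) mpoly mat"
  let ?C = "cross_at e (2 * k) (2 * q) :: (nat \<times> nat, 'k) mpoly mat"
  let ?D = "skew_at (\<lambda>i. e (2 * k + i)) (2 * q) :: (nat \<times> nat, 'k) mpoly mat"
  let ?N = "schur ?B ?C ?D"
  have ek: "strict_mono_on {..<2 * k} e" using e by (auto simp: strict_mono_on_def)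
  have detB: "det ?B = p ^ 2" unfolding p_def by (rule pfaffian_at_square[symmetric])
  have p0: "p \<noteq> 0" unfolding p_def by (rule pfaffian_at_nonzero[OF ek])
  then have B0: "det ?B \<noteq> 0" by (simp add: detB)
  have N: "skew_mat (2 * q) ?N"
    by (rule schur_skew[OF skew_mat_skew_at cross_at_carrier skew_mat_skew_at B0])
  define h where "h = subst (\<lambda>(i, j). ?N $$ (i, j)) (pfaffian q)"
  have h2: "h ^ 2 = det ?N" unfolding h_def by (rule subst_sqrt_det[OF pfaffian(2) N])
  have entry: "?N $$ (i, j) \<in> ?P" if ij: "i < 2 * q" "j < 2 * q" for i j
  proof -
    \<comment> \<open>Bordering the leading block by the two indices belonging to \<open>i\<close>
      and \<open>j\<close> gives a Schur complement of size two with off-diagonal entry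
      \<open>?N $$ (i, j)\<close>. Its determinant yields the square of the entry, which is enough
      because the target of the substitution is a domain.\<close>
    define e' where "e' a = (if a < 2 * k then e a else if a = 2 * k then e (2 * k + i) else e (2 * k + j))" for a
    let ?C' = "cross_at e' (2 * k) 2 :: (nat \<times> nat, 'k) mpoly mat"
    let ?D' = "skew_at (\<lambda>i. e' (2 * k + i)) 2 :: (nat \<times> nat, 'k) mpoly mat"
    have B': "skew_at e' (2 * k) = ?B" by (intro eq_matI) (simp_all add: skew_at_def e'_def)
    have col: "col ?C' 0 = col ?C i" "col ?C' 1 = col ?C j"
      using ij by (auto intro!: eq_vecI simp: cross_at_def e'_def)
    have D': "?D' $$ (0, 1) = ?D $$ (i, j)" using ij by (simp add: skew_at_def e'_def)
    have "schur ?B ?C' ?D' $$ (0, 1) =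
        det ?B * ?D' $$ (0, 1) + col ?C' 0 \<bullet> (adj_mat ?B *\<^sub>v col ?C' 1)"
      by (rule schur_index[OF skew_at_carrier cross_at_carrier skew_at_carrier]) auto
    moreover have "?N $$ (i, j) = det ?B * ?D $$ (i, j) + col ?C i \<bullet> (adj_mat ?B *\<^sub>v col ?C j)"
      by (rule schur_index[OF skew_at_carrier cross_at_carrier skew_at_carrier ij])
    ultimately have N': "schur ?B ?C' ?D' $$ (0, 1) = ?N $$ (i, j)" by (simp only: D' col)
    have "skew_mat 2 (schur ?B ?C' ?D')"
      by (rule schur_skew[OF skew_mat_skew_at cross_at_carrier skew_mat_skew_at B0])
    then have sq: "det (schur ?B ?C' ?D') = (?N $$ (i, j)) ^ 2"
      using det_skew_2 N' by metis
    have "det (skew_at e' (2 * k + 2)) * det ?B ^ 2 = det ?B * det (schur ?B ?C' ?D')"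
      unfolding skew_at_four_block B'
      by (rule det_schur[OF skew_at_carrier cross_at_carrier skew_at_carrier])
    then have "det ?B * (det (skew_at e' (2 * k + 2)) * det ?B) = det ?B * (?N $$ (i, j)) ^ 2"
      unfolding sq by (simp only: power2_eq_square mult_ac)
    then have N2: "(?N $$ (i, j)) ^ 2 = det (skew_at e' (2 * k + 2)) * det ?B"
      using B0 by (metis mult_left_cancel)
    have e'r: "e' a < r" if "a < 2 * k + 2" for a using that ij er by (auto simp: e'_def)
    have "?N $$ (i, j) \<in> carrier (mpoly_ring ?V)"
      by (rule carrier_sqrt, unfold N2, intro carrier_mult carrier_det_skew_at) (use e'r er in auto)
    \<comment> \<open>The bordered matrix has size \<open>2 * k + 2\<close>, more than the rank
      \<open>2 * k\<close> allows.\<close>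
    moreover have "rank_subst k ((?N $$ (i, j)) ^ 2) = 0"
      unfolding N2 subst.hom_mult by (subst rank_subst_det) auto
    then have "rank_subst k (?N $$ (i, j)) = 0" by (simp add: subst.hom_power)
    ultimately show ?thesis by (simp add: rank_ideal_def)
  qed
  \<comment> \<open>Since \<open>pfaffian q\<close> is homogeneous of degree \<open>q\<close>, each
    term of \<open>h\<close> is a constant times a product of \<open>q\<close> entries, all lying in
    \<open>?P\<close>.\<close>
  have h: "h \<in> ideal_pow ?V ?P q"
    unfolding h_def subst_def lin_ext_def
  proof (intro ideal_sum[OF ideal_ideal_pow[OF I]] ideal_mpolyD(4)[OF ideal_ideal_pow[OF I]] carrier_const)
    fix m assume m: "m \<in> keys (pfaffian q :: (nat \<times> nat, 'k) mpoly)"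
    then have "total_degree m = q" using homogeneous_pfaffian unfolding homogeneous_def by blast
    moreover have "keys m \<subseteq> skew_vars (2 * q)"
      using m pfaffian(1)[of q, where 'k = 'k] by (auto simp: carrier_mpoly)
    then have "(case v of (i, j) \<Rightarrow> ?N $$ (i, j)) \<in> ?P" if "v \<in> keys m" for v
      using that entry by (cases v) auto
    ultimately show "(\<Prod>v\<in>keys m. (case v of (i, j) \<Rightarrow> ?N $$ (i, j)) ^ lookup m v) \<in> ideal_pow ?V ?P q"
      using ideal_pow_power_prod[OF I finite_keys, of m "\<lambda>(i, j). ?N $$ (i, j)" "lookup m"]
      by (simp add: total_degree_def)
  qed
  \<comment> \<open>All determinants except that of the whole matrix were expressed by
    \<open>p\<close> and \<open>h\<close>, so both sides become squares and their roots agree up to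
    sign.\<close>
  have "?f ^ 2 * det ?B ^ (2 * q) = det ?B * det ?N"
    unfolding pfaffian_at_square distrib_left skew_at_four_block
    by (rule det_schur[OF skew_at_carrier cross_at_carrier skew_at_carrier])
  then have "(p ^ (2 * q) * ?f) ^ 2 = (p * h) ^ 2"
    unfolding detB h2[symmetric] by (simp only: power_mult_distrib power_mult[symmetric] mult.commute)
  then have "p ^ (2 * q) * ?f = p * h \<or> p ^ (2 * q) * ?f = - (p * h)" by (simp only: power2_eq_iff)
  moreover have pC: "p \<in> carrier (mpoly_ring ?V)" unfolding p_def by (rule carrier_pfaffian_at) (simp add: er)
  then have "p * h \<in> ideal_pow ?V ?P q" using ideal_mpolyD(4)[OF ideal_ideal_pow[OF I] h] by blast
  ultimately have "p ^ (2 * q) * ?f \<in> ideal_pow ?V ?P q"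
    using ideal_mpolyD(5)[OF ideal_ideal_pow[OF I]] by metis
  moreover have "p ^ (2 * q) \<in> carrier (mpoly_ring ?V) - ?P"
  proof -
    have "rank_subst k (p ^ (2 * q)) \<noteq> 0"
      using rank_subst_pfaffian_at_nonzero[OF ek, where 'k = 'k] by (simp add: p_def subst.hom_power)
    then show ?thesis using carrier_power[OF pC] by (auto simp: rank_ideal_def)
  qed
  ultimately have "\<exists>s \<in> carrier (mpoly_ring ?V) - ?P. s * ?f \<in> ideal_pow ?V ?P q" by (rule bexI)
  moreover have "?f \<in> carrier (mpoly_ring ?V)" by (rule carrier_pfaffian_at[OF er])
  ultimately show ?thesis unfolding symbolic_power_prime_iff[OF P] by (intro conjI)
qed

lemma chain_pfaffian:
  assumes C: "C \<subseteq> skew_vars r" "nest.chain C"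
  obtains f :: "(nat \<times> nat, 'k::field_char_0) mpoly" and m where
    "f \<in> symbolic_power (mpoly_ring (skew_vars r)) (rank_ideal r k) (card C - k)"
    "skew.leading f m" "keys m = C" "\<And>v. v \<in> C \<Longrightarrow> lookup m v = 1"
proof -
  note P = primeideal_rank_ideal[of r k, where 'k = 'k]
  obtain e where e: "strict_mono_on {..<2 * card C} e" "\<And>i. i < 2 * card C \<Longrightarrow> e i < r"
    "C = nest_set e (card C)"
    using nest_chain_enumeration[OF C refl] by blast
  let ?f = "pfaffian_at e (card C) :: (nat \<times> nat, 'k) mpoly"
  have "?f \<in> symbolic_power (mpoly_ring (skew_vars r)) (rank_ideal r k) (card C - k)"
  proof (cases "k \<le> card C")
    case True
    then have eq: "k + (card C - k) = card C" by simp
    show ?thesis using pfaffian_at_symbolic_power[of k "card C - k" e r, where 'k = 'k] e(1,2)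
      unfolding eq by blast
  next
    \<comment> \<open>Here \<open>card C - k\<close> is truncated to zero and the symbolic power is
      the whole ring.\<close>
    case False
    then show ?thesis using symbolic_power_0[OF P] carrier_pfaffian_at[OF e(2)] by simp
  qed
  then show ?thesis
    using pfaffian_at_leading[OF e(1,2), where 'k = 'k] that e(3) by metis
qed

lemma leading_off_degree:
  fixes f :: "(nat \<times> nat, 'k::field_char_0) mpoly"
  assumes f: "f \<in> symbolic_power (mpoly_ring (skew_vars r)) (rank_ideal r k) n"
    and m: "skew.leading f m" and F: "nest.chains_le k F"
  shows "n \<le> (\<Sum>v\<in>skew_vars r - F. lookup m v)"
  using f m
proof (induction n arbitrary: f m)
  case (Suc n)
  note P = primeideal_rank_ideal[of r k, where 'k = 'k]
  have fP: "f \<in> rank_ideal r k" using symbolic_power_subset[OF P, of "Suc n"] Suc.prems(1) by auto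
  then have fC: "f \<in> carrier (mpoly_ring (skew_vars r))" by (simp add: rank_ideal_def)
  have mf: "lookup f m \<noteq> 0" "\<And>m'. m' \<in> keys f \<Longrightarrow> m' = m \<or> skew.lt m' m"
    using Suc.prems(2) by (auto simp: is_leading_monomial_def)
  have "\<not> nest.chains_le k (keys m)"
    using rank_subst_nonzero[OF fC Suc.prems(2)] fP by (auto simp: rank_ideal_def)
  then have "\<not> keys m \<subseteq> F" using F unfolding nest.chains_le_def by blast
  then obtain v where v: "v \<in> keys m" "v \<notin> F" by blast
  have "keys m \<subseteq> skew_vars r" using fC mf(1) by (auto simp: carrier_mpoly Poly_Mapping.in_keys_iff)
  then have vV: "v \<in> skew_vars r - F" using v by blast
  define n' where "n' = m - single v 1"
  have mn: "m = n' + single v 1" using exponent_minus_single[OF in_keysD[OF v(1)]] by (simp add: n'_def)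
  \<comment> \<open>Differentiation divides all surviving monomials by the same variable, which
    preserves their order, and in characteristic zero the leading one survives. The degree off
    \<open>F\<close> drops by exactly one.\<close>
  have "skew.leading (pdiff v f) n'"
    unfolding is_leading_monomial_def
  proof (intro conjI ballI)
    have "lookup (pdiff v f) n' = of_nat (Suc (lookup n' v)) * lookup f m"
      by (simp only: lookup_pdiff mn[symmetric])
    then have "lookup (pdiff v f) n' \<noteq> 0" using mf(1) by (simp del: of_nat_Suc)
    then show "n' \<in> keys (pdiff v f)" by (simp add: Poly_Mapping.in_keys_iff)
    fix m' assume "m' \<in> keys (pdiff v f)"
    then have "m' + single v 1 \<in> keys f" by (auto simp: Poly_Mapping.in_keys_iff lookup_pdiff)
    then have "m' + single v 1 = n' + single v 1 \<or> skew.lt (m' + single v 1) (n' + single v 1)"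
      using mf(2) mn by metis
    then show "m' = n' \<or> skew.lt m' n'" by (simp only: skew.lt_add_iff add_right_cancel)
  qed
  then have "n \<le> (\<Sum>v\<in>skew_vars r - F. lookup n' v)"
    using Suc.IH pdiff_symbolic_power[OF P Suc.prems(1)] by blast
  moreover have "(\<Sum>w\<in>skew_vars r - F. lookup m w) = (\<Sum>w\<in>skew_vars r - F. lookup n' w) + 1"
    using vV finite_skew_vars by (subst mn) (simp add: lookup_add lookup_single_if sum.distrib)
  ultimately show ?case by simp
qed simp

text \<open>The Pfaffians of the chains from the duality multiply to an element of the right
  symbolic power. A variable lies in at most as many chains as its exponent in \<open>m\<close>, so
  the leading monomial of the product divides \<open>m\<close>, and a monomial factor fills the
  gap.\<close>

lemma leading_exists:
  assumes mV: "keys m \<subseteq> skew_vars r"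
    and deg: "\<And>F. F \<subseteq> skew_vars r \<Longrightarrow> nest.chains_le k F \<Longrightarrow> n \<le> (\<Sum>v\<in>skew_vars r - F. lookup m v)"
  shows "\<exists>f \<in> symbolic_power (mpoly_ring (skew_vars r)) (rank_ideal r k :: (nat \<times> nat, 'k::field_char_0) mpoly set) n.
    skew.leading f m"
proof -
  let ?sp = "symbolic_power (mpoly_ring (skew_vars r)) (rank_ideal r k :: (nat \<times> nat, 'k) mpoly set)"
  note P = primeideal_rank_ideal[of r k, where 'k = 'k]
  obtain J :: "((nat \<times> nat) \<times> nat) set" and C where J: "finite J"
    and C: "\<And>j. j \<in> J \<Longrightarrow> C j \<subseteq> skew_vars r" "\<And>j. j \<in> J \<Longrightarrow> nest.chain (C j)"
    and mult: "\<And>v. v \<in> skew_vars r \<Longrightarrow> card {j\<in>J. v \<in> C j} \<le> lookup m v"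
    and n: "n \<le> (\<Sum>j\<in>J. card (C j) - k)"
    using nest.weighted_chain_duality[OF finite_skew_vars deg] by blast
  have "\<exists>f p. f \<in> ?sp (card (C j) - k) \<and> skew.leading f p \<and> keys p = C j \<and> (\<forall>v\<in>C j. lookup p v = 1)"
    if "j \<in> J" for j
    using chain_pfaffian[OF C(1,2)[OF that], of k, where 'k = 'k] by metis
  then obtain f p where f: "\<And>j. j \<in> J \<Longrightarrow> f j \<in> ?sp (card (C j) - k)"
    and p: "\<And>j. j \<in> J \<Longrightarrow> skew.leading (f j) (p j)" "\<And>j. j \<in> J \<Longrightarrow> keys (p j) = C j"
      "\<And>j v. j \<in> J \<Longrightarrow> v \<in> C j \<Longrightarrow> lookup (p j) v = 1"
    by metis
  define q where "q = (\<Sum>j\<in>J. p j)"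
  have q: "lookup q v = card {j\<in>J. v \<in> C j}" for v
  proof -
    have "lookup (p j) v = (if v \<in> C j then 1 else 0)" if "j \<in> J" for j
      using p(2,3)[OF that] by (auto simp: Poly_Mapping.in_keys_iff)
    then have "lookup q v = (\<Sum>j\<in>J. if v \<in> C j then 1 else 0)" by (simp add: q_def lookup_sum)
    then show ?thesis using J by (simp add: sum.If_cases Int_def)
  qed
  have qm: "lookup q v \<le> lookup m v" for v
  proof (cases "v \<in> skew_vars r")
    case False
    then have "{j\<in>J. v \<in> C j} = {}" using C(1) by blast
    then have "lookup q v = 0" unfolding q by (simp only: card.empty)
    then show ?thesis by simp
  qed (simp add: q mult)
  have m: "(m - q) + q = m" using qm by (intro poly_mapping_eqI) (simp add: lookup_add lookup_minus)
  have "(\<Prod>j\<in>J. f j) \<in> ?sp (\<Sum>j\<in>J. card (C j) - k)" by (rule symbolic_power_prod[OF P J f])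
  then have fn: "(\<Prod>j\<in>J. f j) \<in> ?sp n" using symbolic_power_antimono[OF P n] by blast
  have "keys (m - q) \<subseteq> keys m" by (auto simp: Poly_Mapping.in_keys_iff lookup_minus)
  then have "single (m - q) 1 \<in> carrier (mpoly_ring (skew_vars r) :: (nat \<times> nat, 'k) mpoly ring)"
    using mV by (intro carrier_singleI) blast
  then have "single (m - q) 1 * (\<Prod>j\<in>J. f j) \<in> ?sp n"
    by (rule ideal_mpolyD(4)[OF ideal_symbolic_power_prime[OF P] fn])
  moreover have "skew.leading (\<Prod>j\<in>J. f j) q" unfolding q_def by (rule skew.leading_prod[OF J p(1)])
  then have "skew.leading (single (m - q) 1 * (\<Prod>j\<in>J. f j)) m"
    using skew.leading_mult(2)[OF skew.leading_single[of "1 :: 'k" "m - q"]] m by fastforce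
  ultimately show ?thesis by blast
qed

section \<open>Comparison of the two initial ideals\<close>

definition nest_complex :: "nat \<Rightarrow> nat \<Rightarrow> (nat \<times> nat) set set" where
  "nest_complex r k = {F. F \<subseteq> skew_vars r \<and> nest.chains_le k F}"

lemma simplicial_complex_nest: "simplicial_complex (skew_vars r) (nest_complex r k)"
proof
  show "{} \<in> nest_complex r k" by (simp add: nest_complex_def nest.chains_le_def)
  show "G \<in> nest_complex r k" if "F \<in> nest_complex r k" "G \<subseteq> F" for F G
    using that unfolding nest_complex_def nest.chains_le_def by blast
qed (auto simp: nest_complex_def finite_skew_vars)

text \<open>The case of exponent one: a monomial whose support is not a face has degree at least one
  off every face, so \<open>leading_exists\<close> realizes it as a leading monomial in the
  prime.\<close>

lemma initial_ideal_rank_ideal: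
  "initial_ideal (skew_vars r) skew.lt (rank_ideal r k :: (nat \<times> nat, 'k::field_char_0) mpoly set) =
    simplicial_complex.stanley_reisner (skew_vars r) (nest_complex r k)"
proof -
  interpret simplicial_complex "skew_vars r" "nest_complex r k" by (rule simplicial_complex_nest)
  note P = primeideal_rank_ideal[of r k, where 'k = 'k]
  let ?P = "rank_ideal r k :: (nat \<times> nat, 'k) mpoly set"
  have "(\<exists>f\<in>?P. skew.leading f m) \<longleftrightarrow> keys m \<notin> nest_complex r k" if mV: "keys m \<subseteq> skew_vars r" for m
  proof
    assume "\<exists>f\<in>?P. skew.leading f m"
    then obtain f where f: "f \<in> ?P" "skew.leading f m" by blast
    then show "keys m \<notin> nest_complex r k"
      using rank_subst_nonzero[of f r m k] by (auto simp: rank_ideal_def nest_complex_def)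
  next
    assume "keys m \<notin> nest_complex r k"
    then have not_le: "\<not> nest.chains_le k (keys m)" using mV by (simp add: nest_complex_def)
    have "1 \<le> (\<Sum>v\<in>skew_vars r - F. lookup m v)" if F: "nest.chains_le k F" for F
    proof -
      have "\<not> keys m \<subseteq> F" using not_le F unfolding nest.chains_le_def by blast
      then obtain v where v: "v \<in> keys m" "v \<in> skew_vars r - F" using mV by blast
      have "lookup m v \<le> (\<Sum>v\<in>skew_vars r - F. lookup m v)"
        using v finite_skew_vars by (intro member_le_sum) auto
      then show ?thesis using in_keysD[OF v(1)] by linarith
    qed
    then obtain f where "f \<in> symbolic_power (mpoly_ring (skew_vars r)) ?P 1" "skew.leading f m"
      using leading_exists[OF mV, of k 1, where 'k = 'k] by blast
    then show "\<exists>f\<in>?P. skew.leading f m" using symbolic_power_subset[OF P, of 1] by blast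
  qed
  then show ?thesis
    unfolding skew.initial_ideal_eq[OF primeideal_mpolyD(1)[OF P]] stanley_reisner_def
    by (intro Collect_cong conj_cong refl ball_cong) (auto simp: carrier_mpoly)
qed

theorem corollary7p18:
  fixes r t n :: nat
  assumes "1 \<le> t" and "t \<le> r div 2"
  shows "initial_ideal (skew_vars r) (lex_less skew_var_greater)
           (symbolic_power (mpoly_ring (skew_vars r))
              (pfaffian_ideal r t :: (nat \<times> nat, 'k::field_char_0) mpoly set) n)
       = symbolic_power (mpoly_ring (skew_vars r))
           (initial_ideal (skew_vars r) (lex_less skew_var_greater) (pfaffian_ideal r t)) n"
proof -
  let ?k = "t - 1"
  let ?P = "rank_ideal r ?k :: (nat \<times> nat, 'k) mpoly set"
  note P = primeideal_rank_ideal[of r ?k, where 'k = 'k]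
  interpret simplicial_complex "skew_vars r" "nest_complex r ?k" by (rule simplicial_complex_nest)
  \<comment> \<open>Both sides of the theorem are spanned by monomials, so it is enough to match
    their conditions on a single exponent \<open>m\<close>.\<close>
  have "(\<exists>f \<in> symbolic_power (mpoly_ring (skew_vars r)) ?P n. skew.leading f m) \<longleftrightarrow>
      (\<forall>F\<in>nest_complex r ?k. n \<le> off_degree F m)" if mV: "keys m \<subseteq> skew_vars r" for m
  proof
    assume "\<exists>f \<in> symbolic_power (mpoly_ring (skew_vars r)) ?P n. skew.leading f m"
    then show "\<forall>F\<in>nest_complex r ?k. n \<le> off_degree F m"
      using leading_off_degree unfolding off_degree_def nest_complex_def by blast
  next
    assume "\<forall>F\<in>nest_complex r ?k. n \<le> off_degree F m"
    then show "\<exists>f \<in> symbolic_power (mpoly_ring (skew_vars r)) ?P n. skew.leading f m"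
      by (intro leading_exists[OF mV]) (auto simp: off_degree_def nest_complex_def)
  qed
  then have "initial_ideal (skew_vars r) skew.lt (symbolic_power (mpoly_ring (skew_vars r)) ?P n) =
      symbolic_power (mpoly_ring (skew_vars r)) (stanley_reisner :: (nat \<times> nat, 'k) mpoly set) n"
    unfolding skew.initial_ideal_eq[OF ideal_symbolic_power_prime[OF P]] symbolic_power_stanley_reisner
    by (intro Collect_cong conj_cong refl ball_cong) (auto simp: carrier_mpoly)
  then show ?thesis
    unfolding pfaffian_ideal_eq[OF assms(1)] initial_ideal_rank_ideal .
qed

end
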